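(* Let $\mathcal{A}$ be a simplicial arrangement of $n$ lines in $\mathbb{RP}^2$. If the dual points of $k$ lines of $\mathcal{A}$ belong to the same irreducible cubic curve (in the dual real projective plane), then $$n\ \ge\ \frac{8}{7}k-3 .$$
   Context: A line arrangement is a finite set $\mathcal{A}$ of lines in the real projective plane $\mathbb{RP}^2$. It is simplicial if every connected component of $\mathbb{RP}^2\setminus\bigcup_{L\in\mathcal{A}}L$ is a triangle. The dual point of a line $\{[x:y:z]: ax+by+cz=0\}$ is the point $[a:b:c]$ of the dual real projective plane. An irreducible cubic curve is the real zero locus of an irreducible homogeneous real polynomial of degree $3$; it may be singular (nodal, cuspidal or acnodal), and its singular point, including an isolated real one, belongs to it. *)

theory Defs
  imports "HOL-Analysis.Analysis" "HOL-Computational_Algebra.Computational_Algebra"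
begin

definition proportional :: "real^3 \<Rightarrow> real^3 \<Rightarrow> bool" where
  "proportional u v \<longleftrightarrow> u \<noteq> 0 \<and> v \<noteq> 0 \<and> (\<exists>c. c \<noteq> 0 \<and> u = c *\<^sub>R v)"

lemma part_equivp_proportional: "part_equivp proportional"
proof (rule part_equivpI)
  show "\<exists>x. proportional x x"
    unfolding proportional_def
    by (intro exI[of _ "axis 1 1 :: real^3"] conjI exI[of _ "1::real"]) (auto simp: axis_eq_0_iff)
  show "symp proportional"
  proof (rule sympI)
    fix u v assume "proportional u v"
    then obtain c where "u \<noteq> 0" "v \<noteq> 0" "c \<noteq> 0" "u = c *\<^sub>R v"
      unfolding proportional_def by blast
    then show "proportional v u"
      unfolding proportional_def by (intro conjI exI[of _ "inverse c"]) auto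
  qed
  show "transp proportional"
  proof (rule transpI)
    fix u v w assume "proportional u v" "proportional v w"
    then obtain c d where "u \<noteq> 0" "w \<noteq> 0" "c \<noteq> 0" "u = c *\<^sub>R v" "d \<noteq> 0" "v = d *\<^sub>R w"
      unfolding proportional_def by blast
    then show "proportional u w"
      unfolding proportional_def by (intro conjI exI[of _ "c * d"]) auto
  qed
qed

text \<open>
  The real projective plane. The point with homogeneous coordinates \<open>v\<close> is \<open>hpoint v\<close>; this is
  meaningful only for \<open>v \<noteq> 0\<close>. The dual plane is represented by the same type, the
  coordinates then being the coefficients \<open>[a:b:c]\<close> of linear forms.
\<close>

quotient_type rp2 = "real^3" / partial: proportional
  morphisms rep_rp2 hpoint
  by (rule part_equivp_proportional)

lemma hpoint_eq_iff:
  assumes "u \<noteq> 0" "v \<noteq> 0"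
  shows "hpoint u = hpoint v \<longleftrightarrow> (\<exists>c. c \<noteq> 0 \<and> u = c *\<^sub>R v)"
proof -
  have "proportional w w" if "w \<noteq> 0" for w
    unfolding proportional_def using that by (intro conjI exI[of _ "1::real"]) auto
  then have "hpoint u = hpoint v \<longleftrightarrow> proportional u v"
    using assms Quotient3_rel[OF Quotient3_rp2, of u v] by blast
  then show ?thesis
    using assms by (simp add: proportional_def)
qed

text \<open>The quotient topology of \<open>\<real>\<^sup>3 - {0}\<close>.\<close>

instantiation rp2 :: topological_space
begin

definition open_rp2 :: "rp2 set \<Rightarrow> bool" where
  "open_rp2 U \<longleftrightarrow> open {v. v \<noteq> 0 \<and> hpoint v \<in> U}"

instance
proof
  have "{v :: real^3. v \<noteq> 0 \<and> hpoint v \<in> UNIV} = - {0}"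
    by auto
  then show "open (UNIV :: rp2 set)"
    unfolding open_rp2_def by (simp only: open_Compl closed_singleton)
next
  fix S T :: "rp2 set"
  assume "open S" "open T"
  moreover have "{v. v \<noteq> 0 \<and> hpoint v \<in> S \<inter> T}
      = {v. v \<noteq> 0 \<and> hpoint v \<in> S} \<inter> {v. v \<noteq> 0 \<and> hpoint v \<in> T}"
    by auto
  ultimately show "open (S \<inter> T)"
    unfolding open_rp2_def by (simp only: open_Int)
next
  fix K :: "rp2 set set"
  assume "\<forall>S\<in>K. open S"
  moreover have "{v. v \<noteq> 0 \<and> hpoint v \<in> \<Union>K} = (\<Union>S\<in>K. {v. v \<noteq> 0 \<and> hpoint v \<in> S})"
    by auto
  ultimately show "open (\<Union>K)"
    unfolding open_rp2_def by (simp only: open_UN)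
qed

end

definition proj_line :: "real^3 \<Rightarrow> rp2 set" where
  "proj_line a = {hpoint v |v. v \<noteq> 0 \<and> a \<bullet> v = 0}"

definition line_arrangement :: "rp2 set set \<Rightarrow> bool" where
  "line_arrangement \<A> \<longleftrightarrow> finite \<A> \<and> (\<forall>L\<in>\<A>. \<exists>a. a \<noteq> 0 \<and> L = proj_line a)"

text \<open>
  Open triangles with vertices \<open>hpoint u\<close>, \<open>hpoint v\<close>, \<open>hpoint w\<close>. Three non-collinear
  points are the vertices of four triangles, corresponding to the choices of signs of the
  representatives \<open>u\<close>, \<open>v\<close>, \<open>w\<close>.
\<close>

definition open_triangle :: "rp2 set \<Rightarrow> bool" where
  "open_triangle T \<longleftrightarrow>
    (\<exists>u v w :: real^3. card {u, v, w} = 3 \<and> independent {u, v, w} \<and>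
       T = {hpoint (\<alpha> *\<^sub>R u + \<beta> *\<^sub>R v + \<gamma> *\<^sub>R w) |\<alpha> \<beta> \<gamma>. \<alpha> > 0 \<and> \<beta> > 0 \<and> \<gamma> > 0})"

definition simplicial_arrangement :: "rp2 set set \<Rightarrow> bool" where
  "simplicial_arrangement \<A> \<longleftrightarrow>
    line_arrangement \<A> \<and> (\<forall>R \<in> components (- \<Union>\<A>). open_triangle R)"

definition dual_point :: "rp2 set \<Rightarrow> rp2" where
  "dual_point L = (THE p. \<exists>a. a \<noteq> 0 \<and> L = proj_line a \<and> p = hpoint a)"

lemma hpoint_in_proj_line:
  assumes "v \<noteq> 0"
  shows "hpoint v \<in> proj_line a \<longleftrightarrow> a \<bullet> v = 0"
proof
  assume "hpoint v \<in> proj_line a"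
  then obtain w where "w \<noteq> 0" "a \<bullet> w = 0" "hpoint v = hpoint w"
    unfolding proj_line_def by blast
  then show "a \<bullet> v = 0"
    using assms by (auto simp: hpoint_eq_iff)
qed (use assms in \<open>auto simp: proj_line_def\<close>)

lemma proj_line_eqD:
  assumes "a \<noteq> 0" "b \<noteq> 0" "proj_line a = proj_line b"
  shows "hpoint a = hpoint b"
proof -
  have *: "a \<bullet> v = 0 \<longleftrightarrow> b \<bullet> v = 0" for v
  proof (cases "v = 0")
    case False
    then show ?thesis
      using hpoint_in_proj_line[of v a] hpoint_in_proj_line[of v b] assms(3) by simp
  qed simp
  define c where "c = (a \<bullet> b) / (b \<bullet> b)"
  have "b \<bullet> (a - c *\<^sub>R b) = 0"
    using assms(2) by (simp add: c_def inner_diff_right inner_commute)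
  then have "(a - c *\<^sub>R b) \<bullet> (a - c *\<^sub>R b) = 0"
    using *[of "a - c *\<^sub>R b"] by (simp add: inner_diff_left)
  then have "a = c *\<^sub>R b"
    by simp
  moreover from this have "c \<noteq> 0"
    using assms(1) by auto
  ultimately show ?thesis
    using assms by (auto simp: hpoint_eq_iff)
qed

lemma dual_point_proj_line:
  assumes "a \<noteq> 0"
  shows "dual_point (proj_line a) = hpoint a"
  unfolding dual_point_def
  by (rule the_equality) (use assms proj_line_eqD in blast)+

text \<open>
  Ternary polynomials are elements of \<open>\<real>[x][y][z]\<close>: the coefficient of \<open>x\<^sup>i y\<^sup>j z\<^sup>k\<close> in \<open>F\<close>
  is \<open>coeff (coeff (coeff F k) j) i\<close>.
\<close>

definition eval3 :: "real poly poly poly \<Rightarrow> real^3 \<Rightarrow> real" where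
  "eval3 F v = poly (poly (poly F [:[:v $ 3:]:]) [:v $ 2:]) (v $ 1)"

lemma eval3_eq_sum:
  "eval3 F v = (\<Sum>k\<le>degree F. \<Sum>j\<le>degree (coeff F k). \<Sum>i\<le>degree (coeff (coeff F k) j).
     coeff (coeff (coeff F k) j) i * (v $ 1) ^ i * (v $ 2) ^ j * (v $ 3) ^ k)"
proof -
  have 1: "poly (poly p [:b:]) a = (\<Sum>j\<le>degree p. poly (coeff p j) a * b ^ j)"
    for p :: "real poly poly" and a b
    by (simp add: poly_altdef[of p] poly_sum)
  have "poly (poly F [:[:c:]:]) q = (\<Sum>k\<le>degree F. poly (coeff F k) q * [:c:] ^ k)" for c q
    by (simp add: poly_altdef[of F] poly_sum)
  then have "eval3 F v = (\<Sum>k\<le>degree F. poly (poly (coeff F k) [:v $ 2:]) (v $ 1) * (v $ 3) ^ k)"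
    by (simp add: eval3_def poly_sum)
  also have "\<dots> = (\<Sum>k\<le>degree F. (\<Sum>j\<le>degree (coeff F k).
      (\<Sum>i\<le>degree (coeff (coeff F k) j). coeff (coeff (coeff F k) j) i * (v $ 1) ^ i)
        * (v $ 2) ^ j) * (v $ 3) ^ k)"
    by (simp only: 1 poly_altdef[of "coeff (coeff _ _) _"])
  finally show ?thesis
    by (simp add: sum_distrib_right)
qed

definition homogeneous :: "nat \<Rightarrow> real poly poly poly \<Rightarrow> bool" where
  "homogeneous d F \<longleftrightarrow>
    (\<forall>i j k. coeff (coeff (coeff F k) j) i \<noteq> 0 \<longrightarrow> i + j + k = d)"

definition zero_locus :: "real poly poly poly \<Rightarrow> rp2 set" where
  "zero_locus F = {hpoint v |v. v \<noteq> 0 \<and> eval3 F v = 0}"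

text \<open>
  The zero polynomial satisfies \<open>homogeneous 3\<close> but is not irreducible.
\<close>

definition irreducible_cubic_curve :: "rp2 set \<Rightarrow> bool" where
  "irreducible_cubic_curve C \<longleftrightarrow>
    (\<exists>F. homogeneous 3 F \<and> irreducible F \<and> C = zero_locus F)"

end

theory Submission
  imports Defs "HOL-Real_Asymp.Real_Asymp"
begin

text \<open>
  A path of points that passes from a line \<open>q\<^sub>1\<close> of a simplicial arrangement to a line \<open>q\<^sub>2\<close> without
  meeting another line stays in one triangle, so no line separates the start of the path from the
  intersection point of \<open>q\<^sub>1\<close> and \<open>q\<^sub>2\<close>. In the dual plane the path is a family of lines that meets
  the dual points one after the other. For a family that meets the points of an arc without flexes in
  their order along the arc, convexity contradicts this, unless between any two consecutive points
  (apart from the first and the last ones) the family also meets a dual point off the cubic.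

  A real irreducible cubic has a real flex, so it is projectively equivalent to
  \<open>y\<^sup>2 = x\<^sup>3 + p x + q\<close>. Let \<open>e\<close> be the largest root of the right-hand side, \<open>m\<close> the number of dual points off
  the cubic, and \<open>K\<close> and \<open>D\<close> the sets of dual points on the cubic with \<open>x < e\<close> and with \<open>x \<ge> e\<close>.
  The part \<open>x \<ge> e\<close> consists of three arcs without flexes, and the family of tangents to a branch
  beyond the flex shows that each of them contains at most \<open>2 m + 3\<close> dual points. If \<open>K\<close> is
  nonempty, the lines supporting \<open>K\<close> from above and from below yield \<open>|D| \<le> m + 5\<close>. Finally, on the line
  dual to a point of \<open>K\<close> no two neighbouring vertices are double points, whence
  \<open>|K| \<le> 2 (|D| + m) + 3\<close>. In all cases the cubic contains at most \<open>7 m + 21\<close> dual points.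
\<close>

section \<open>Faces of simplicial arrangements\<close>

text \<open>The constants come from a count against m. The flex at infinity, a possible singular
  point with abscissa \<open>e\<close>, three arcs of at most 2 m + 3 points and a set
  \<open>K\<close> of at most m + 10 points make 1 + 1 + 3 (2 m + 3) + (m + 10) = 7 m + 21; this is
  why m + 10 is the threshold for \<open>K\<close>. A larger \<open>K\<close> is controlled by
  \<open>D\<close> and leaves only 5 m + 19. As n is m plus the number of dual points on the cubic,
  7 m + 21 is the same as 8 k \<le> 7 n + 21. The factor 2 stems from convexity: relative to a
  moving tangent a fixed point first sinks and then rises, so it is met at most twice. The loss of 3
  per arc stems from the convexity argument, which compares a pair of consecutive points with one
  point before and one point after it. The obstacle is degeneracy. Tangents touch their own branch,
  supporting lines touch \<open>K\<close>, and one line can contain several dual points. All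
  families are therefore shifted by a small generic \<epsilon>, and much of the work consists in
  showing that the order of the crossings survives the shift and that only points off the cubic and
  dual points at infinity can still interfere.\<close>

lemma continuous_on_hpoint: "continuous_on (- {0}) hpoint"
  unfolding continuous_on_open_invariant
proof (intro allI impI)
  fix B :: "rp2 set" assume "open B"
  then have "open {v. v \<noteq> 0 \<and> hpoint v \<in> B}"
    by (simp add: open_rp2_def)
  moreover have "{v. v \<noteq> 0 \<and> hpoint v \<in> B} \<inter> - {0} = hpoint -` B \<inter> - {0}"
    by auto
  ultimately show "\<exists>A. open A \<and> A \<inter> - {0} = hpoint -` B \<inter> - {0}"
    by blast
qed

lemma hpoint_notin_lines:
  assumes "v \<noteq> 0"
  shows "hpoint v \<in> - \<Union>(proj_line ` R) \<longleftrightarrow> (\<forall>r\<in>R. r \<bullet> v \<noteq> 0)"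
  using assms by (auto simp: hpoint_in_proj_line)

lemma same_sign_IVT:
  fixes h :: "real \<Rightarrow> real"
  assumes "continuous_on {a..b} h" "a \<le> b" "\<And>x. x \<in> {a..b} \<Longrightarrow> h x \<noteq> 0"
  shows "h a * h b > 0"
proof (rule ccontr)
  assume "\<not> ?thesis"
  moreover have "h a \<noteq> 0" "h b \<noteq> 0" using assms by auto
  ultimately consider "h a < 0" "h b > 0" | "h a > 0" "h b < 0"
    by (meson linorder_neqE_linordered_idom mult_neg_neg mult_pos_pos)
  then show False
  proof cases
    case 1
    then obtain x where "a \<le> x" "x \<le> b" "h x = 0"
      using IVT'[of h a 0 b] assms by (auto simp: less_imp_le)
    then show False using assms(3) by auto
  next
    case 2
    then obtain x where "a \<le> x" "x \<le> b" "h x = 0"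
      using IVT2'[of h b 0 a] assms by (auto simp: less_imp_le)
    then show False using assms(3) by auto
  qed
qed

section \<open>Triangular faces as cones spanned by signed vertices\<close>

lemma ex_coordinates:
  fixes U V W :: "real^3"
  assumes "card {U, V, W} = 3" "independent {U, V, W}"
  shows "\<exists>g1 g2 g3 :: real^3 \<Rightarrow> real. linear g1 \<and> linear g2 \<and> linear g3 \<and>
     (\<forall>\<alpha> \<beta> \<gamma>. g1 (\<alpha> *\<^sub>R U + \<beta> *\<^sub>R V + \<gamma> *\<^sub>R W) = \<alpha> \<and> g2 (\<alpha> *\<^sub>R U + \<beta> *\<^sub>R V + \<gamma> *\<^sub>R W) = \<beta> \<and>
        g3 (\<alpha> *\<^sub>R U + \<beta> *\<^sub>R V + \<gamma> *\<^sub>R W) = \<gamma>) \<and>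
     (\<forall>x. x = g1 x *\<^sub>R U + g2 x *\<^sub>R V + g3 x *\<^sub>R W)"
proof -
  have d: "U \<noteq> V" "U \<noteq> W" "V \<noteq> W"
    using assms(1) by (auto simp: card_insert_if split: if_splits)
  have ext: "\<exists>g. linear g \<and> (\<forall>x\<in>{U, V, W}. g x = f x)" for f :: "real^3 \<Rightarrow> real"
    using linear_independent_extend[OF assms(2)] by blast
  obtain g1 where g1: "linear g1" "\<forall>x\<in>{U, V, W}. g1 x = (if x = U then 1 else 0 :: real)"
    using ext[of "\<lambda>x. if x = U then 1 else 0"] by blast
  obtain g2 where g2: "linear g2" "\<forall>x\<in>{U, V, W}. g2 x = (if x = V then 1 else 0 :: real)"
    using ext[of "\<lambda>x. if x = V then 1 else 0"] by blast
  obtain g3 where g3: "linear g3" "\<forall>x\<in>{U, V, W}. g3 x = (if x = W then 1 else 0 :: real)"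
    using ext[of "\<lambda>x. if x = W then 1 else 0"] by blast
  note lin = linear_add linear_scale
  have g: "g1 (\<alpha> *\<^sub>R U + \<beta> *\<^sub>R V + \<gamma> *\<^sub>R W) = \<alpha>" "g2 (\<alpha> *\<^sub>R U + \<beta> *\<^sub>R V + \<gamma> *\<^sub>R W) = \<beta>"
    "g3 (\<alpha> *\<^sub>R U + \<beta> *\<^sub>R V + \<gamma> *\<^sub>R W) = \<gamma>" for \<alpha> \<beta> \<gamma>
    using g1 g2 g3 d by (simp_all add: lin)
  have "span {U, V, W} = UNIV"
    using card_eq_dim[of "{U, V, W}" UNIV] assms by (auto simp: dim_UNIV)
  have rep: "x = g1 x *\<^sub>R U + g2 x *\<^sub>R V + g3 x *\<^sub>R W" for x
  proof -
    have "x \<in> span {U, V, W}" using \<open>span {U, V, W} = UNIV\<close> by simp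
    then obtain a b c where "x = a *\<^sub>R U + b *\<^sub>R V + c *\<^sub>R W"
      unfolding span_insert span_empty by (auto simp: algebra_simps)
    then show ?thesis using g by simp
  qed
  show ?thesis
    by (intro exI[of _ g1] exI[of _ g2] exI[of _ g3] conjI allI g1(1) g2(1) g3(1) g rep)
qed

text \<open>The triangle with vertices \<open>U\<close>, \<open>V\<close>, \<open>W\<close> selected by the signs of the representatives.\<close>

definition tri :: "real^3 \<Rightarrow> real^3 \<Rightarrow> real^3 \<Rightarrow> rp2 set" where
  "tri U V W = {hpoint (\<alpha> *\<^sub>R U + \<beta> *\<^sub>R V + \<gamma> *\<^sub>R W) |\<alpha> \<beta> \<gamma>. \<alpha> > 0 \<and> \<beta> > 0 \<and> \<gamma> > 0}"

lemma tri_perm: "tri U V W = tri V U W" "tri U V W = tri U W V"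
proof -
  have "tri U V W \<subseteq> tri V U W" "tri U V W \<subseteq> tri U W V" for U V W
    unfolding tri_def by (auto simp: add_ac) (metis add.commute add.left_commute)+
  then show "tri U V W = tri V U W" "tri U V W = tri U W V" by blast+
qed

text \<open>\<open>R\<close> consists of normal vectors of the lines. Keeping representatives of the
  vertices turns the position of a line relative to the face into the signs of three inner
  products.\<close>

definition face_cone :: "(real^3) set \<Rightarrow> real^3 \<Rightarrow> real^3 \<Rightarrow> real^3 \<Rightarrow> bool" where
  "face_cone R U V W \<longleftrightarrow> card {U, V, W} = 3 \<and> independent {U, V, W} \<and>
     tri U V W \<in> components (- \<Union>(proj_line ` R))"

lemma face_cone_perm:
  assumes "face_cone R U V W"
  shows "face_cone R V U W" "face_cone R U W V"
  using assms tri_perm unfolding face_cone_def by (simp_all add: insert_commute)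

lemma ex_face_cone:
  assumes "simplicial_arrangement (proj_line ` R)" "connected X" "X \<noteq> {}"
    and "\<And>v. v \<in> X \<Longrightarrow> v \<noteq> 0 \<and> (\<forall>r\<in>R. r \<bullet> v \<noteq> 0)"
  shows "\<exists>U V W. face_cone R U V W \<and> hpoint ` X \<subseteq> tri U V W"
proof -
  have "continuous_on X hpoint"
    using continuous_on_hpoint by (rule continuous_on_subset) (use assms(4) in auto)
  then have "connected (hpoint ` X)"
    using assms(2) connected_continuous_image by blast
  moreover have "hpoint ` X \<subseteq> - \<Union>(proj_line ` R)"
    using assms(4) hpoint_notin_lines by blast
  ultimately obtain T where T: "T \<in> components (- \<Union>(proj_line ` R))" "hpoint ` X \<subseteq> T"
    using exists_component_superset assms(3)
    by (metis (no_types, lifting) empty_subsetI equals0I image_is_empty subset_empty)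
  then have "open_triangle T"
    using assms(1) by (auto simp: simplicial_arrangement_def)
  then show ?thesis
    using T unfolding open_triangle_def face_cone_def tri_def by blast
qed

lemma comb_nonzero:
  assumes "face_cone R U V W" "\<alpha> > 0 \<or> \<beta> > 0 \<or> \<gamma> > 0"
  shows "\<alpha> *\<^sub>R U + \<beta> *\<^sub>R V + \<gamma> *\<^sub>R W \<noteq> 0"
proof -
  obtain g1 g2 g3 :: "real^3 \<Rightarrow> real" where g: "linear g1" "linear g2" "linear g3"
    "\<And>\<alpha> \<beta> \<gamma>. g1 (\<alpha> *\<^sub>R U + \<beta> *\<^sub>R V + \<gamma> *\<^sub>R W) = \<alpha> \<and> g2 (\<alpha> *\<^sub>R U + \<beta> *\<^sub>R V + \<gamma> *\<^sub>R W) = \<beta> \<and>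
        g3 (\<alpha> *\<^sub>R U + \<beta> *\<^sub>R V + \<gamma> *\<^sub>R W) = \<gamma>"
    using ex_coordinates assms(1) unfolding face_cone_def by blast
  show ?thesis
    using g assms(2) linear_0 by (metis less_irrefl)
qed

lemma face_cone_off_lines:
  assumes "face_cone R U V W" "\<alpha> > 0" "\<beta> > 0" "\<gamma> > 0" "r \<in> R"
  shows "r \<bullet> (\<alpha> *\<^sub>R U + \<beta> *\<^sub>R V + \<gamma> *\<^sub>R W) \<noteq> 0"
proof -
  have "hpoint (\<alpha> *\<^sub>R U + \<beta> *\<^sub>R V + \<gamma> *\<^sub>R W) \<in> tri U V W"
    using assms unfolding tri_def by blast
  moreover have "tri U V W \<subseteq> - \<Union>(proj_line ` R)"
    using assms(1) in_components_subset unfolding face_cone_def by blast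
  ultimately have "hpoint (\<alpha> *\<^sub>R U + \<beta> *\<^sub>R V + \<gamma> *\<^sub>R W) \<in> - \<Union>(proj_line ` R)" by blast
  then show ?thesis
    using hpoint_notin_lines comb_nonzero assms by metis
qed

text \<open>A line that takes opposite signs at two vertices crosses the side between them, and then
  also the open triangle, whatever its sign at the third vertex.\<close>

lemma face_cone_signs:
  assumes "face_cone R U V W" "r \<in> R"
  shows "(r \<bullet> U) * (r \<bullet> V) \<ge> 0"
proof (rule ccontr)
  assume neg: "\<not> ?thesis"
  define x y z where "x = r \<bullet> U" and "y = r \<bullet> V" and "z = r \<bullet> W"
  have off: "\<alpha> * x + \<beta> * y + \<gamma> * z \<noteq> 0" if "\<alpha> > 0" "\<beta> > 0" "\<gamma> > 0" for \<alpha> \<beta> \<gamma>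
    using face_cone_off_lines[OF assms(1) that assms(2)]
    by (simp add: x_def y_def z_def inner_add_right)
  have xy: "x * y < 0" using neg by (simp add: x_def y_def)
  \<comment> \<open>a positive combination of \<open>x\<close> and \<open>y\<close> can be given any value, here \<open>- z\<close>\<close>
  obtain K where K: "K > 0" "K * \<bar>x\<bar> > \<bar>z\<bar>"
  proof
    show "1 + \<bar>z\<bar> / \<bar>x\<bar> > 0" by (simp add: add_pos_nonneg)
    show "(1 + \<bar>z\<bar> / \<bar>x\<bar>) * \<bar>x\<bar> > \<bar>z\<bar>" using xy by (auto simp: field_simps)
  qed
  define \<beta> where "\<beta> = (- z - K * x) / y"
  have "\<beta> * y = - z - K * x" using xy by (auto simp: \<beta>_def)
  moreover have "\<beta> > 0"
  proof (cases "x > 0")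
    case True
    then have "y < 0" "- z - K * x < 0" using xy K by (auto simp: mult_less_0_iff)
    then show ?thesis by (simp add: \<beta>_def divide_neg_neg)
  next
    case False
    then have "y > 0" "- z - K * x > 0" using xy K by (auto simp: mult_less_0_iff abs_if split: if_splits)
    then show ?thesis by (simp add: \<beta>_def)
  qed
  ultimately show False
    using off[of K \<beta> 1] K by simp
qed

text \<open>Otherwise some point x = U + t V of the side lies on no line. By the sign condition the
  segment from x to x + W, which ends inside the face, then avoids all lines as well, so x belongs
  to the component. But the third coordinate of x is 0.\<close>

lemma face_cone_side:
  assumes "face_cone R U V W" "finite R" "0 \<notin> R"
  shows "\<exists>s\<in>R. s \<bullet> U = 0 \<and> s \<bullet> V = 0"
proof (rule ccontr)
  assume no: "\<not> ?thesis"
  have "finite {t. r \<bullet> (U + t *\<^sub>R V) = 0}" if "r \<in> R" for r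
  proof (cases "r \<bullet> V = 0")
    case True
    then show ?thesis using no that by (auto simp: inner_add_right)
  next
    case False
    then have "{t. r \<bullet> (U + t *\<^sub>R V) = 0} \<subseteq> {- (r \<bullet> U) / (r \<bullet> V)}"
      by (auto simp: inner_add_right field_simps)
    then show ?thesis using finite_subset by blast
  qed
  then have "finite (\<Union>r\<in>R. {t. r \<bullet> (U + t *\<^sub>R V) = 0})"
    using assms(2) by blast
  then have "infinite ({0<..} - (\<Union>r\<in>R. {t. r \<bullet> (U + t *\<^sub>R V) = 0}))"
    using infinite_Ioi[of "0::real"] Diff_infinite_finite by blast
  then have "{0<..} - (\<Union>r\<in>R. {t. r \<bullet> (U + t *\<^sub>R V) = 0}) \<noteq> {}"
    by (metis finite.emptyI)
  then obtain t :: real where t: "t > 0" "\<And>r. r \<in> R \<Longrightarrow> r \<bullet> (U + t *\<^sub>R V) \<noteq> 0"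
    by blast
  define x where "x = U + t *\<^sub>R V"
  define S where "S = (\<lambda>g. x + g *\<^sub>R W) ` {0..1}"
  have S: "x + g *\<^sub>R W \<noteq> 0 \<and> (\<forall>r\<in>R. r \<bullet> (x + g *\<^sub>R W) \<noteq> 0)" if "g \<ge> 0" for g
  proof (intro conjI ballI)
    show "x + g *\<^sub>R W \<noteq> 0"
      using comb_nonzero[OF assms(1), of 1 t g] by (simp add: x_def)
    fix r assume r: "r \<in> R"
    have "(r \<bullet> W) * (r \<bullet> U) \<ge> 0" "(r \<bullet> W) * (r \<bullet> V) \<ge> 0"
      using face_cone_signs r assms(1) face_cone_perm by (meson)+
    then have "(r \<bullet> x) * (g * (r \<bullet> W)) \<ge> 0"
      using t that by (simp add: x_def inner_add_right algebra_simps)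
    moreover have "r \<bullet> x \<noteq> 0" using t r by (simp add: x_def)
    ultimately have "(r \<bullet> x) * (r \<bullet> x + g * (r \<bullet> W)) > 0"
      by (smt (verit) distrib_left mult_eq_0_iff not_square_less_zero zero_less_mult_iff)
    then show "r \<bullet> (x + g *\<^sub>R W) \<noteq> 0"
      by (auto simp: inner_add_right)
  qed
  have "connected S"
    unfolding S_def by (intro connected_continuous_image continuous_intros) simp
  moreover have "continuous_on S hpoint"
    using continuous_on_hpoint by (rule continuous_on_subset) (use S in \<open>auto simp: S_def\<close>)
  ultimately have "connected (hpoint ` S)"
    by (rule connected_continuous_image[rotated])
  moreover have "hpoint ` S \<subseteq> - \<Union>(proj_line ` R)"
    using S by (auto simp: S_def hpoint_in_proj_line)
  moreover have "hpoint (x + 1 *\<^sub>R W) \<in> tri U V W \<inter> hpoint ` S"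
  proof -
    have "hpoint (1 *\<^sub>R U + t *\<^sub>R V + 1 *\<^sub>R W) \<in> tri U V W"
      unfolding tri_def using t(1) by (metis (mono_tags, lifting) mem_Collect_eq zero_less_one)
    moreover have "x + 1 *\<^sub>R W \<in> S" unfolding S_def by (rule image_eqI[of _ _ 1]) auto
    ultimately show ?thesis by (simp add: x_def)
  qed
  moreover have "tri U V W \<in> components (- \<Union>(proj_line ` R))"
    using assms(1) by (simp add: face_cone_def)
  ultimately have "hpoint ` S \<subseteq> tri U V W"
    using components_maximal[of "tri U V W" _ "hpoint ` S"] by blast
  moreover have "hpoint x \<in> hpoint ` S"
    unfolding S_def by (intro imageI image_eqI[of _ _ 0]) auto
  ultimately obtain a b c where abc: "a > 0" "b > 0" "c > 0" "hpoint x = hpoint (a *\<^sub>R U + b *\<^sub>R V + c *\<^sub>R W)"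
    unfolding tri_def by blast
  obtain g1 g2 g3 :: "real^3 \<Rightarrow> real" where g: "linear g1" "linear g2" "linear g3"
    "\<And>\<alpha> \<beta> \<gamma>. g1 (\<alpha> *\<^sub>R U + \<beta> *\<^sub>R V + \<gamma> *\<^sub>R W) = \<alpha> \<and> g2 (\<alpha> *\<^sub>R U + \<beta> *\<^sub>R V + \<gamma> *\<^sub>R W) = \<beta> \<and>
        g3 (\<alpha> *\<^sub>R U + \<beta> *\<^sub>R V + \<gamma> *\<^sub>R W) = \<gamma>"
    using ex_coordinates assms(1) unfolding face_cone_def by blast
  have "x \<noteq> 0" using S[of 0] by simp
  moreover have "a *\<^sub>R U + b *\<^sub>R V + c *\<^sub>R W \<noteq> 0"
    using comb_nonzero assms(1) abc(1) by blast
  ultimately obtain k where "k \<noteq> 0" "x = k *\<^sub>R (a *\<^sub>R U + b *\<^sub>R V + c *\<^sub>R W)"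
    using abc(4) hpoint_eq_iff by blast
  then have "g3 x = k * c" using g(3,4) by (simp add: linear_scale)
  moreover have "g3 x = 0" using g(4)[of 1 t 0] by (simp add: x_def)
  ultimately show False using abc(3) \<open>k \<noteq> 0\<close> by simp
qed

text \<open>The edge of a face through the point \<open>c a\<close>, which lies on a single line \<open>r\<^sub>0\<close>: \<open>c a\<close> is the sum of
  representatives \<open>U\<close>, \<open>V\<close> of the ends of the edge, and \<open>W\<close> is the opposite vertex.\<close>

definition edge_frame :: "(real^3) set \<Rightarrow> (real \<Rightarrow> real^3) \<Rightarrow> real \<Rightarrow> real \<Rightarrow> real^3 \<Rightarrow> real^3 \<Rightarrow> real^3 \<Rightarrow> real^3 \<Rightarrow>
    (real^3 \<Rightarrow> real) \<Rightarrow> (real^3 \<Rightarrow> real) \<Rightarrow> (real^3 \<Rightarrow> real) \<Rightarrow> bool" where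
  "edge_frame R c a b r0 U V W g1 g2 g3 \<longleftrightarrow>
     linear g1 \<and> linear g2 \<and> linear g3 \<and> (\<forall>x. x = g1 x *\<^sub>R U + g2 x *\<^sub>R V + g3 x *\<^sub>R W) \<and>
     c a = U + V \<and> r0 \<bullet> U = 0 \<and> r0 \<bullet> V = 0 \<and>
     (\<forall>t\<in>{a<..<b}. g1 (c t) > 0 \<and> g2 (c t) > 0 \<and> g3 (c t) > 0) \<and>
     (\<forall>r\<in>R. (r \<bullet> U) * (r \<bullet> V) \<ge> 0 \<and> (r \<bullet> U) * (r \<bullet> W) \<ge> 0 \<and> (r \<bullet> V) * (r \<bullet> W) \<ge> 0) \<and>
     (\<exists>s\<in>R. s \<bullet> V = 0 \<and> s \<bullet> W = 0) \<and> (\<exists>s\<in>R. s \<bullet> U = 0 \<and> s \<bullet> W = 0)"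

text \<open>A projective point determines its coordinates only up to a common factor, which is why
  the hypotheses speak of products. \<open>g1\<close> has no zero along the path before
  \<open>b\<close>, so its sign is constant; rescaling the vertices by the coordinates of
  \<open>c a\<close> and by this sign makes all coordinates positive.\<close>

lemma edge_frame_aux:
  assumes fc: "face_cone R U V W" "finite R" "0 \<notin> R"
    and c: "a < b" "continuous_on {a..b} c"
    and r0: "r0 \<in> R" "\<forall>r\<in>R. r \<bullet> c a = 0 \<longleftrightarrow> r = r0"
    and g: "linear g1" "linear g2" "linear g3" "\<And>x. x = g1 x *\<^sub>R U + g2 x *\<^sub>R V + g3 x *\<^sub>R W"
    and pos: "\<And>t. t \<in> {a<..<b} \<Longrightarrow> g1 (c t) * g2 (c t) > 0 \<and> g1 (c t) * g3 (c t) > 0"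
    and at_a: "g1 (c a) * g2 (c a) > 0" "g3 (c a) = 0"
  shows "\<exists>U V W g1 g2 g3. edge_frame R c a b r0 U V W g1 g2 g3"
proof -
  define A1 A2 \<sigma> where "A1 = g1 (c a)" and "A2 = g2 (c a)" and "\<sigma> = sgn A1"
  have nz: "A1 \<noteq> 0" "A2 \<noteq> 0" "A1 * A2 > 0" "\<sigma> \<noteq> 0" "A1 * \<sigma> > 0" "A2 * \<sigma> > 0"
    using at_a by (auto simp: A1_def A2_def \<sigma>_def sgn_if zero_less_mult_iff split: if_splits)
  have ca: "c a = A1 *\<^sub>R U + A2 *\<^sub>R V"
    using g(4)[of "c a"] at_a by (simp add: A1_def A2_def)
  have "s = r0" if "s \<in> R" "s \<bullet> U = 0" "s \<bullet> V = 0" for s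
    using bspec[OF r0(2) that(1)] that by (simp add: ca inner_add_right)
  then have r0UV: "r0 \<bullet> U = 0" "r0 \<bullet> V = 0"
    using face_cone_side[OF fc] by blast+
  have "g1 (c t) / A1 > 0 \<and> g2 (c t) / A2 > 0 \<and> g3 (c t) / \<sigma> > 0" if t: "t \<in> {a<..<b}" for t
  proof -
    have "continuous_on {a..t} (\<lambda>t. g1 (c t))"
      using c t by (intro linear_continuous_on_compose[OF _ g(1)]) (auto intro: continuous_on_subset)
    moreover have "g1 (c x) \<noteq> 0" if "x \<in> {a..t}" for x
      using pos[of x] nz t that by (cases "x = a") (auto simp: A1_def)
    ultimately have "A1 * g1 (c t) > 0"
      using same_sign_IVT[of a t "\<lambda>t. g1 (c t)"] t by (simp add: A1_def)
    then show ?thesis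
      using pos[OF t] nz by (auto simp: zero_less_mult_iff zero_less_divide_iff \<sigma>_def)
  qed
  moreover have "linear (\<lambda>x. g1 x / A1)" "linear (\<lambda>x. g2 x / A2)" "linear (\<lambda>x. g3 x / \<sigma>)"
    using g(1-3) by (simp_all add: linear_iff add_divide_distrib)
  moreover have "x = (g1 x / A1) *\<^sub>R (A1 *\<^sub>R U) + (g2 x / A2) *\<^sub>R (A2 *\<^sub>R V) + (g3 x / \<sigma>) *\<^sub>R (\<sigma> *\<^sub>R W)" for x
    using g(4)[of x] nz by simp
  moreover have "(r \<bullet> (A1 *\<^sub>R U)) * (r \<bullet> (A2 *\<^sub>R V)) \<ge> 0 \<and> (r \<bullet> (A1 *\<^sub>R U)) * (r \<bullet> (\<sigma> *\<^sub>R W)) \<ge> 0 \<and>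
      (r \<bullet> (A2 *\<^sub>R V)) * (r \<bullet> (\<sigma> *\<^sub>R W)) \<ge> 0" if "r \<in> R" for r
  proof -
    have "(r \<bullet> U) * (r \<bullet> V) \<ge> 0" "(r \<bullet> U) * (r \<bullet> W) \<ge> 0" "(r \<bullet> V) * (r \<bullet> W) \<ge> 0"
      using face_cone_signs that fc(1) face_cone_perm by meson+
    then have "(A1 * A2) * ((r \<bullet> U) * (r \<bullet> V)) \<ge> 0" "(A1 * \<sigma>) * ((r \<bullet> U) * (r \<bullet> W)) \<ge> 0"
        "(A2 * \<sigma>) * ((r \<bullet> V) * (r \<bullet> W)) \<ge> 0"
      using nz by (meson less_imp_le mult_nonneg_nonneg)+
    then show ?thesis by (simp add: mult_ac)
  qed
  moreover have "\<exists>s\<in>R. s \<bullet> (A2 *\<^sub>R V) = 0 \<and> s \<bullet> (\<sigma> *\<^sub>R W) = 0" "\<exists>s\<in>R. s \<bullet> (A1 *\<^sub>R U) = 0 \<and> s \<bullet> (\<sigma> *\<^sub>R W) = 0"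
    using face_cone_side[of R V W U] face_cone_side[of R U W V] fc face_cone_perm
    by (metis inner_scaleR_right mult_zero_right)+
  ultimately have "edge_frame R c a b r0 (A1 *\<^sub>R U) (A2 *\<^sub>R V) (\<sigma> *\<^sub>R W)
      (\<lambda>x. g1 x / A1) (\<lambda>x. g2 x / A2) (\<lambda>x. g3 x / \<sigma>)"
    unfolding edge_frame_def using ca r0UV by simp
  then show ?thesis by blast
qed

text \<open>By continuity the coordinates of \<open>c a\<close> do not have opposite signs. If two
  vanish, \<open>c a\<close> is a vertex; both sides through it must then be \<open>r0\<close>,
  which would contain all three vertices. If none vanishes, \<open>c a\<close> is inside the face
  and cannot lie on \<open>r0\<close>. So \<open>c a\<close> is inside a side.\<close>

lemma ex_edge_frame:
  assumes simp: "simplicial_arrangement (proj_line ` R)" and R: "finite R" "0 \<notin> R"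
    and c: "a < b" "continuous_on {a..b} c" "c a \<noteq> 0"
    and r0: "r0 \<in> R" "\<forall>r\<in>R. r \<bullet> c a = 0 \<longleftrightarrow> r = r0"
    and off: "\<forall>t\<in>{a<..<b}. \<forall>r\<in>R. r \<bullet> c t \<noteq> 0"
  shows "\<exists>U V W g1 g2 g3. edge_frame R c a b r0 U V W g1 g2 g3"
proof -
  have "connected (c ` {a<..<b})"
    using c(2) by (intro connected_continuous_image) (auto intro: continuous_on_subset)
  moreover have "v \<noteq> 0 \<and> (\<forall>r\<in>R. r \<bullet> v \<noteq> 0)" if "v \<in> c ` {a<..<b}" for v
    using that off r0(1) by fastforce
  moreover have "c ` {a<..<b} \<noteq> {}" using c(1) by simp
  ultimately obtain U V W where fc: "face_cone R U V W" and X: "hpoint ` c ` {a<..<b} \<subseteq> tri U V W"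
    using ex_face_cone[OF simp] by metis
  obtain g1 g2 g3 :: "real^3 \<Rightarrow> real" where g: "linear g1" "linear g2" "linear g3"
    "\<And>\<alpha> \<beta> \<gamma>. g1 (\<alpha> *\<^sub>R U + \<beta> *\<^sub>R V + \<gamma> *\<^sub>R W) = \<alpha> \<and> g2 (\<alpha> *\<^sub>R U + \<beta> *\<^sub>R V + \<gamma> *\<^sub>R W) = \<beta> \<and>
        g3 (\<alpha> *\<^sub>R U + \<beta> *\<^sub>R V + \<gamma> *\<^sub>R W) = \<gamma>"
    and rep: "\<And>x. x = g1 x *\<^sub>R U + g2 x *\<^sub>R V + g3 x *\<^sub>R W"
    using ex_coordinates fc unfolding face_cone_def by blast
  have pos: "g1 (c t) * g2 (c t) > 0 \<and> g1 (c t) * g3 (c t) > 0 \<and> g2 (c t) * g3 (c t) > 0" if t: "t \<in> {a<..<b}" for t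
  proof -
    have "hpoint (c t) \<in> tri U V W" using X t by blast
    then obtain x y z where xyz: "x > 0" "y > 0" "z > 0" "hpoint (c t) = hpoint (x *\<^sub>R U + y *\<^sub>R V + z *\<^sub>R W)"
      unfolding tri_def by blast
    moreover have "c t \<noteq> 0" using off t r0(1) by force
    moreover have "x *\<^sub>R U + y *\<^sub>R V + z *\<^sub>R W \<noteq> 0"
      using comb_nonzero[OF fc] xyz(1) by blast
    ultimately obtain k where "k \<noteq> 0" "c t = k *\<^sub>R (x *\<^sub>R U + y *\<^sub>R V + z *\<^sub>R W)"
      using hpoint_eq_iff by blast
    then have "g1 (c t) = k * x" "g2 (c t) = k * y" "g3 (c t) = k * z"
      using g by (simp_all add: linear_scale)
    then show ?thesis
      using xyz \<open>k \<noteq> 0\<close> by (auto simp: zero_less_mult_iff mult_less_0_iff not_less)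
  qed
  have cont: "continuous_on {a..b} (\<lambda>t. g1 (c t))" "continuous_on {a..b} (\<lambda>t. g2 (c t))" "continuous_on {a..b} (\<lambda>t. g3 (c t))"
    using linear_continuous_on_compose[OF c(2)] g by blast+
  have cl: "closure {a<..<b} = {a..b}" "a \<in> closure {a<..<b}" using c(1) by auto
  have lim: "h a \<ge> 0" if "continuous_on {a..b} h" "\<And>t. t \<in> {a<..<b} \<Longrightarrow> h t > 0" for h :: "real \<Rightarrow> real"
    using continuous_ge_on_closure[OF _ cl(2), of h 0] that cl(1) by (simp add: less_imp_le)
  have nonneg: "g1 (c a) * g2 (c a) \<ge> 0" "g1 (c a) * g3 (c a) \<ge> 0" "g2 (c a) * g3 (c a) \<ge> 0"
    using lim[of "\<lambda>t. g1 (c t) * g2 (c t)"] lim[of "\<lambda>t. g1 (c t) * g3 (c t)"]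
      lim[of "\<lambda>t. g2 (c t) * g3 (c t)"] pos cont continuous_on_mult by blast+
  \<comment> \<open>exactly one of the three coordinates of \<open>c a\<close> vanishes\<close>
  have no2: "\<not> (g2 (c a) = 0 \<and> g3 (c a) = 0)" if fc: "face_cone R U V W"
    and rep: "\<And>x. x = g1 x *\<^sub>R U + g2 x *\<^sub>R V + g3 x *\<^sub>R W" for U V W and g1 g2 g3 :: "real^3 \<Rightarrow> real"
  proof
    assume "g2 (c a) = 0 \<and> g3 (c a) = 0"
    then have ca: "c a = g1 (c a) *\<^sub>R U" using rep[of "c a"] by simp
    obtain s where "s \<in> R" "s \<bullet> U = 0" "s \<bullet> V = 0" using face_cone_side[OF fc R] by blast
    moreover obtain s' where "s' \<in> R" "s' \<bullet> U = 0" "s' \<bullet> W = 0"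
      using face_cone_side[of R U W V] face_cone_perm fc R by metis
    ultimately have "r0 \<bullet> U = 0" "r0 \<bullet> V = 0" "r0 \<bullet> W = 0"
      using r0(2) ca by (metis inner_scaleR_right mult_zero_right)+
    then have "r0 \<bullet> r0 = 0" using rep[of r0]
      by (metis (no_types, lifting) add.right_neutral inner_add_right inner_scaleR_right mult_zero_right)
    then show False using r0(1) R(2) by simp
  qed
  have not3: "\<not> (g1 (c a) \<noteq> 0 \<and> g2 (c a) \<noteq> 0 \<and> g3 (c a) \<noteq> 0)"
  proof
    assume "g1 (c a) \<noteq> 0 \<and> g2 (c a) \<noteq> 0 \<and> g3 (c a) \<noteq> 0"
    then have nz: "g1 (c a) \<noteq> 0" "g2 (c a) * g1 (c a) > 0" "g3 (c a) * g1 (c a) > 0"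
      using nonneg by (simp_all add: less_le mult.commute)
    define k where "k = sgn (g1 (c a))"
    have "k * k = 1" "k * g1 (c a) > 0" "k * g2 (c a) > 0" "k * g3 (c a) > 0"
      using nz by (auto simp: k_def sgn_if zero_less_mult_iff)
    moreover have "r0 \<bullet> ((k * g1 (c a)) *\<^sub>R U + (k * g2 (c a)) *\<^sub>R V + (k * g3 (c a)) *\<^sub>R W) = k * (r0 \<bullet> c a)"
      by (subst rep[of "c a"]) (simp add: inner_add_right algebra_simps)
    ultimately show False
      using face_cone_off_lines[OF fc _ _ _ r0(1)] r0 by (metis mult_zero_right)
  qed
  have rep': "x = g1 x *\<^sub>R U + g3 x *\<^sub>R W + g2 x *\<^sub>R V" "x = g2 x *\<^sub>R V + g3 x *\<^sub>R W + g1 x *\<^sub>R U"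
    "x = g2 x *\<^sub>R V + g1 x *\<^sub>R U + g3 x *\<^sub>R W" "x = g3 x *\<^sub>R W + g1 x *\<^sub>R U + g2 x *\<^sub>R V" for x
    using rep[of x] by (simp_all add: algebra_simps)
  have fc': "face_cone R U W V" "face_cone R V W U" "face_cone R V U W" "face_cone R W U V"
    using fc face_cone_perm by metis+
  have "\<not> (g2 (c a) = 0 \<and> g3 (c a) = 0)" "\<not> (g1 (c a) = 0 \<and> g3 (c a) = 0)" "\<not> (g1 (c a) = 0 \<and> g2 (c a) = 0)"
    using no2[OF fc rep] no2[OF fc'(3) rep'(3)] no2[OF fc'(4) rep'(4)] by blast+
  then consider "g3 (c a) = 0" "g1 (c a) * g2 (c a) > 0" | "g2 (c a) = 0" "g1 (c a) * g3 (c a) > 0"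
    | "g1 (c a) = 0" "g2 (c a) * g3 (c a) > 0"
    using not3 nonneg by (metis less_eq_real_def mult_eq_0_iff)
  then show ?thesis
  proof cases
    case 1
    then show ?thesis
      using edge_frame_aux[OF fc R c(1,2) r0 g(1,2,3) rep] pos by blast
  next
    case 2
    then show ?thesis
      using edge_frame_aux[OF fc'(1) R c(1,2) r0 g(1,3,2) rep'(1)] pos by blast
  next
    case 3
    then show ?thesis
      using edge_frame_aux[OF fc'(2) R c(1,2) r0 g(2,3,1) rep'(2)] pos by (metis mult.commute)
  qed
qed

text \<open>If a path runs in a single face from an edge on the line \<open>q\<^sub>1\<close> to an edge on \<open>q\<^sub>2\<close>, then no line
  crosses the side on \<open>q\<^sub>1\<close> between the initial point of the path and the vertex \<open>P\<close> of the face.\<close>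

definition sides_meet :: "(real^3) set \<Rightarrow> bool" where
  "sides_meet R \<longleftrightarrow> (\<forall>(u :: real \<Rightarrow> real^3) a b q1 q2 P. a < b \<longrightarrow> continuous_on {a..b} u \<longrightarrow> q1 \<in> R \<longrightarrow> q2 \<in> R \<longrightarrow> q1 \<noteq> q2 \<longrightarrow>
     (\<forall>r\<in>R. r \<bullet> u a = 0 \<longleftrightarrow> r = q1) \<longrightarrow> (\<forall>r\<in>R. r \<bullet> u b = 0 \<longleftrightarrow> r = q2) \<longrightarrow>
     (\<forall>t\<in>{a<..<b}. \<forall>r\<in>R. r \<bullet> u t \<noteq> 0) \<longrightarrow> q1 \<bullet> P = 0 \<longrightarrow> q2 \<bullet> P = 0 \<longrightarrow>
     (\<exists>\<sigma>\<in>{1, -1::real}. \<forall>r\<in>R. 0 \<le> \<sigma> * (r \<bullet> u a) * (r \<bullet> P)))"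

lemma edge_frame_inner:
  assumes "edge_frame R c a b r0 U V W g1 g2 g3"
  shows "r \<bullet> x = g1 x * (r \<bullet> U) + g2 x * (r \<bullet> V) + g3 x * (r \<bullet> W)"
proof -
  have rep: "x = g1 x *\<^sub>R U + g2 x *\<^sub>R V + g3 x *\<^sub>R W"
    using assms unfolding edge_frame_def by blast
  show ?thesis by (subst rep) (simp add: inner_add_right)
qed

lemma edge_frame_nonzero:
  assumes "edge_frame R c a b r0 U V W g1 g2 g3" "r \<bullet> U = 0" "r \<bullet> V = 0" "r \<bullet> W = 0"
  shows "r = 0"
  using edge_frame_inner[OF assms(1), of r r] assms by simp

text \<open>The line \<open>q1\<close> carries the side \<open>U V\<close> on which the path starts,
  and the path ends on another side of the same triangle. So \<open>q2\<close> is one of the two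
  sides through \<open>W\<close>, and it meets \<open>q1\<close> in \<open>U\<close> or
  \<open>V\<close>. No line separates \<open>U + V\<close> from either of them.\<close>

lemma simplicial_sides_meet:
  assumes simp: "simplicial_arrangement (proj_line ` R)" and R: "finite R" "0 \<notin> R"
  shows "sides_meet R"
  unfolding sides_meet_def
proof (intro allI impI)
  fix u :: "real \<Rightarrow> real^3" and a b q1 q2 P
  assume ab: "a < b" "continuous_on {a..b} u" and q: "q1 \<in> R" "q2 \<in> R" "q1 \<noteq> q2"
    and ua: "\<forall>r\<in>R. r \<bullet> u a = 0 \<longleftrightarrow> r = q1" and ub: "\<forall>r\<in>R. r \<bullet> u b = 0 \<longleftrightarrow> r = q2"
    and off: "\<forall>t\<in>{a<..<b}. \<forall>r\<in>R. r \<bullet> u t \<noteq> 0" and P: "q1 \<bullet> P = 0" "q2 \<bullet> P = 0"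
  have "u a \<noteq> 0" using ua q by force
  then obtain U V W g1 g2 g3 where ef: "edge_frame R u a b q1 U V W g1 g2 g3"
    using ex_edge_frame[OF simp R ab _ q(1) ua off] by blast
  note e = ef[unfolded edge_frame_def]
  note in3 = edge_frame_inner[OF ef]
  have ua': "u a = U + V" and q1UV: "q1 \<bullet> U = 0" "q1 \<bullet> V = 0" using e by auto
  obtain s1 s2 where s: "s1 \<in> R" "s1 \<bullet> V = 0" "s1 \<bullet> W = 0" "s2 \<in> R" "s2 \<bullet> U = 0" "s2 \<bullet> W = 0"
    using e by blast
  have cl: "closure {a<..<b} = {a..b}" "b \<in> closure {a<..<b}" using ab by auto
  have nonneg: "g (u b) \<ge> 0" if "linear g" "\<forall>t\<in>{a<..<b}. g (u t) > 0" for g :: "real^3 \<Rightarrow> real"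
    using continuous_ge_on_closure[OF _ cl(2), of "\<lambda>t. g (u t)" 0] that
      linear_continuous_on_compose[OF ab(2) that(1)] by (auto simp: cl(1) less_imp_le)
  have B: "g1 (u b) \<ge> 0" "g2 (u b) \<ge> 0" "g3 (u b) \<ge> 0"
    using nonneg e by blast+
  have sgn: "(q2 \<bullet> U) * (q2 \<bullet> V) \<ge> 0" "(q2 \<bullet> U) * (q2 \<bullet> W) \<ge> 0" "(q2 \<bullet> V) * (q2 \<bullet> W) \<ge> 0"
    using e q(2) by blast+
  have q2b: "g1 (u b) * (q2 \<bullet> U) + g2 (u b) * (q2 \<bullet> V) + g3 (u b) * (q2 \<bullet> W) = 0"
    using ub q(2) by (simp flip: in3)
  \<comment> \<open>The three terms never have opposite signs and they add up to zero. So each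
    vanishes: \<open>q2\<close> contains every vertex with a nonzero coordinate at
    \<open>u b\<close>.\<close>
  have z: "g1 (u b) * (q2 \<bullet> U) = 0" "g2 (u b) * (q2 \<bullet> V) = 0" "g3 (u b) * (q2 \<bullet> W) = 0"
  proof -
    have "(g1 (u b) * (q2 \<bullet> U)) * (g2 (u b) * (q2 \<bullet> V)) \<ge> 0" "(g1 (u b) * (q2 \<bullet> U)) * (g3 (u b) * (q2 \<bullet> W)) \<ge> 0"
      "(g2 (u b) * (q2 \<bullet> V)) * (g3 (u b) * (q2 \<bullet> W)) \<ge> 0"
      using mult_nonneg_nonneg[OF mult_nonneg_nonneg[OF B(1) B(2)] sgn(1)]
        mult_nonneg_nonneg[OF mult_nonneg_nonneg[OF B(1) B(3)] sgn(2)]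
        mult_nonneg_nonneg[OF mult_nonneg_nonneg[OF B(2) B(3)] sgn(3)] by (simp_all add: mult_ac)
    moreover have "x = 0 \<and> y = 0 \<and> z = 0" if "x * y \<ge> 0" "x * z \<ge> 0" "y * z \<ge> 0" "x + y + z = 0" for x y z :: real
      using that by (smt (verit) zero_le_mult_iff)
    ultimately show "g1 (u b) * (q2 \<bullet> U) = 0" "g2 (u b) * (q2 \<bullet> V) = 0" "g3 (u b) * (q2 \<bullet> W) = 0"
      using q2b by blast+
  qed
  have "q1 \<bullet> u b \<noteq> 0" using ub q by blast
  then have "g3 (u b) \<noteq> 0"
    unfolding in3[of q1 "u b"] q1UV by auto
  then have q2W: "q2 \<bullet> W = 0" using z by simp
  note zero = edge_frame_nonzero[OF ef]
  have q1W: "q1 \<bullet> W \<noteq> 0" using zero q1UV q(1) R(2) by metis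
  have PW: "g3 P = 0" using in3[of q1 P] P q1UV q1W by simp
  \<comment> \<open>Otherwise \<open>u b\<close> is a multiple of \<open>W\<close> and lies on both
    sides through \<open>W\<close>, although it lies on \<open>q2\<close> only.\<close>
  have "q2 \<bullet> U = 0 \<or> q2 \<bullet> V = 0"
  proof (rule ccontr)
    assume no: "\<not> ?thesis"
    then have "g1 (u b) = 0" "g2 (u b) = 0" using z by auto
    then have "s1 \<bullet> u b = 0" "s2 \<bullet> u b = 0"
      using in3[of s1 "u b"] in3[of s2 "u b"] s by simp_all
    then show False using ub s no by metis
  qed
  then consider "q2 \<bullet> U = 0" "q2 \<bullet> V \<noteq> 0" | "q2 \<bullet> V = 0" "q2 \<bullet> U \<noteq> 0"
    using zero q2W q(2) R(2) by metis
  then show "\<exists>\<sigma>\<in>{1, -1::real}. \<forall>r\<in>R. 0 \<le> \<sigma> * (r \<bullet> u a) * (r \<bullet> P)"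
  proof cases
    case 1
    then have "g2 P = 0" using in3[of q2 P] P q2W by simp
    then have P': "r \<bullet> P = g1 P * (r \<bullet> U)" for r using in3[of r P] PW by simp
    have "0 \<le> (if g1 P \<ge> 0 then 1 else -1) * (r \<bullet> u a) * (r \<bullet> P)" if "r \<in> R" for r
    proof -
      have "(r \<bullet> U) * (r \<bullet> U) + (r \<bullet> U) * (r \<bullet> V) \<ge> 0" using e that by simp
      then have "\<bar>g1 P\<bar> * ((r \<bullet> U) * (r \<bullet> U) + (r \<bullet> U) * (r \<bullet> V)) \<ge> 0" by simp
      then show ?thesis
        unfolding P' ua' by (auto simp: inner_add_right algebra_simps abs_if split: if_splits)
    qed
    then show ?thesis by (intro bexI[of _ "if g1 P \<ge> 0 then 1 else -1"]) auto
  next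
    case 2
    then have "g1 P = 0" using in3[of q2 P] P q2W by simp
    then have P': "r \<bullet> P = g2 P * (r \<bullet> V)" for r using in3[of r P] PW by simp
    have "0 \<le> (if g2 P \<ge> 0 then 1 else -1) * (r \<bullet> u a) * (r \<bullet> P)" if "r \<in> R" for r
    proof -
      have "(r \<bullet> V) * (r \<bullet> V) + (r \<bullet> U) * (r \<bullet> V) \<ge> 0" using e that by simp
      then have "\<bar>g2 P\<bar> * ((r \<bullet> V) * (r \<bullet> V) + (r \<bullet> U) * (r \<bullet> V)) \<ge> 0" by simp
      then show ?thesis
        unfolding P' ua' by (auto simp: inner_add_right algebra_simps abs_if split: if_splits)
    qed
    then show ?thesis by (intro bexI[of _ "if g2 P \<ge> 0 then 1 else -1"]) auto
  qed
qed

text \<open>Two neighbouring double points on a line \<open>r\<^sub>0\<close> force the two triangles between them to have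
  the same three sides, and hence all other lines to be concurrent.\<close>

definition double_neighbours_pencil :: "(real^3) set \<Rightarrow> bool" where
  "double_neighbours_pencil R \<longleftrightarrow> (\<forall>r0 a b U V. r0 \<in> R \<longrightarrow> a \<in> R \<longrightarrow> b \<in> R \<longrightarrow> r0 \<noteq> a \<longrightarrow> r0 \<noteq> b \<longrightarrow> a \<noteq> b \<longrightarrow>
     r0 \<bullet> U = 0 \<longrightarrow> a \<bullet> U = 0 \<longrightarrow> r0 \<bullet> V = 0 \<longrightarrow> b \<bullet> V = 0 \<longrightarrow> a \<bullet> V \<noteq> 0 \<longrightarrow> b \<bullet> U \<noteq> 0 \<longrightarrow>
     (\<forall>r\<in>R - {r0, a, b}. (r \<bullet> U) * (r \<bullet> V) > 0) \<longrightarrow>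
     (\<exists>W. W \<noteq> 0 \<and> (\<forall>r\<in>R - {r0}. r \<bullet> W = 0)))"

text \<open>The faces on both sides of \<open>r0\<close> at the point \<open>p\<close> between the
  double points are bounded by \<open>r0\<close>, \<open>a\<close> and \<open>b\<close>. Their third
  vertices are the same projective point, but with representatives \<open>W1\<close> and
  \<open>W2\<close> on opposite sides of \<open>r0\<close>. Every other line has weakly the sign of
  \<open>p\<close> at both of them, hence the value 0.\<close>

lemma simplicial_double_neighbours_pencil:
  assumes simp: "simplicial_arrangement (proj_line ` R)" and R: "finite R" "0 \<notin> R"
  shows "double_neighbours_pencil R"
  unfolding double_neighbours_pencil_def
proof (intro allI impI)
  fix r0 a b U0 V0
  assume r: "r0 \<in> R" "a \<in> R" "b \<in> R" "r0 \<noteq> a" "r0 \<noteq> b" "a \<noteq> b"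
    and U0: "r0 \<bullet> U0 = 0" "a \<bullet> U0 = 0" and V0: "r0 \<bullet> V0 = 0" "b \<bullet> V0 = 0"
    and nz: "a \<bullet> V0 \<noteq> 0" "b \<bullet> U0 \<noteq> 0"
    and others: "\<forall>r\<in>R - {r0, a, b}. (r \<bullet> U0) * (r \<bullet> V0) > 0"
  define p where "p = U0 + V0"
  have p: "r \<bullet> p = 0 \<longleftrightarrow> r = r0" if "r \<in> R" for r
  proof -
    have 1: "r \<bullet> p \<noteq> 0" if "r \<noteq> r0" "r \<noteq> a" "r \<noteq> b"
    proof -
      have "(r \<bullet> U0) * (r \<bullet> V0) > 0" using others \<open>r \<in> R\<close> that by auto
      then show ?thesis by (auto simp: p_def inner_add_right zero_less_mult_iff)
    qed
    moreover have "r0 \<bullet> p = 0" "a \<bullet> p \<noteq> 0" "b \<bullet> p \<noteq> 0"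
      using U0 V0 nz by (simp_all add: p_def inner_add_right)
    ultimately show ?thesis by blast
  qed
  have "p \<noteq> 0" using p[OF r(2)] r by auto
  have "r0 \<noteq> 0" using r R by auto
  have "\<forall>\<^sub>F t in at (0::real). r \<bullet> (p + t *\<^sub>R r0) \<noteq> 0" if "r \<in> R - {r0}" for r
  proof -
    have "((\<lambda>t. r \<bullet> (p + t *\<^sub>R r0)) \<longlongrightarrow> r \<bullet> (p + 0 *\<^sub>R r0)) (at 0)"
      by (intro tendsto_intros)
    then show ?thesis
      using p that by (intro tendsto_imp_eventually_ne) auto
  qed
  then have "\<forall>\<^sub>F t in at (0::real). \<forall>r\<in>R - {r0}. r \<bullet> (p + t *\<^sub>R r0) \<noteq> 0"
    using R(1) by (simp add: eventually_ball_finite)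
  then obtain d where d: "d > 0" "\<And>t r. t \<noteq> 0 \<Longrightarrow> \<bar>t\<bar> < d \<Longrightarrow> r \<in> R - {r0} \<Longrightarrow> r \<bullet> (p + t *\<^sub>R r0) \<noteq> 0"
    unfolding eventually_at by (auto simp: dist_real_def)
  have frame: "\<exists>U V W g1 g2 g3. edge_frame R (\<lambda>t. p + (k * t) *\<^sub>R r0) 0 d r0 U V W g1 g2 g3" if "k = 1 \<or> k = -1" for k
  proof (rule ex_edge_frame[OF simp R d(1)])
    show "continuous_on {0..d} (\<lambda>t. p + (k * t) *\<^sub>R r0)" by (intro continuous_intros)
    show "\<forall>t\<in>{0<..<d}. \<forall>r\<in>R. r \<bullet> (p + (k * t) *\<^sub>R r0) \<noteq> 0"
    proof (intro ballI)
      fix t r assume t: "t \<in> {0<..<d}" and "r \<in> R"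
      show "r \<bullet> (p + (k * t) *\<^sub>R r0) \<noteq> 0"
      proof (cases "r = r0")
        case True
        then show ?thesis using p[of r0] r(1) t \<open>r0 \<noteq> 0\<close> \<open>k = 1 \<or> k = -1\<close> by (auto simp: inner_add_right)
      next
        case False
        then show ?thesis using d(2)[of "k * t" r] t \<open>r \<in> R\<close> \<open>k = 1 \<or> k = -1\<close> by auto
      qed
    qed
  qed (use p \<open>p \<noteq> 0\<close> r in auto)
  have indep: "independent {U0, V0, r0}" "card {U0, V0, r0} = 3"
  proof -
    have ne: "U0 \<noteq> V0" "U0 \<noteq> r0" "V0 \<noteq> r0" using U0 V0 nz \<open>r0 \<noteq> 0\<close> by auto
    then show "card {U0, V0, r0} = 3" by simp
    have "r0 \<notin> span {}" using \<open>r0 \<noteq> 0\<close> by simp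
    moreover have "V0 \<notin> span {r0}"
      using V0 nz \<open>r0 \<noteq> 0\<close> by (auto simp: span_singleton)
    moreover have "U0 \<notin> span {V0, r0}"
    proof
      assume "U0 \<in> span {V0, r0}"
      then obtain x y where xy: "U0 = x *\<^sub>R V0 + y *\<^sub>R r0"
        unfolding span_insert span_empty by (auto simp: algebra_simps)
      then have "r0 \<bullet> U0 = y * (r0 \<bullet> r0)" using V0 by (simp add: inner_add_right)
      then have "y = 0" using U0 \<open>r0 \<noteq> 0\<close> by simp
      then have "b \<bullet> U0 = 0" using xy V0 by simp
      then show False using nz by simp
    qed
    ultimately show "independent {U0, V0, r0}"
      using ne by (simp add: independent_insert)
  qed
  have orth: "\<exists>x y. X = x *\<^sub>R U0 + y *\<^sub>R V0" if "r0 \<bullet> X = 0" for X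
  proof -
    obtain x y z where xyz: "X = x *\<^sub>R U0 + y *\<^sub>R V0 + z *\<^sub>R r0"
      using ex_coordinates[OF indep(2,1)] by blast
    have "r0 \<bullet> X = z * (r0 \<bullet> r0)" unfolding xyz by (simp add: inner_add_right U0 V0)
    then have "z = 0" using that \<open>r0 \<noteq> 0\<close> by simp
    then show ?thesis using xyz by auto
  qed
  have W: "a \<bullet> W = 0 \<and> b \<bullet> W = 0 \<and> k * (r0 \<bullet> W) > 0 \<and> (\<forall>r\<in>R. (r \<bullet> p) * (r \<bullet> W) \<ge> 0)"
    if k: "k = 1 \<or> k = -1" and "edge_frame R (\<lambda>t. p + (k * t) *\<^sub>R r0) 0 d r0 U V W g1 g2 g3" for k U V W g1 g2 g3
  proof (intro conjI)
    note ef = that(2)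
    note e = ef[unfolded edge_frame_def]
    note in3 = edge_frame_inner[OF ef]
    have pUV: "p = U + V" and r0UV: "r0 \<bullet> U = 0" "r0 \<bullet> V = 0" using e by auto
    obtain s1 s2 where s: "s1 \<in> R" "s1 \<bullet> V = 0" "s1 \<bullet> W = 0" "s2 \<in> R" "s2 \<bullet> U = 0" "s2 \<bullet> W = 0"
      using e by blast
    obtain x y where xy: "U = x *\<^sub>R U0 + y *\<^sub>R V0" using orth[OF r0UV(1)] by blast
    have xy': "V = (1 - x) *\<^sub>R U0 + (1 - y) *\<^sub>R V0"
      using pUV xy by (simp add: p_def algebra_simps)
    have "(a \<bullet> U) * (a \<bullet> V) \<ge> 0" "(b \<bullet> U) * (b \<bullet> V) \<ge> 0" using e r by blast+
    then have "(y * (1 - y)) * (a \<bullet> V0)^2 \<ge> 0" "(x * (1 - x)) * (b \<bullet> U0)^2 \<ge> 0"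
      by (simp_all add: xy xy' inner_add_right U0 V0 power2_eq_square mult_ac)
    then have xy01: "0 \<le> y" "y \<le> 1" "0 \<le> x" "x \<le> 1"
      using nz by (auto simp: zero_le_mult_iff)
    have nzero: "U \<noteq> 0" "V \<noteq> 0" using edge_frame_nonzero[OF ef] s R by (metis inner_zero_right)+
    have "s \<in> {a, b}" if "s \<in> R" "s \<noteq> r0" "s \<bullet> (v *\<^sub>R U0 + w *\<^sub>R V0) = 0" "v \<ge> 0" "w \<ge> 0" "v \<noteq> 0 \<or> w \<noteq> 0" for s v w
    proof (rule ccontr)
      assume "s \<notin> {a, b}"
      then have "(s \<bullet> U0) * (s \<bullet> V0) > 0" using others that by auto
      moreover have "v * (s \<bullet> U0) + w * (s \<bullet> V0) = 0" using that by (simp add: inner_add_right)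
      ultimately show False using that
        by (smt (verit) mult_nonneg_nonneg mult_nonneg_nonpos mult_pos_pos mult_pos_neg zero_less_mult_iff)
    qed
    moreover have "s1 \<noteq> r0" "s2 \<noteq> r0"
      using s edge_frame_nonzero[OF ef] r0UV R by metis+
    ultimately have "s1 \<in> {a, b}" "s2 \<in> {a, b}"
      using s xy xy' xy01 nzero by (metis add_0 diff_ge_0_iff_ge scaleR_zero_left)+
    moreover have "s1 \<noteq> s2" using edge_frame_nonzero[OF ef] s R by metis
    ultimately show "a \<bullet> W = 0" "b \<bullet> W = 0" using s by auto
    define X where "X = p + (k * (d / 2)) *\<^sub>R r0"
    have "r0 \<bullet> X = g3 X * (r0 \<bullet> W)"
      unfolding in3[of r0 X] r0UV by simp
    moreover have "g3 X > 0"
    proof -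
      have "\<forall>t\<in>{0<..<d}. g3 (p + (k * t) *\<^sub>R r0) > 0" using e by blast
      moreover have "d / 2 \<in> {0<..<d}" using d(1) by simp
      ultimately show ?thesis unfolding X_def by blast
    qed
    moreover have "r0 \<bullet> X = k * (d / 2 * (r0 \<bullet> r0))"
      using p[of r0] r(1) by (simp add: X_def inner_add_right)
    moreover have "d / 2 * (r0 \<bullet> r0) > 0" using d(1) \<open>r0 \<noteq> 0\<close> by simp
    ultimately have "g3 X * (k * (r0 \<bullet> W)) > 0" "g3 X > 0"
      using k by auto
    then show "k * (r0 \<bullet> W) > 0"
      by (simp add: zero_less_mult_iff)
    show "\<forall>r\<in>R. (r \<bullet> p) * (r \<bullet> W) \<ge> 0"
      using e unfolding pUV by (simp add: inner_add_right distrib_right)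
  qed
  obtain W1 where W1: "a \<bullet> W1 = 0" "b \<bullet> W1 = 0" "r0 \<bullet> W1 > 0" "\<forall>r\<in>R. (r \<bullet> p) * (r \<bullet> W1) \<ge> 0"
  proof -
    obtain U V W g1 g2 g3 where "edge_frame R (\<lambda>t. p + (1 * t) *\<^sub>R r0) 0 d r0 U V W g1 g2 g3"
      using frame[of 1] by blast
    from W[OF _ this] that[of W] show thesis by simp
  qed
  obtain W2 where W2: "a \<bullet> W2 = 0" "b \<bullet> W2 = 0" "r0 \<bullet> W2 < 0" "\<forall>r\<in>R. (r \<bullet> p) * (r \<bullet> W2) \<ge> 0"
  proof -
    obtain U V W g1 g2 g3 where "edge_frame R (\<lambda>t. p + (- 1 * t) *\<^sub>R r0) 0 d r0 U V W g1 g2 g3"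
      using frame[of "-1"] by blast
    from W[OF _ this] that[of W] show thesis by simp
  qed
  define \<kappa> where "\<kappa> = (r0 \<bullet> W2) / (r0 \<bullet> W1)"
  have "\<kappa> < 0" using W1 W2 by (simp add: \<kappa>_def divide_neg_pos)
  have "r0 \<bullet> (W2 - \<kappa> *\<^sub>R W1) = 0" using W1 by (simp add: \<kappa>_def inner_diff_right)
  then obtain x y where xy: "W2 - \<kappa> *\<^sub>R W1 = x *\<^sub>R U0 + y *\<^sub>R V0" using orth by blast
  have "a \<bullet> (W2 - \<kappa> *\<^sub>R W1) = 0" "b \<bullet> (W2 - \<kappa> *\<^sub>R W1) = 0"
    using W1 W2 by (simp_all add: inner_diff_right)
  then have "x = 0" "y = 0" using nz unfolding xy by (simp_all add: inner_add_right U0 V0)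
  then have W2': "W2 = \<kappa> *\<^sub>R W1" using xy by simp
  show "\<exists>W. W \<noteq> 0 \<and> (\<forall>r\<in>R - {r0}. r \<bullet> W = 0)"
  proof (intro exI conjI ballI)
    show "W1 \<noteq> 0" using W1 by auto
    fix r assume "r \<in> R - {r0}"
    then have "(r \<bullet> p) * (r \<bullet> W1) \<ge> 0" "\<kappa> * ((r \<bullet> p) * (r \<bullet> W1)) \<ge> 0" "r \<bullet> p \<noteq> 0"
      using W1 W2 W2' p by (auto simp: mult_ac)
    then show "r \<bullet> W1 = 0"
      using \<open>\<kappa> < 0\<close> by (simp add: zero_le_mult_iff mult_le_0_iff) linarith
  qed
qed

section \<open>Families of lines in the affine dual plane\<close>

definition gap :: "real \<Rightarrow> real \<Rightarrow> real \<times> real \<Rightarrow> real" where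
  "gap s t p = snd p - s * fst p - t"

text \<open>Minus twice the signed area of the triangle \<open>p1\<close>, \<open>p2\<close>,
  \<open>p\<close>: positive to the right of the line directed from \<open>p1\<close> to
  \<open>p2\<close>.\<close>

definition turn :: "real \<times> real \<Rightarrow> real \<times> real \<Rightarrow> real \<times> real \<Rightarrow> real" where
  "turn p1 p2 p = (fst p - fst p1) * (snd p2 - snd p1) - (snd p - snd p1) * (fst p2 - fst p1)"

lemma turn_swap: "turn p2 p1 p = - turn p1 p2 p"
  by (simp add: turn_def algebra_simps)

text \<open>The elements \<open>(x, y)\<close> of \<open>S\<close> and \<open>\<mu>\<close> of \<open>I\<close> stand for the dual points \<open>[x:y:1]\<close> and \<open>[1:\<mu>:0]\<close>. The line
  \<open>y = s x + t\<close> is a point of the original plane; it lies on the line dual to \<open>[1:\<mu>:0]\<close> if \<open>s = \<mu>\<close>.\<close>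

definition sides_meet_aff :: "(real \<times> real) set \<Rightarrow> real set \<Rightarrow> bool" where
  "sides_meet_aff S I \<longleftrightarrow> (\<forall>(s :: real \<Rightarrow> real) (t :: real \<Rightarrow> real) a b p1 p2.
     a < b \<longrightarrow> continuous_on {a..b} s \<longrightarrow> continuous_on {a..b} t \<longrightarrow> p1 \<in> S \<longrightarrow> p2 \<in> S \<longrightarrow> p1 \<noteq> p2 \<longrightarrow>
     (\<forall>p\<in>S. gap (s a) (t a) p = 0 \<longleftrightarrow> p = p1) \<longrightarrow> s a \<notin> I \<longrightarrow>
     (\<forall>p\<in>S. gap (s b) (t b) p = 0 \<longleftrightarrow> p = p2) \<longrightarrow> s b \<notin> I \<longrightarrow>
     (\<forall>\<tau>\<in>{a<..<b}. s \<tau> \<notin> I \<and> (\<forall>p\<in>S. gap (s \<tau>) (t \<tau>) p \<noteq> 0)) \<longrightarrow>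
     (\<exists>\<sigma>\<in>{1, -1::real}. \<forall>p\<in>S. 0 \<le> \<sigma> * gap (s a) (t a) p * turn p1 p2 p))"

text \<open>A path of lines \<open>y = s x + t\<close> that meets each point of \<open>D\<close> exactly once, always crossing it in the same
  direction.\<close>

definition chain :: "(real \<times> real) set \<Rightarrow> real set \<Rightarrow> real set \<Rightarrow> (real \<Rightarrow> real) \<Rightarrow> (real \<Rightarrow> real) \<Rightarrow>
    (real \<times> real) set \<Rightarrow> (real \<times> real \<Rightarrow> real) \<Rightarrow> real \<Rightarrow> bool" where
  "chain S I J s t D \<kappa> e \<longleftrightarrow> sides_meet_aff S I \<and> is_interval J \<and> continuous_on J s \<and> continuous_on J t \<and>
     D \<subseteq> S \<and> e \<noteq> 0 \<and> inj_on \<kappa> D \<and> \<kappa> ` D \<subseteq> J \<and>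
     (\<forall>p\<in>D. gap (s (\<kappa> p)) (t (\<kappa> p)) p = 0) \<and>
     (\<forall>p\<in>D. \<forall>\<tau>\<in>J. \<tau> < \<kappa> p \<longrightarrow> e * gap (s \<tau>) (t \<tau>) p < 0) \<and>
     (\<forall>p\<in>D. \<forall>\<tau>\<in>J. \<kappa> p < \<tau> \<longrightarrow> e * gap (s \<tau>) (t \<tau>) p > 0)"

definition contacts :: "(real \<times> real) set \<Rightarrow> real set \<Rightarrow> real set \<Rightarrow> (real \<Rightarrow> real) \<Rightarrow> (real \<Rightarrow> real) \<Rightarrow> real set" where
  "contacts M I J s t = {\<tau>\<in>J. s \<tau> \<in> I \<or> (\<exists>r\<in>M. gap (s \<tau>) (t \<tau>) r = 0)}"

section \<open>Contacts between consecutive points of a chain\<close>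

lemma chain_step:
  assumes ch: "chain S I J s t D \<kappa> e" and p: "p1 \<in> D" "p2 \<in> D" "\<kappa> p1 < \<kappa> p2"
    and adj: "\<forall>p\<in>D. \<not> (\<kappa> p1 < \<kappa> p \<and> \<kappa> p < \<kappa> p2)"
    and gen: "\<kappa> p1 \<notin> contacts (S - D) I J s t" "\<kappa> p2 \<notin> contacts (S - D) I J s t"
    and free: "contacts (S - D) I J s t \<inter> {\<kappa> p1<..<\<kappa> p2} = {}"
  shows "\<exists>\<sigma>\<in>{1, -1::real}. \<forall>p\<in>S. 0 \<le> \<sigma> * gap (s (\<kappa> p1)) (t (\<kappa> p1)) p * turn p1 p2 p"
proof -
  note c = ch[unfolded chain_def]
  have inJ: "\<kappa> p1 \<in> J" "\<kappa> p2 \<in> J" and intv: "is_interval J" and DS: "D \<subseteq> S" and inj: "inj_on \<kappa> D"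
    using c p by auto
  have J: "x \<in> J" if "\<kappa> p1 \<le> x" "x \<le> \<kappa> p2" for x
    using mem_is_interval_1_I[OF intv inJ that] .
  have neg: "e * gap (s \<tau>) (t \<tau>) p < 0" if "p \<in> D" "\<tau> \<in> J" "\<tau> < \<kappa> p" for p \<tau>
    using c that by blast
  have pos: "e * gap (s \<tau>) (t \<tau>) p > 0" if "p \<in> D" "\<tau> \<in> J" "\<kappa> p < \<tau>" for p \<tau>
    using c that by blast
  have at: "gap (s (\<kappa> p)) (t (\<kappa> p)) p = 0" if "p \<in> D" for p
    using c that by blast
  have zero: "gap (s \<tau>) (t \<tau>) p = 0 \<longleftrightarrow> \<tau> = \<kappa> p" if "p \<in> D" "\<tau> \<in> J" for p \<tau>
    using at[OF that(1)] neg[OF that] pos[OF that] by (cases \<tau> "\<kappa> p" rule: linorder_cases) auto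
  have nc: "\<tau> \<notin> contacts (S - D) I J s t" if "\<kappa> p1 \<le> \<tau>" "\<tau> \<le> \<kappa> p2" for \<tau>
  proof (cases "\<tau> = \<kappa> p1 \<or> \<tau> = \<kappa> p2")
    case True
    then show ?thesis using gen by blast
  next
    case False
    then have "\<tau> \<in> {\<kappa> p1<..<\<kappa> p2}" using that by auto
    then show ?thesis using free by blast
  qed
  have off: "gap (s \<tau>) (t \<tau>) r \<noteq> 0" if "r \<in> S - D" "\<kappa> p1 \<le> \<tau>" "\<tau> \<le> \<kappa> p2" for r \<tau>
    using nc[OF that(2,3)] J[OF that(2,3)] that(1) unfolding contacts_def by blast
  have offI: "s \<tau> \<notin> I" if "\<kappa> p1 \<le> \<tau>" "\<tau> \<le> \<kappa> p2" for \<tau>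
    using nc[OF that] J[OF that] unfolding contacts_def by blast
  have only: "gap (s (\<kappa> r)) (t (\<kappa> r)) r' = 0 \<longleftrightarrow> r' = r" if "r' \<in> S" "r \<in> D" "\<kappa> p1 \<le> \<kappa> r" "\<kappa> r \<le> \<kappa> p2" for r r'
  proof (cases "r' \<in> D")
    case True
    then show ?thesis using zero[OF True J[OF that(3,4)]] inj that(2) by (auto dest: inj_onD)
  next
    case False
    then show ?thesis using off[of r' "\<kappa> r"] that by blast
  qed
  have open_off: "gap (s \<tau>) (t \<tau>) r \<noteq> 0" if "\<kappa> p1 < \<tau>" "\<tau> < \<kappa> p2" "r \<in> S" for \<tau> r
  proof (cases "r \<in> D")
    case True
    then show ?thesis using zero[OF True J[of \<tau>]] that adj by auto
  next
    case False
    then show ?thesis using off[of r \<tau>] that by auto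
  qed
  have sub: "{\<kappa> p1..\<kappa> p2} \<subseteq> J" using J by auto
  have cont: "continuous_on {\<kappa> p1..\<kappa> p2} s" "continuous_on {\<kappa> p1..\<kappa> p2} t"
    using c continuous_on_subset[OF _ sub] by blast+
  have pS: "p1 \<in> S" "p2 \<in> S" "p1 \<noteq> p2" using DS p by auto
  have sm: "sides_meet_aff S I" using c by blast
  show ?thesis
    by (rule sm[unfolded sides_meet_aff_def, rule_format, OF p(3) cont pS])
      (use only[OF _ p(1)] only[OF _ p(2)] offI open_off p(3) in auto)
qed

text \<open>When the path is at \<open>p1\<close>, it has already crossed \<open>p0\<close> but not
  yet \<open>p3\<close>, so these points lie on different sides of the moving line. They lie on the
  same side of the line \<open>p1 p2\<close>. Without a contact, \<open>chain_step\<close> makes the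
  product of the two signs weakly constant on \<open>S\<close>, which is impossible.\<close>

lemma chain_contact_between:
  assumes ch: "chain S I J s t D \<kappa> e" and p: "p1 \<in> D" "p2 \<in> D" "\<kappa> p1 < \<kappa> p2"
    and adj: "\<forall>p\<in>D. \<not> (\<kappa> p1 < \<kappa> p \<and> \<kappa> p < \<kappa> p2)"
    and gen: "\<forall>p\<in>D. \<kappa> p \<notin> contacts (S - D) I J s t"
    and p03: "p0 \<in> D" "p3 \<in> D" "\<kappa> p0 < \<kappa> p1" "\<kappa> p2 < \<kappa> p3" "turn p1 p2 p0 * turn p1 p2 p3 > 0"
  shows "\<exists>z\<in>contacts (S - D) I J s t. \<kappa> p1 < z \<and> z < \<kappa> p2"
proof (rule ccontr)
  assume "\<not> ?thesis"
  then have "contacts (S - D) I J s t \<inter> {\<kappa> p1<..<\<kappa> p2} = {}" by auto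
  then obtain \<sigma> where \<sigma>: "\<sigma> \<in> {1, -1::real}" "\<And>p. p \<in> S \<Longrightarrow> 0 \<le> \<sigma> * gap (s (\<kappa> p1)) (t (\<kappa> p1)) p * turn p1 p2 p"
    using chain_step[OF ch p adj] gen p by meson
  have DS: "D \<subseteq> S" and inJ: "\<kappa> p1 \<in> J"
    using ch p unfolding chain_def by auto
  have neg: "e * gap (s \<tau>) (t \<tau>) p < 0" if "p \<in> D" "\<tau> \<in> J" "\<tau> < \<kappa> p" for p \<tau>
    using ch that unfolding chain_def by blast
  have pos: "e * gap (s \<tau>) (t \<tau>) p > 0" if "p \<in> D" "\<tau> \<in> J" "\<kappa> p < \<tau>" for p \<tau>
    using ch that unfolding chain_def by blast
  define T where "T p = gap (s (\<kappa> p1)) (t (\<kappa> p1)) p" for p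
  have "e * T p0 > 0" "e * T p3 < 0"
    using pos[OF p03(1) inJ p03(3)] neg[OF p03(2) inJ] p p03 unfolding T_def by auto
  then have "T p0 * T p3 < 0"
    by (auto simp: zero_less_mult_iff mult_less_0_iff)
  moreover have "0 \<le> (\<sigma> * T p0 * turn p1 p2 p0) * (\<sigma> * T p3 * turn p1 p2 p3)"
    unfolding T_def by (rule mult_nonneg_nonneg) (use \<sigma>(2) DS p03 in blast)+
  then have "0 \<le> (T p0 * T p3) * (turn p1 p2 p0 * turn p1 p2 p3)"
    using \<sigma>(1) by (auto simp: algebra_simps)
  ultimately show False using p03(5) mult_neg_pos by fastforce
qed

lemma card_le_if_separated:
  fixes G Z :: "real set"
  assumes "finite G" "finite Z" and sep: "\<And>a. a \<in> G \<Longrightarrow> \<exists>z\<in>Z. a < z \<and> (\<forall>b\<in>G. a < b \<longrightarrow> z < b)"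
  shows "card G \<le> card Z"
proof -
  obtain h where h: "\<And>a. a \<in> G \<Longrightarrow> h a \<in> Z \<and> a < h a \<and> (\<forall>b\<in>G. a < b \<longrightarrow> h a < b)"
    using sep by metis
  have "inj_on h G"
    by (rule inj_onI) (metis h less_trans linorder_neqE_linordered_idom order_less_irrefl)
  moreover have "h ` G \<subseteq> Z" using h by auto
  ultimately show ?thesis using assms(2) card_inj_on_le by blast
qed

text \<open>Only the least and the two largest elements are dropped, so that \<open>w\<close>,
  \<open>a\<close>, \<open>b\<close>, \<open>c\<close> can serve as the four points of
  \<open>chain_contact_between\<close>, with \<open>b\<close> the immediate successor of
  \<open>a\<close>.\<close>

lemma inner_subset:
  fixes X :: "real set"
  assumes "finite X"
  obtains G where "G \<subseteq> X" "card X \<le> card G + 3"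
    "\<And>a. a \<in> G \<Longrightarrow> \<exists>w\<in>X. \<exists>b\<in>X. \<exists>c\<in>X. w < a \<and> a < b \<and> b < c \<and> (\<forall>x\<in>X. a < x \<longrightarrow> b \<le> x)"
proof (cases "card X \<le> 3")
  case True
  then show ?thesis using that[of "{}"] by simp
next
  case False
  define m where "m = Max X"
  define X' where "X' = X - {m}"
  have X: "X \<noteq> {}" "finite X'" "X' \<noteq> {}"
  proof -
    show "X \<noteq> {}" "finite X'" using False assms by (auto simp: X'_def)
    have "card X - card {m} \<le> card X'" unfolding X'_def by (rule diff_card_le_card_Diff) simp
    then show "X' \<noteq> {}" using False by auto
  qed
  define m' where "m' = Max X'"
  define G where "G = X - {Min X, m, m'}"
  show ?thesis
  proof (rule that[of G])
    show "G \<subseteq> X" by (auto simp: G_def)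
    have "card X - card {Min X, m, m'} \<le> card G" unfolding G_def by (rule diff_card_le_card_Diff) simp
    moreover have "card {Min X, m, m'} \<le> 3" by (simp add: card_insert_if)
    ultimately show "card X \<le> card G + 3" by linarith
    fix a assume a: "a \<in> G"
    define b where "b = Min {x\<in>X. a < x}"
    have "m' \<in> X'" using X by (simp add: m'_def)
    moreover have "a \<in> X'" using a by (auto simp: G_def X'_def)
    moreover have "a \<noteq> m'" "m \<in> X" using a X assms by (auto simp: G_def m_def)
    moreover have "a \<le> m'" unfolding m'_def using X \<open>a \<in> X'\<close> by simp
    moreover have "m' \<le> m" using \<open>m' \<in> X'\<close> assms by (simp add: m_def X'_def)
    ultimately have am: "a < m'" "m' \<in> X" "m' < m" "m \<in> X"
      by (auto simp: X'_def less_le)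
    have fin: "finite {x\<in>X. a < x}" "{x\<in>X. a < x} \<noteq> {}" using assms am by auto
    have "b \<in> X" "a < b" using Min_in[OF fin] by (auto simp: b_def)
    moreover have "b \<le> m'" using am fin by (auto simp: b_def)
    moreover have "\<forall>x\<in>X. a < x \<longrightarrow> b \<le> x" using fin by (auto simp: b_def)
    moreover have "Min X \<in> X" "Min X < a" using a assms X by (auto simp: G_def less_le)
    ultimately show "\<exists>w\<in>X. \<exists>b\<in>X. \<exists>c\<in>X. w < a \<and> a < b \<and> b < c \<and> (\<forall>x\<in>X. a < x \<longrightarrow> b \<le> x)"
      using am by (meson order_le_less_trans)
  qed
qed

section \<open>Arcs of a Weierstrass cubic\<close>

text \<open>The upper branch \<open>g = sqrt f\<close> satisfies \<open>g'' = \<psi> / (4 f g)\<close>. Hence the zero \<open>x0\<close> of \<open>\<psi>\<close> to the right of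
  the largest root \<open>e\<close> of \<open>f\<close> is the abscissa of the flexes of \<open>y\<^sup>2 = f x\<close>, which divide the part \<open>x \<ge> e\<close> of
  the curve into the three arcs \<open>arcA\<close>, \<open>arcP\<close>, \<open>arcM\<close> below. (If \<open>x0 = e\<close>, then \<open>arcA\<close> is empty, and
  the singular point \<open>(e, 0)\<close> belongs to none of them.)\<close>

locale wcubic =
  fixes p q e x0 :: real
  fixes f f' \<psi> g sl :: "real \<Rightarrow> real"
  defines "f x \<equiv> x^3 + p * x + q"
  defines "f' x \<equiv> 3 * x^2 + p"
  defines "\<psi> x \<equiv> 12 * x * f x - (f' x)^2"
  defines "g x \<equiv> sqrt (f x)"
  defines "sl x \<equiv> f' x / (2 * sqrt (f x))"
  assumes fe: "f e = 0" and f_pos: "e < x \<Longrightarrow> f x > 0"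
    and e_le: "e \<le> x0" and psi0: "\<psi> x0 = 0"
begin

section \<open>Concavity and convexity of the upper branch\<close>

lemma f_nonneg: "e \<le> x \<Longrightarrow> f x \<ge> 0"
  using fe f_pos by (cases "x = e") (auto simp: less_le)

lemma DERIV_f: "(f has_real_derivative f' x) (at x)"
  unfolding f_def[abs_def] f'_def by (auto intro!: derivative_eq_intros)

lemma DERIV_psi: "(\<psi> has_real_derivative 12 * f x) (at x)"
  unfolding \<psi>_def[abs_def] f_def f'_def
  by (auto intro!: derivative_eq_intros simp: algebra_simps power2_eq_square power3_eq_cube)

text \<open>\<open>\<psi>\<close> is the third division polynomial 3 x^4 + 6 p x^2 + 12 q x - p^2.
  Its derivative 12 f is positive beyond \<open>e\<close>, so \<open>x0\<close> is the only place to
  the right of \<open>e\<close> where the branch can pass from concave to convex.\<close>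

lemma psi_mono:
  assumes "e \<le> x" "x < y"
  shows "\<psi> x < \<psi> y"
  using assms(2)
proof (rule DERIV_pos_imp_increasing_open)
  fix z assume "x < z" "z < y"
  then show "\<exists>D. (\<psi> has_real_derivative D) (at z) \<and> D > 0"
    using DERIV_psi f_pos[of z] assms by (intro exI[of _ "12 * f z"]) auto
qed (unfold \<psi>_def[abs_def] f_def[abs_def] f'_def[abs_def], intro continuous_intros)

lemma DERIV_g:
  assumes "e < x"
  shows "(g has_real_derivative sl x) (at x)"
  unfolding g_def[abs_def] using f_pos[OF assms]
  by (auto intro!: derivative_eq_intros DERIV_f simp: sl_def field_simps)

lemma DERIV_sl:
  assumes "e < x"
  shows "(sl has_real_derivative \<psi> x / (4 * f x * g x)) (at x)"
proof -
  have "(f' has_real_derivative 6 * x) (at x)"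
    unfolding f'_def[abs_def] by (auto intro!: derivative_eq_intros)
  moreover have "((\<lambda>x. 2 * sqrt (f x)) has_real_derivative 2 * sl x) (at x)"
    using DERIV_cmult[OF DERIV_g[OF assms], of 2] by (simp add: g_def)
  ultimately have "(sl has_real_derivative (6 * x * (2 * sqrt (f x)) - f' x * (2 * sl x)) / ((2 * sqrt (f x)) * (2 * sqrt (f x)))) (at x)"
    unfolding sl_def[abs_def] using f_pos[OF assms] by (intro DERIV_divide) (auto simp: sl_def)
  moreover have "(6 * x * (2 * sqrt (f x)) - f' x * (2 * sl x)) / ((2 * sqrt (f x)) * (2 * sqrt (f x))) = \<psi> x / (4 * f x * g x)"
    using f_pos[OF assms] by (simp add: sl_def g_def \<psi>_def field_simps power2_eq_square)
  ultimately show ?thesis by simp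
qed

lemma cont_f: "continuous_on X f"
  unfolding f_def[abs_def] by (intro continuous_intros)

lemma cont_g: "continuous_on X g"
  unfolding g_def[abs_def] by (intro continuous_intros cont_f)

lemma cont_sl:
  assumes "X \<subseteq> {e<..}"
  shows "continuous_on X sl"
  unfolding sl_def[abs_def] f'_def
  by (intro continuous_intros cont_f) (use f_pos assms in force)

lemma sl_less:
  assumes "e < a" "x0 \<le> a" "a < b"
  shows "sl a < sl b"
  using assms(3)
proof (rule DERIV_pos_imp_increasing_open)
  fix z assume z: "a < z" "z < b"
  then have "\<psi> z > 0" "f z > 0" using psi_mono[of x0 z] psi0 e_le assms f_pos[of z] by auto
  then show "\<exists>D. (sl has_real_derivative D) (at z) \<and> D > 0"
    using DERIV_sl[of z] z assms by (intro exI[of _ "\<psi> z / (4 * f z * g z)"]) (auto simp: g_def)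
qed (intro cont_sl, use assms in auto)

lemma sl_greater:
  assumes "e < a" "a < b" "b \<le> x0"
  shows "sl a > sl b"
  using assms(2)
proof (rule DERIV_neg_imp_decreasing_open)
  fix z assume z: "a < z" "z < b"
  then have "\<psi> z < 0" "f z > 0" using psi_mono[of z x0] psi0 e_le assms f_pos[of z] by auto
  then show "\<exists>D. (sl has_real_derivative D) (at z) \<and> D < 0"
    using DERIV_sl[of z] z assms by (intro exI[of _ "\<psi> z / (4 * f z * g z)"]) (auto simp: g_def divide_neg_pos)
qed (intro cont_sl, use assms in auto)

text \<open>The case \<open>a = e\<close> is included, although \<open>g\<close> need not be
  differentiable there: the mean value theorem requires only continuity at the ends.\<close>

lemma g_mvt:
  assumes "e \<le> a" "a < b"
  obtains z where "a < z" "z < b" "g b - g a = (b - a) * sl z"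
proof -
  have "\<exists>l z. a < z \<and> z < b \<and> (g has_real_derivative l) (at z) \<and> g b - g a = (b - a) * l"
  proof (rule MVT)
    show "a < b" by fact
    show "continuous_on {a..b} g" by (rule cont_g)
    fix x assume "a < x" "x < b"
    then show "g differentiable (at x)" using DERIV_g[of x] assms real_differentiable_def by auto
  qed
  then obtain l z where "a < z" "z < b" "(g has_real_derivative l) (at z)" "g b - g a = (b - a) * l" by blast
  moreover from this have "l = sl z" using DERIV_g[of z] DERIV_unique assms by force
  ultimately show thesis using that by blast
qed

lemma g_convex:
  assumes "x0 \<le> a" "a < b" "b < c"
  shows "(g b - g a) * (c - b) < (g c - g b) * (b - a)"
proof -
  obtain z where z: "a < z" "z < b" "g b - g a = (b - a) * sl z" by (rule g_mvt[of a b]) (use assms e_le in auto)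
  obtain w where w: "b < w" "w < c" "g c - g b = (c - b) * sl w" by (rule g_mvt[of b c]) (use assms e_le in auto)
  have "sl z < sl w" using sl_less[of z w] z w assms e_le by auto
  then have "sl z * ((b - a) * (c - b)) < sl w * ((b - a) * (c - b))" using assms by simp
  then show ?thesis unfolding z(3) w(3) by (simp add: algebra_simps)
qed

lemma g_concave:
  assumes "e \<le> a" "a < b" "b < c" "c \<le> x0"
  shows "(g b - g a) * (c - b) > (g c - g b) * (b - a)"
proof -
  obtain z where z: "a < z" "z < b" "g b - g a = (b - a) * sl z" by (rule g_mvt[of a b]) (use assms e_le in auto)
  obtain w where w: "b < w" "w < c" "g c - g b = (c - b) * sl w" by (rule g_mvt[of b c]) (use assms e_le in auto)
  have "sl z > sl w" using sl_greater[of z w] z w assms by auto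
  then have "sl z * ((b - a) * (c - b)) > sl w * ((b - a) * (c - b))" using assms by simp
  then show ?thesis unfolding z(3) w(3) by (simp add: algebra_simps)
qed

section \<open>Order and orientation of points on the three arcs\<close>

definition oncurve :: "real \<times> real \<Rightarrow> bool" where
  "oncurve P \<longleftrightarrow> (snd P)^2 = f (fst P)"

definition arcA where "arcA = {P. oncurve P \<and> e \<le> fst P \<and> fst P < x0}"
definition arcP where "arcP = {P. oncurve P \<and> x0 \<le> fst P \<and> snd P > 0}"
definition arcM where "arcM = {P. oncurve P \<and> x0 \<le> fst P \<and> snd P < 0}"

text \<open>\<open>xi\<close> orders the points with \<open>x \<ge> e\<close> along the curve, from the lower to the upper branch.\<close>

definition xi :: "real \<times> real \<Rightarrow> real" where
  "xi P = sgn (snd P) * (fst P - e)"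

lemma oncurve_abs: "oncurve P \<Longrightarrow> \<bar>snd P\<bar> = g (fst P)"
  by (metis g_def oncurve_def real_sqrt_abs)

lemma xi_inj:
  assumes "oncurve P" "oncurve Q" "e \<le> fst P" "e \<le> fst Q" "xi P = xi Q"
  shows "P = Q"
proof -
  have zero: "snd R = 0 \<longleftrightarrow> fst R = e" if "oncurve R" "e \<le> fst R" for R
    using that fe f_pos[of "fst R"] by (cases "fst R = e") (auto simp: oncurve_def)
  have "fst P = fst Q \<and> sgn (snd P) = sgn (snd Q)"
    using assms zero[of P] zero[of Q]
    by (auto simp: xi_def sgn_if split: if_splits)
  moreover from this have "\<bar>snd P\<bar> = \<bar>snd Q\<bar>" using assms oncurve_abs by metis
  ultimately show ?thesis
    by (metis mult_sgn_abs prod.expand)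
qed

lemma turn_arcP:
  assumes "P0 \<in> arcP" "P1 \<in> arcP" "P2 \<in> arcP" "P3 \<in> arcP"
    and "fst P0 < fst P1" "fst P1 < fst P2" "fst P2 < fst P3"
  shows "turn P1 P2 P0 < 0" "turn P1 P2 P3 < 0"
proof -
  have y: "snd P = g (fst P)" if "P \<in> arcP" for P
    using that oncurve_abs[of P] by (auto simp: arcP_def)
  have x: "x0 \<le> fst P0" using assms by (simp add: arcP_def)
  show "turn P1 P2 P0 < 0" "turn P1 P2 P3 < 0"
    using g_convex[of "fst P0" "fst P1" "fst P2"] g_convex[of "fst P1" "fst P2" "fst P3"] assms x
    unfolding turn_def by (simp_all add: y algebra_simps)
qed

text \<open>The first two parts are concavity of the upper branch. For the third, the line through
  the chord has nonnegative height at every abscissa between \<open>e\<close> and \<open>x0\<close>: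
  between the end points it interpolates nonnegative values, and elsewhere it lies above the
  branch.\<close>

lemma turn_arcA_up:
  assumes "e \<le> x1" "x1 < x2" "x2 \<le> x0"
  shows "e \<le> x \<Longrightarrow> x < x1 \<Longrightarrow> turn (x1, g x1) (x2, g x2) (x, g x) > 0"
    and "x2 < x \<Longrightarrow> x \<le> x0 \<Longrightarrow> turn (x1, g x1) (x2, g x2) (x, g x) > 0"
    and "e \<le> x \<Longrightarrow> x \<le> x0 \<Longrightarrow> y < 0 \<Longrightarrow> turn (x1, g x1) (x2, g x2) (x, y) > 0"
proof -
  show 1: "turn (x1, g x1) (x2, g x2) (x, g x) > 0" if "e \<le> x" "x < x1"
    using g_concave[of x x1 x2] that assms unfolding turn_def by (simp add: algebra_simps)
  show 2: "turn (x1, g x1) (x2, g x2) (x, g x) > 0" if "x2 < x" "x \<le> x0"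
    using g_concave[of x1 x2 x] that assms unfolding turn_def by (simp add: algebra_simps)
  show "turn (x1, g x1) (x2, g x2) (x, y) > 0" if "e \<le> x" "x \<le> x0" "y < 0"
  proof -
    have gn: "g z \<ge> 0" if "e \<le> z" for z using f_nonneg[OF that] by (simp add: g_def)
    have "(x - x1) * (g x2 - g x1) + g x1 * (x2 - x1) \<ge> 0"
    proof (cases "x1 \<le> x \<and> x \<le> x2")
      case True
      have "(x - x1) * (g x2 - g x1) + g x1 * (x2 - x1) = g x1 * (x2 - x) + g x2 * (x - x1)"
        by (simp add: algebra_simps)
      then show ?thesis using True gn[of x1] gn[of x2] assms by simp
    next
      case False
      then have "turn (x1, g x1) (x2, g x2) (x, g x) > 0" using 1 2 that by auto
      moreover have "turn (x1, g x1) (x2, g x2) (x, g x) =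
          (x - x1) * (g x2 - g x1) + g x1 * (x2 - x1) - g x * (x2 - x1)"
        by (simp add: turn_def algebra_simps)
      moreover have "g x * (x2 - x1) \<ge> 0" using gn that assms by simp
      ultimately show ?thesis by linarith
    qed
    moreover have "y * (x2 - x1) < 0" using that assms by (simp add: mult_neg_pos)
    moreover have "turn (x1, g x1) (x2, g x2) (x, y) =
          (x - x1) * (g x2 - g x1) + g x1 * (x2 - x1) - y * (x2 - x1)"
      by (simp add: turn_def algebra_simps)
    ultimately show ?thesis by linarith
  qed
qed

text \<open>The chord joins the lower half of \<open>arcA\<close> to the upper one. If
  \<open>u < v \<le> x\<close> or \<open>u = v\<close>, the signs of the factors suffice; in the
  other two cases concavity on the three abscissae is needed.\<close>

lemma turn_arcA_mixed:
  assumes "e \<le> v" "v \<le> x0" "e \<le> u" "u < x" "x \<le> x0" "g u > 0" "g v > 0"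
  shows "turn (v, - g v) (u, g u) (x, g x) > 0"
proof -
  have gx: "g x \<ge> 0" using f_nonneg[of x] assms by (simp add: g_def)
  have t: "turn (v, - g v) (u, g u) (x, g x) = (x - v) * (g u + g v) - (g x + g v) * (u - v)"
    by (simp add: turn_def)
  consider "u < v" "x < v" | "u < v" "v \<le> x" | "u = v" | "v < u" by linarith
  then show ?thesis
  proof cases
    case 1
    then have "(g x - g u) * (v - x) > (g v - g x) * (x - u)" using g_concave[of u x v] assms by auto
    moreover have "g v * (x - u) > 0" using assms by simp
    ultimately show ?thesis unfolding t by (simp add: algebra_simps)
  next
    case 2
    have "(x - v) * (g u + g v) \<ge> 0" using 2 assms by simp
    moreover have "(g x + g v) * (v - u) > 0" using 2 assms gx by simp
    ultimately show ?thesis unfolding t by (simp add: algebra_simps)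
  next
    case 3
    then show ?thesis unfolding t using assms by simp
  next
    case 4
    then have "(g u - g v) * (x - u) > (g x - g u) * (u - v)" using g_concave[of v u x] assms by auto
    moreover have "g v * (x - u) > 0" using assms by simp
    ultimately show ?thesis unfolding t by (simp add: algebra_simps)
  qed
qed

text \<open>The symmetry of the curve. It exchanges the branches, reverses the order
  \<open>xi\<close> and changes the sign of \<open>turn\<close>, so that statements about the upper
  half carry over to the lower half.\<close>

definition mirror :: "real \<times> real \<Rightarrow> real \<times> real" where "mirror P = (fst P, - snd P)"

lemma mirror_simps [simp]: "fst (mirror P) = fst P" "snd (mirror P) = - snd P" "mirror (mirror P) = P"
  by (simp_all add: mirror_def)

lemma turn_mirror: "turn (mirror P1) (mirror P2) (mirror P) = - turn P1 P2 P"
  by (simp add: turn_def algebra_simps)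

lemma xi_mirror [simp]: "xi (mirror P) = - xi P"
  by (simp add: xi_def sgn_minus)

lemma oncurve_mirror [simp]: "oncurve (mirror P) = oncurve P"
  by (simp add: oncurve_def)

lemma mirror_arcs:
  "mirror P \<in> arcA \<longleftrightarrow> P \<in> arcA" "mirror P \<in> arcP \<longleftrightarrow> P \<in> arcM" "mirror P \<in> arcM \<longleftrightarrow> P \<in> arcP"
  by (auto simp: arcA_def arcP_def arcM_def)

lemma turn_arcA_nonneg:
  assumes P: "P0 \<in> arcA" "P1 \<in> arcA" "P2 \<in> arcA" "P3 \<in> arcA"
    and xi: "xi P0 < xi P1" "xi P1 < xi P2" "xi P2 < xi P3" and y: "snd P1 \<ge> 0"
  shows "turn P1 P2 P0 > 0" "turn P1 P2 P3 > 0"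
proof -
  have up: "P = (fst P, g (fst P))" if "P \<in> arcA" "snd P \<ge> 0" for P
    using that oncurve_abs[of P] by (simp add: arcA_def prod_eq_iff)
  have x: "e \<le> fst P" "fst P < x0" if "P \<in> arcA" for P using that by (auto simp: arcA_def)
  have zero: "fst P = e" if "P \<in> arcA" "snd P = 0" for P
    using that f_pos[of "fst P"] by (cases "fst P = e") (auto simp: arcA_def oncurve_def)
  have xiv: "xi P = fst P - e" if "P \<in> arcA" "snd P \<ge> 0" for P
    using that zero[of P] by (cases "snd P = 0") (auto simp: xi_def)
  have xin: "xi P \<le> 0" if "P \<in> arcA" "snd P < 0" for P
    using that x[of P] by (simp add: xi_def)
  have p1: "xi P1 \<ge> 0" using xiv[OF P(2) y] x[OF P(2)] by simp
  have y2: "snd P2 \<ge> 0" "snd P3 \<ge> 0" using xin[OF P(3)] xin[OF P(4)] xi p1 by linarith+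
  have lt: "fst P1 < fst P2" "fst P2 < fst P3" using xiv[OF P(2) y] xiv[OF P(3) y2(1)] xiv[OF P(4) y2(2)] xi by linarith+
  show "turn P1 P2 P3 > 0"
    using turn_arcA_up(2)[of "fst P1" "fst P2" "fst P3"] lt x[OF P(2)] x[OF P(3)] x[OF P(4)]
      up[OF P(2) y] up[OF P(3) y2(1)] up[OF P(4) y2(2)] by simp
  show "turn P1 P2 P0 > 0"
  proof (cases "snd P0 \<ge> 0")
    case True
    then have "fst P0 < fst P1" using xiv[OF P(1)] xiv[OF P(2) y] xi by simp
    then show ?thesis
      using turn_arcA_up(1)[of "fst P1" "fst P2" "fst P0"] lt x[OF P(2)] x[OF P(3)] x[OF P(1)]
        up[OF P(2) y] up[OF P(3) y2(1)] up[OF P(1) True] by simp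
  next
    case False
    then show ?thesis
      using turn_arcA_up(3)[of "fst P1" "fst P2" "fst P0" "snd P0"] lt x[OF P(2)] x[OF P(3)] x[OF P(1)]
        up[OF P(2) y] up[OF P(3) y2(1)] by simp
  qed
qed

text \<open>\<open>arcA\<close> is a convex arc around its vertical tangent at the point with
  abscissa \<open>e\<close>. The three cases are a chord of the closed upper half, a chord of the
  closed lower half, reduced to the former by reflection, and a chord that joins the open
  halves.\<close>

lemma turn_arcA:
  assumes P: "P0 \<in> arcA" "P1 \<in> arcA" "P2 \<in> arcA" "P3 \<in> arcA"
    and xi: "xi P0 < xi P1" "xi P1 < xi P2" "xi P2 < xi P3"
  shows "turn P1 P2 P0 * turn P1 P2 P3 > 0"
proof -
  consider "snd P1 \<ge> 0" | "snd P2 \<le> 0" | "snd P1 < 0" "snd P2 > 0" by linarith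
  then show ?thesis
  proof cases
    case 1
    then show ?thesis using turn_arcA_nonneg[OF P xi] by simp
  next
    case 2
    have "turn (mirror P2) (mirror P1) (mirror P3) > 0" "turn (mirror P2) (mirror P1) (mirror P0) > 0"
      using turn_arcA_nonneg[of "mirror P3" "mirror P2" "mirror P1" "mirror P0"] P xi 2 by (simp_all add: mirror_arcs)
    then show ?thesis by (simp add: turn_mirror turn_swap[of P1 P2] mult_neg_neg)
  next
    case 3
    have mixed: "turn V U X > 0" if "V \<in> arcA" "U \<in> arcA" "X \<in> arcA" "snd V < 0" "snd U > 0" "xi U < xi X" for U V X
    proof -
      have e: "e \<le> fst V" "fst V < x0" "e \<le> fst U" "fst U < x0" "e \<le> fst X" "fst X < x0"
        using that by (auto simp: arcA_def)
      have "xi U = fst U - e" using that by (simp add: xi_def)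
      then have "xi X > 0" using e that f_pos by linarith
      then have "snd X > 0" using e by (auto simp: xi_def zero_less_mult_iff)
      then have "xi X = fst X - e" by (simp add: xi_def)
      have "V = (fst V, - g (fst V))" "U = (fst U, g (fst U))" "X = (fst X, g (fst X))"
        using oncurve_abs[of V] oncurve_abs[of U] oncurve_abs[of X] that \<open>snd X > 0\<close>
        by (auto simp: arcA_def prod_eq_iff)
      moreover have "fst U < fst X" using that \<open>xi U = _\<close> \<open>xi X = _\<close> by simp
      moreover have "g (fst U) > 0" "g (fst V) > 0"
        using that oncurve_abs[of V] oncurve_abs[of U] by (auto simp: arcA_def)
      ultimately show ?thesis
        using turn_arcA_mixed[of "fst V" "fst U" "fst X"] e by simp
    qed
    have "turn P1 P2 P3 > 0" using mixed[of P1 P2 P3] P xi 3 by simp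
    moreover have "turn (mirror P2) (mirror P1) (mirror P0) > 0"
      using mixed[of "mirror P2" "mirror P1" "mirror P0"] P xi 3 by (simp add: mirror_arcs)
    then have "turn P1 P2 P0 > 0" by (simp add: turn_mirror turn_swap[of P1 P2])
    ultimately show ?thesis by simp
  qed
qed

definition arcs where "arcs = {arcA, arcP, arcM}"

lemma xi_arcP: "P \<in> arcP \<Longrightarrow> xi P = fst P - e" and xi_arcM: "P \<in> arcM \<Longrightarrow> xi P = e - fst P"
  by (auto simp: arcP_def arcM_def xi_def)

lemma turn_same_arc:
  assumes "C \<in> arcs" "P0 \<in> C" "P1 \<in> C" "P2 \<in> C" "P3 \<in> C"
    and xi: "xi P0 < xi P1" "xi P1 < xi P2" "xi P2 < xi P3"
  shows "turn P1 P2 P0 * turn P1 P2 P3 > 0"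
proof -
  consider "C = arcA" | "C = arcP" | "C = arcM" using assms(1) by (auto simp: arcs_def)
  then show ?thesis
  proof cases
    case 1
    then show ?thesis using turn_arcA assms by blast
  next
    case 2
    then show ?thesis using turn_arcP[of P0 P1 P2 P3] assms xi_arcP mult_neg_neg by simp
  next
    case 3
    then have "turn (mirror P2) (mirror P1) (mirror P3) < 0" "turn (mirror P2) (mirror P1) (mirror P0) < 0"
      using turn_arcP[of "mirror P3" "mirror P2" "mirror P1" "mirror P0"] assms xi_arcM
      by (simp_all add: mirror_arcs)
    then show ?thesis by (simp add: turn_mirror turn_swap[of P1 P2] mult_neg_neg)
  qed
qed

text \<open>Each arc is an interval for the order \<open>xi\<close>. Hence points that are
  consecutive among the chosen points of an arc remain consecutive among all chosen points with x
  \<ge> e.\<close>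

lemma xi_between:
  assumes "C \<in> arcs" "P \<in> C" "Q \<in> C" "oncurve X" "e \<le> fst X" "xi P < xi X" "xi X < xi Q"
  shows "X \<in> C"
proof -
  have sx: "snd X = 0 \<longleftrightarrow> fst X = e"
    using assms(4,5) fe f_pos[of "fst X"] by (cases "fst X = e") (auto simp: oncurve_def)
  have A: "\<bar>xi Y\<bar> < x0 - e" if "Y \<in> arcA" for Y
    using that by (auto simp: arcA_def xi_def sgn_if)
  have ax: "\<bar>xi X\<bar> = fst X - e" using sx assms(5) by (auto simp: xi_def sgn_if)
  have sgn: "xi X > 0 \<Longrightarrow> snd X > 0" "xi X < 0 \<Longrightarrow> snd X < 0"
    using assms(5) by (auto simp: xi_def zero_less_mult_iff mult_less_0_iff sgn_if split: if_splits)
  consider "C = arcA" | "C = arcP" | "C = arcM" using assms(1) by (auto simp: arcs_def)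
  then show ?thesis
  proof cases
    case 1
    then have "\<bar>xi X\<bar> < x0 - e" using A[of P] A[of Q] assms by auto
    then show ?thesis using 1 ax assms by (auto simp: arcA_def)
  next
    case 2
    then have "xi X > x0 - e" "xi X > 0" using assms xi_arcP[of P] e_le by (auto simp: arcP_def)
    then show ?thesis using 2 ax sgn assms by (auto simp: arcP_def)
  next
    case 3
    then have "xi X < e - x0" "xi X < 0" using assms xi_arcM[of Q] e_le by (auto simp: arcM_def)
    then show ?thesis using 3 ax sgn assms by (auto simp: arcM_def)
  qed
qed

section \<open>Tangents to the upper branch\<close>

definition tgap :: "real \<Rightarrow> real \<times> real \<Rightarrow> real" where
  "tgap c P = snd P - g c - sl c * (fst P - c)"

text \<open>The double root at \<open>c\<close> is the tangency. Since \<open>f\<close> has no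
  quadratic term, the three roots add up to \<open>(sl c)^2\<close>, and this gives the third
  one.\<close>

lemma tangent_identity:
  assumes "e < c"
  shows "f x - (g c + sl c * (x - c))^2 = (x - c)^2 * (x + 2 * c - (sl c)^2)"
proof -
  have "f c > 0" by (rule f_pos[OF assms])
  then have "(g c)^2 = f c" "2 * g c * sl c = f' c" by (simp_all add: g_def sl_def)
  then have "f x - (g c + sl c * (x - c))^2 = f x - f c - f' c * (x - c) - (sl c)^2 * (x - c)^2"
    by (simp add: power2_eq_square algebra_simps)
  also have "f x - f c - f' c * (x - c) = (x - c)^2 * (x + 2 * c)"
    by (simp add: f_def f'_def power2_eq_square power3_eq_cube algebra_simps)
  finally show ?thesis by (simp add: algebra_simps)
qed

lemma tangent_third:
  assumes "e < c" "oncurve P" "tgap c P = 0" "fst P \<noteq> c"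
  shows "f x - (g c + sl c * (x - c))^2 = (x - c)^2 * (x - fst P)"
proof -
  have "snd P = g c + sl c * (fst P - c)" using assms(3) by (simp add: tgap_def)
  then have "(fst P - c)^2 * (fst P + 2 * c - (sl c)^2) = 0"
    using tangent_identity[OF assms(1), of "fst P"] assms(2) by (simp add: oncurve_def)
  then have "fst P + 2 * c - (sl c)^2 = 0" using assms(4) by simp
  then have "x + 2 * c - (sl c)^2 = x - fst P" for x by simp
  then show ?thesis using tangent_identity[OF assms(1), of x] by simp
qed

text \<open>In differential form: the derivative of \<open>tgap c P\<close> with respect to
  \<open>c\<close> is the derivative of the slope times \<open>c - fst P\<close>, and the slope
  increases beyond the flex. So \<open>P\<close> sinks relative to the tangent until the point of
  tangency is above or below \<open>P\<close>, and rises afterwards.\<close>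

lemma tgap_decreasing:
  assumes "e < a" "x0 \<le> a" "a < b" "b \<le> fst P"
  shows "tgap b P < tgap a P"
proof -
  obtain z where z: "a < z" "z < b" "g b - g a = (b - a) * sl z"
    by (rule g_mvt[of a b]) (use assms in auto)
  have "sl a < sl z" "sl a < sl b" using sl_less[of a z] sl_less[of a b] z assms by auto
  then have "(sl z - sl a) * (b - a) > 0" "(sl b - sl a) * (fst P - b) \<ge> 0" using assms by simp_all
  then show ?thesis using z(3) unfolding tgap_def by (simp add: algebra_simps)
qed

lemma tgap_increasing:
  assumes "e < a" "x0 \<le> a" "a < b" "fst P \<le> a"
  shows "tgap a P < tgap b P"
proof -
  obtain z where z: "a < z" "z < b" "g b - g a = (b - a) * sl z"
    by (rule g_mvt[of a b]) (use assms in auto)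
  have "sl z < sl b" "sl a < sl b" using sl_less[of z b] sl_less[of a b] z assms by auto
  then have "(sl b - sl z) * (b - a) > 0" "(sl b - sl a) * (a - fst P) \<ge> 0" using assms by simp_all
  then show ?thesis using z(3) unfolding tgap_def by (simp add: algebra_simps)
qed

lemma cont_tgap:
  assumes "X \<subseteq> {e<..}"
  shows "continuous_on X (\<lambda>c. tgap c P)"
  unfolding tgap_def by (intro continuous_intros cont_g cont_sl assms)

lemma tgap_at_top: "filterlim (\<lambda>c. tgap c P) at_top at_top"
  unfolding tgap_def g_def sl_def f_def f'_def by real_asymp

lemma tgap_pos_ex: "\<exists>c>a. tgap c P > 0"
proof -
  have "\<forall>\<^sub>F c in at_top. tgap c P > 0 \<and> c > a"
    using tgap_at_top by (intro eventually_conj) (auto simp: filterlim_at_top_dense eventually_gt_at_top)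
  then show ?thesis by (metis (no_types, lifting) eventually_happens trivial_limit_at_top_linorder)
qed

lemma tgap_zero_ex:
  assumes "e < a" "tgap a P \<le> 0"
  obtains c where "a \<le> c" "tgap c P = 0"
proof -
  obtain b where "a < b" "tgap b P > 0" using tgap_pos_ex by blast
  then have "\<exists>c\<ge>a. c \<le> b \<and> tgap c P = 0"
    using assms by (intro IVT' cont_tgap) auto
  then show thesis using that by blast
qed

text \<open>Up to the abscissa of \<open>P\<close> the value stays at most its initial one, which is
  negative; after that it increases strictly and without bound. Hence there is a single crossing,
  always from below to above the line.\<close>

lemma tgap_cross:
  assumes "e < a" "x0 \<le> a" "tgap a P + \<epsilon> < 0"
  obtains \<kappa> where "a < \<kappa>" "tgap \<kappa> P + \<epsilon> = 0" "\<And>c. a \<le> c \<Longrightarrow> c < \<kappa> \<Longrightarrow> tgap c P + \<epsilon> < 0"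
    "\<And>c. \<kappa> < c \<Longrightarrow> tgap c P + \<epsilon> > 0"
proof -
  define b where "b = max a (fst P)"
  have low: "tgap c P \<le> tgap a P" if "a \<le> c" "c \<le> b" for c
    using tgap_decreasing[of a c P] that assms by (cases "c = a") (auto simp: b_def max_def split: if_splits)
  have inc: "tgap c P < tgap d P" if "b \<le> c" "c < d" for c d
    using tgap_increasing[of c d P] that assms by (auto simp: b_def)
  obtain d where d: "b < d" "tgap d (fst P, snd P + \<epsilon>) > 0" using tgap_pos_ex by blast
  have eps: "tgap c (fst P, snd P + \<epsilon>) = tgap c P + \<epsilon>" for c by (simp add: tgap_def)
  have "b \<ge> a" by (simp add: b_def)
  have "tgap b P + \<epsilon> < 0" using low[of b] assms \<open>b \<ge> a\<close> by simp
  then have "\<exists>\<kappa>\<ge>b. \<kappa> \<le> d \<and> tgap \<kappa> P + \<epsilon> = 0"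
    using d assms \<open>b \<ge> a\<close> unfolding eps by (intro IVT' continuous_intros cont_tgap) auto
  then obtain \<kappa> where \<kappa>: "\<kappa> \<ge> b" "tgap \<kappa> P + \<epsilon> = 0" by blast
  then have "\<kappa> > b" using \<open>tgap b P + \<epsilon> < 0\<close> by (cases "\<kappa> = b") auto
  show thesis
  proof (rule that[of \<kappa>])
    show "a < \<kappa>" using \<open>\<kappa> > b\<close> \<open>b \<ge> a\<close> by simp
    show "tgap \<kappa> P + \<epsilon> = 0" by fact
    show "tgap c P + \<epsilon> < 0" if "a \<le> c" "c < \<kappa>" for c
      using that low[of c] inc[of c \<kappa>] \<kappa> assms by (cases "c \<le> b") auto
    show "tgap c P + \<epsilon> > 0" if "\<kappa> < c" for c
      using that inc[of \<kappa> c] \<kappa> by simp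
  qed
qed

lemma tgap_contacts:
  assumes "e < a" "x0 \<le> a"
  shows "finite {c\<in>{a..}. tgap c P + \<epsilon> = 0} \<and> card {c\<in>{a..}. tgap c P + \<epsilon> = 0} \<le> 2"
proof -
  let ?X = "{c\<in>{a..fst P}. tgap c P + \<epsilon> = 0}" and ?Y = "{c\<in>{max a (fst P)..}. tgap c P + \<epsilon> = 0}"
  have X: "x = y" if "x \<in> ?X" "y \<in> ?X" for x y
    using that tgap_decreasing[of x y P] tgap_decreasing[of y x P] assms
    by (cases x y rule: linorder_cases) auto
  have Y: "x = y" if "x \<in> ?Y" "y \<in> ?Y" for x y
    using that tgap_increasing[of x y P] tgap_increasing[of y x P] assms
    by (cases x y rule: linorder_cases) auto
  have fin: "finite Z \<and> card Z \<le> 1" if "\<And>x y. x \<in> Z \<Longrightarrow> y \<in> Z \<Longrightarrow> x = y" for Z :: "real set"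
  proof (cases "Z = {}")
    case False
    then obtain z where "z \<in> Z" by blast
    then have "Z = {z}" using that by blast
    then show ?thesis by simp
  qed simp
  have "{c\<in>{a..}. tgap c P + \<epsilon> = 0} \<subseteq> ?X \<union> ?Y" by auto
  moreover have "finite (?X \<union> ?Y)" "card (?X \<union> ?Y) \<le> 2"
    using fin[of ?X, OF X] fin[of ?Y, OF Y] card_Un_le[of ?X ?Y] by auto
  ultimately show ?thesis by (meson card_mono finite_subset le_trans)
qed

text \<open>Such a point is eventually above the tangents, so it suffices that no tangent beyond the
  flex passes through it. If one did, with the point left of \<open>e\<close>, then
  \<open>f e\<close> minus a square would be positive by \<open>tangent_third\<close>, although
  \<open>f e = 0\<close>.\<close>

lemma tgap_off_curve:
  assumes "x0 < c" "oncurve P" "fst P < e \<or> P = (e, 0) \<and> x0 = e"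
  shows "tgap c P > 0"
proof -
  have nz: "tgap d P \<noteq> 0" if d: "x0 < d" for d
  proof
    assume z: "tgap d P = 0"
    have "e < d" "fst P \<noteq> d" using d e_le assms(3) by auto
    note third = tangent_third[OF this(1) assms(2) z this(2)]
    from assms(3) show False
    proof
      assume "fst P < e"
      then have "(e - d)^2 * (e - fst P) > 0" using \<open>e < d\<close> by simp
      moreover have "f e - (g d + sl d * (e - d))^2 \<le> 0" using fe by simp
      ultimately show False using third[of e] by linarith
    next
      \<comment> \<open>Here \<open>\<psi> e = 0\<close> makes \<open>e\<close> a double root of
        \<open>f\<close>. A tangent at \<open>d\<close> through the singular point has
        \<open>(sl d)^2\<close> equal both to d + 2 e and to 3 (d + e) / 2, which forces d =
        e.\<close>
      assume P: "P = (e, 0) \<and> x0 = e"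
      then have gd: "g d = sl d * (d - e)"
        using z by (simp add: tgap_def algebra_simps)
      have "f' e = 0" using psi0 P fe by (simp add: \<psi>_def)
      then have pe: "p = - 3 * e^2" by (simp add: f'_def)
      have qe: "q = 2 * e^3"
        using fe by (simp add: f_def pe power2_eq_square power3_eq_cube)
      then have fd: "f d = (d - e)^2 * (d + 2 * e)" "f' d = 3 * (d - e) * (d + e)"
        by (simp_all add: f_def f'_def pe qe power2_eq_square power3_eq_cube algebra_simps)
      have "f d > 0" by (rule f_pos[OF \<open>e < d\<close>])
      then have "(g d)^2 = f d" "2 * g d * sl d = f' d" by (simp_all add: g_def sl_def)
      then have "(d - e)^2 * (sl d)^2 = (d - e)^2 * (d + 2 * e)" "(d - e) * (2 * (sl d)^2) = (d - e) * (3 * (d + e))"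
        unfolding gd fd by (simp_all add: power2_eq_square algebra_simps)
      then have "(sl d)^2 = d + 2 * e" "2 * (sl d)^2 = 3 * (d + e)" using \<open>e < d\<close> by auto
      then show False using \<open>e < d\<close> by simp
    qed
  qed
  show ?thesis
  proof (rule ccontr)
    assume "\<not> ?thesis"
    then obtain d where "c \<le> d" "tgap d P = 0"
      using tgap_zero_ex[of c P] assms(1) e_le by (metis le_less_trans not_less)
    then show False using nz assms(1) by auto
  qed
qed

lemma tgap_arcP:
  assumes "x0 < c" "P \<in> arcP"
  shows "tgap c P \<ge> 0"
proof -
  have x: "x0 \<le> fst P" "snd P = g (fst P)" using assms(2) oncurve_abs[of P] by (auto simp: arcP_def)
  have "fst P \<noteq> e" using assms(2) fe by (auto simp: arcP_def oncurve_def)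
  then have "e < fst P" using x e_le by simp
  have z: "tgap (fst P) P = 0" using x by (simp add: tgap_def)
  consider "c < fst P" | "c = fst P" | "fst P < c" by linarith
  then show ?thesis
  proof cases
    case 1
    then show ?thesis using tgap_decreasing[of c "fst P" P] z assms e_le by simp
  next
    case 3
    then show ?thesis using tgap_increasing[of "fst P" c P] z \<open>e < fst P\<close> x by simp
  qed (use z in simp)
qed

text \<open>At a zero of the tangent line left of \<open>x1\<close> the value of \<open>f\<close>
  would be \<open>(z - c)^2 * (z - x1)\<close>, which is negative.\<close>

lemma tangent_pos_left:
  assumes "e < c" "e \<le> x" "x < x1" "g c + sl c * (x1 - c) > 0"
    and third: "\<And>x. f x - (g c + sl c * (x - c))^2 = (x - c)^2 * (x - x1)" and "x1 < c"
  shows "g c + sl c * (x - c) > 0"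
proof (rule ccontr)
  define T where "T x = g c + sl c * (x - c)" for x
  assume "\<not> ?thesis"
  then have "T x \<le> 0" "0 \<le> T x1" using assms by (auto simp: T_def)
  then have "\<exists>z\<ge>x. z \<le> x1 \<and> T z = 0"
    using assms by (intro IVT') (auto simp: T_def intro!: continuous_intros)
  then obtain z where z: "x \<le> z" "z \<le> x1" "T z = 0" by blast
  then have "z \<noteq> x1" using assms by (auto simp: T_def)
  then have "(z - c)^2 * (z - x1) < 0" using z assms by (intro mult_pos_neg) auto
  moreover have "f z = (z - c)^2 * (z - x1)" using third[of z] \<open>T z = 0\<close> unfolding T_def by simp
  moreover have "f z \<ge> 0" using z assms f_nonneg by simp
  ultimately show False by simp
qed

lemma arc_not_tangency:
  assumes "P \<in> arcA \<union> arcM" "x0 < c" "tgap c P = 0"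
  shows "fst P \<noteq> c"
proof
  assume "fst P = c"
  then have "snd P = g c" using assms(3) by (simp add: tgap_def)
  moreover have "g c > 0" using f_pos[of c] assms e_le by (simp add: g_def)
  ultimately show False using assms \<open>fst P = c\<close> by (auto simp: arcA_def arcM_def)
qed

text \<open>When the tangent passes through \<open>P\<close>, the points before \<open>P\<close> are
  still below it, so they are met later: for growing \<open>c\<close> the points are met in
  decreasing order of \<open>xi\<close>. The reason is \<open>tangent_third\<close>: at
  \<open>Q\<close>, the square of the ordinate minus the square of the height of the tangent has the
  sign of \<open>fst Q - fst P\<close>, except that it is 0 at the tangency.\<close>

lemma tgap_order:
  assumes P: "P \<in> arcA \<union> arcM" and c: "x0 < c" "tgap c P = 0"
    and Q: "oncurve Q" "e \<le> fst Q" and xi: "xi Q < xi P"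
  shows "tgap c Q < 0"
proof -
  have ec: "e < c" using c e_le by simp
  note third = tangent_third[OF ec _ c(2) arc_not_tangency[OF P c]]
  have on: "oncurve P" "e \<le> fst P" using P e_le by (auto simp: arcA_def arcM_def)
  note third = third[OF on(1)]
  define T where "T x = g c + sl c * (x - c)" for x
  have TP: "T (fst P) = snd P" using c(2) by (simp add: T_def tgap_def)
  have tQ: "tgap c Q = snd Q - T (fst Q)" by (simp add: T_def tgap_def)
  have yQ: "(snd Q)^2 - (T (fst Q))^2 = (fst Q - c)^2 * (fst Q - fst P)"
    using third[of "fst Q"] Q by (simp add: oncurve_def T_def)
  have up: "T x > 0" if "snd P > 0" "e \<le> x" "x < fst P" for x
  proof -
    have "P \<in> arcA" using P that by (auto simp: arcM_def)
    then have "fst P < c" using c by (auto simp: arcA_def)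
    show ?thesis
      unfolding T_def
      by (rule tangent_pos_left[OF ec that(2,3) _ third \<open>fst P < c\<close>]) (use TP that in \<open>simp add: T_def\<close>)
  qed
  have xiP: "xi P = fst P - e" if "snd P > 0" using that by (simp add: xi_def)
  have xiQ: "xi Q = fst Q - e" if "snd Q \<ge> 0"
    using that Q f_pos[of "fst Q"] by (cases "fst Q = e") (auto simp: xi_def sgn_if oncurve_def)
  show ?thesis
  proof (cases "snd Q \<ge> 0")
    case True
    then have "xi P > 0" using xi xiQ Q by simp
    then have "snd P > 0" using on by (auto simp: xi_def zero_less_mult_iff)
    then have lt: "fst Q < fst P" using xi xiP xiQ[OF True] by simp
    have "P \<in> arcA" using P \<open>snd P > 0\<close> by (auto simp: arcM_def)
    then have "fst Q < c" using lt c by (auto simp: arcA_def)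
    then have "(fst Q - c)^2 * (fst Q - fst P) < 0"
      using lt by (intro mult_pos_neg) auto
    then have "(snd Q)^2 < (T (fst Q))^2" using yQ by linarith
    moreover have "T (fst Q) > 0" using up[OF \<open>snd P > 0\<close> Q(2) lt] .
    ultimately show ?thesis unfolding tQ using power_less_imp_less_base[of "snd Q" 2 "T (fst Q)"] by simp
  next
    case False
    show ?thesis
    proof (cases "fst Q < fst P")
      case True
      have "snd P > 0"
      proof (rule ccontr)
        assume np: "\<not> snd P > 0"
        have "snd P \<noteq> 0" using True on Q f_pos[of "fst P"] by (auto simp: oncurve_def)
        then have "xi P = e - fst P" "xi Q = e - fst Q" using np False by (simp_all add: xi_def)
        then show False using xi True by simp
      qed
      then show ?thesis using up[OF _ Q(2) True] False unfolding tQ by simp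
    next
      case ge: False
      then have "(T (fst Q))^2 \<le> (snd Q)^2" using yQ by (smt (verit) mult_nonneg_nonneg zero_le_power2)
      then have "\<bar>T (fst Q)\<bar> \<le> \<bar>snd Q\<bar>" by (simp add: abs_le_square_iff)
      then have "snd Q \<le> T (fst Q)" using False by simp
      moreover have "snd Q \<noteq> T (fst Q)"
      proof
        assume eq: "snd Q = T (fst Q)"
        then have "(fst Q - c)^2 * (fst Q - fst P) = 0" using yQ by simp
        then consider "fst Q = c" | "fst Q = fst P" by auto
        then show False
        proof cases
          case 1
          then have "T (fst Q) = g c" by (simp add: T_def)
          moreover have "g c > 0" using f_pos[OF ec] by (simp add: g_def)
          ultimately show False using eq False by simp
        next
          case 2
          then have "Q = P" using eq TP by (simp add: prod_eq_iff)
          then show False using xi by simp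
        qed
      qed
      ultimately show ?thesis unfolding tQ by simp
    qed
  qed
qed

lemma sl_flex:
  assumes "e < x0"
  shows "(sl x0)^2 = 3 * x0"
proof -
  have "12 * x0 * f x0 = (f' x0)^2" using psi0 by (simp add: \<psi>_def)
  moreover have "f x0 > 0" by (rule f_pos[OF assms])
  ultimately show ?thesis by (simp add: sl_def power_divide power_mult_distrib field_simps)
qed

text \<open>For \<open>arcA\<close> the motion starts at the flex, where the contact is triple: f -
  T^2 = (x - x0)^3 is negative left of \<open>x0\<close>, so \<open>P\<close> is below the tangent.
  For \<open>arcM\<close> it starts at the tangent above \<open>P\<close>; an earlier tangent
  through \<open>P\<close> would have a zero between its tangency and \<open>P\<close>, where
  \<open>f\<close> would not be positive.\<close>

lemma ex_tangent_through:
  assumes P: "P \<in> arcA \<union> arcM"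
  obtains c where "x0 < c" "tgap c P = 0" "\<And>d. x0 < d \<Longrightarrow> d < c \<Longrightarrow> tgap d P < 0"
proof -
  consider "P \<in> arcA" | "P \<in> arcM" using P by blast
  then show thesis
  proof cases
    case 1
    then have x: "e \<le> fst P" "fst P < x0" "oncurve P" by (auto simp: arcA_def)
    then have "e < x0" by simp
    have third: "f x - (g x0 + sl x0 * (x - x0))^2 = (x - x0)^2 * (x - x0)" for x
      using tangent_identity[OF \<open>e < x0\<close>, of x] sl_flex[OF \<open>e < x0\<close>] by simp
    define T where "T x = g x0 + sl x0 * (x - x0)" for x
    have neg: "(x - x0)^2 * (x - x0) < 0" if "x < x0" for x using that by (intro mult_pos_neg) auto
    have "T (fst P) > 0"
    proof (rule ccontr)
      assume "\<not> ?thesis"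
      moreover have "T x0 > 0" using f_pos[OF \<open>e < x0\<close>] by (simp add: T_def g_def)
      ultimately have "\<exists>z\<ge>fst P. z \<le> x0 \<and> T z = 0"
        using x by (intro IVT') (auto simp: T_def intro!: continuous_intros)
      then obtain z where "fst P \<le> z" "z \<le> x0" "T z = 0" by blast
      then have "z < x0" "f z \<ge> 0" using \<open>T x0 > 0\<close> x f_nonneg[of z] by (cases "z = x0", auto)
      then show False using third[of z] neg[of z] \<open>T z = 0\<close> by (simp add: T_def)
    qed
    moreover have "(snd P)^2 < (T (fst P))^2" using third[of "fst P"] neg[of "fst P"] x by (simp add: T_def oncurve_def)
    ultimately have "snd P < T (fst P)"
      using power_less_imp_less_base[of "snd P" 2 "T (fst P)"] by simp
    then have "tgap x0 P + 0 < 0" by (simp add: tgap_def T_def)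
    then show thesis
      using tgap_cross[of x0 P 0] \<open>e < x0\<close> that by (metis add.right_neutral less_imp_le order_refl)
  next
    case 2
    then have x: "x0 \<le> fst P" "snd P < 0" "oncurve P" by (auto simp: arcM_def)
    then have "fst P \<noteq> e" using fe by (auto simp: oncurve_def)
    then have "e < fst P" using x e_le by simp
    have "g (fst P) > 0" using f_pos[OF \<open>e < fst P\<close>] by (simp add: g_def)
    then have "tgap (fst P) P < 0" using x by (simp add: tgap_def)
    then obtain \<kappa> where \<kappa>: "fst P < \<kappa>" "tgap \<kappa> P = 0" "\<And>c. fst P \<le> c \<Longrightarrow> c < \<kappa> \<Longrightarrow> tgap c P < 0"
    proof -
      have "tgap (fst P) P + 0 < 0" using \<open>tgap (fst P) P < 0\<close> by simp
      from tgap_cross[OF \<open>e < fst P\<close> x(1) this] show thesis using that by (metis add.right_neutral)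
    qed
    have "tgap d P < 0" if d: "x0 < d" "d < fst P" for d
    proof (rule ccontr)
      assume "\<not> ?thesis"
      then have "\<exists>c\<ge>d. c \<le> fst P \<and> tgap c P = 0"
        using \<open>tgap (fst P) P < 0\<close> d e_le by (intro IVT2' cont_tgap) auto
      then obtain c where c: "d \<le> c" "c \<le> fst P" "tgap c P = 0" by blast
      then have "c \<noteq> fst P" using \<open>tgap (fst P) P < 0\<close> by auto
      then have ec: "e < c" "c < fst P" using c d e_le by auto
      note third = tangent_third[OF ec(1) x(3) c(3)]
      define T where "T x = g c + sl c * (x - c)" for x
      have "T c > 0" "T (fst P) < 0"
        using f_pos[OF ec(1)] c(3) x by (auto simp: T_def g_def tgap_def)
      then have "\<exists>z\<ge>c. z \<le> fst P \<and> T z = 0"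
        using ec by (intro IVT2') (auto simp: T_def intro!: continuous_intros)
      then obtain z where z: "c \<le> z" "z \<le> fst P" "T z = 0" by blast
      have "z < fst P" using z \<open>T (fst P) < 0\<close> by (cases "z = fst P") auto
      then have "(z - c)^2 * (z - fst P) \<le> 0" by (intro mult_nonneg_nonpos) auto
      moreover have "f z > 0" using z ec by (intro f_pos) simp
      ultimately show False using third[of z] z ec by (simp add: T_def)
    qed
    then show thesis
      using that[of \<kappa>] \<kappa> x by (metis le_less_trans not_less)
  qed
qed

lemma sl_inj:
  assumes "x0 < c" "x0 < d" "sl c = sl d"
  shows "c = d"
  using sl_less[of c d] sl_less[of d c] assms e_le by (cases c d rule: linorder_cases) auto

lemma oncurve_cases:
  assumes "oncurve P" "P \<notin> arcA" "P \<notin> arcM"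
  obtains "P \<in> arcP" | "fst P < e \<or> P = (e, 0) \<and> x0 = e"
proof (cases "fst P < e")
  case False
  show thesis
  proof (cases "snd P = 0")
    case True
    then have "fst P = e"
      using assms False f_pos[of "fst P"] by (cases "fst P = e") (auto simp: oncurve_def)
    moreover from this have "x0 = e" using assms e_le by (auto simp: arcA_def)
    ultimately show thesis using that(2) True by (simp add: prod_eq_iff)
  next
    case nz: False
    then have "P \<in> arcP" using assms False by (auto simp: arcA_def arcM_def arcP_def)
    then show thesis using that by blast
  qed
qed (use that in blast)

section \<open>Lowered tangents and the bound for one arc\<close>

lemma eventually_add_neg: "a < 0 \<Longrightarrow> \<forall>\<^sub>F \<epsilon> in at_right (0::real). a + \<epsilon> < 0"
  by (rule eventually_at_rightI[of 0 "- a"]) auto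

lemma eventually_ne_at_right: "\<forall>\<^sub>F \<epsilon> in at_right (0::real). \<epsilon> \<noteq> b"
  by (rule eventually_at_rightI[of 0 "if b > 0 then b else 1"]) (auto split: if_splits)

text \<open>At most one tangent beyond the flex has the given slope, so at most one value of
  \<epsilon> is bad.\<close>

lemma tgap_generic:
  assumes "x0 < c0"
  shows "\<forall>\<^sub>F \<epsilon> in at_right 0. \<forall>c\<ge>c0. sl c = \<sigma> \<longrightarrow> tgap c P + \<epsilon> \<noteq> 0"
proof (cases "\<exists>c\<ge>c0. sl c = \<sigma>")
  case True
  then obtain c1 where c1: "c1 \<ge> c0" "sl c1 = \<sigma>" by blast
  have "c = c1" if "c \<ge> c0" "sl c = \<sigma>" for c using sl_inj[of c c1] that c1 assms by simp
  then have uniq: "\<And>c. c \<ge> c0 \<Longrightarrow> sl c = \<sigma> \<Longrightarrow> c = c1" .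
  show ?thesis
    using eventually_ne_at_right[of "- tgap c1 P"]
  proof eventually_elim
    case (elim \<epsilon>)
    show ?case
    proof (intro allI impI)
      fix c assume "c \<ge> c0" "sl c = \<sigma>"
      then have "c = c1" by (rule uniq)
      then show "tgap c P + \<epsilon> \<noteq> 0" using elim by auto
    qed
  qed
qed auto

text \<open>The path consists of the tangents to the upper branch beyond the flex, lowered by
  \<epsilon>. All remaining points of the cubic lie on or above the tangents, hence strictly above
  the lowered lines. So contacts come only from points off the cubic, at most two each, and from
  slopes in \<open>I\<close>, at most one each. All but at most three points of \<open>C\<close> are
  followed by a contact before the next point of \<open>C\<close>.\<close>

theorem arc_card_le:
  assumes fin: "finite S" "finite I" and sm: "sides_meet_aff S I" and C: "C = arcA \<or> C = arcM"
  shows "card (S \<inter> C) \<le> 2 * (card {P\<in>S. \<not> oncurve P} + card I) + 3"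
proof -
  \<comment> \<open>The chain contains both arcs, although only \<open>C\<close> is counted: the
    tangents meet both, and crossing the other arc must not be a contact.\<close>
  define D where "D = S \<inter> (arcA \<union> arcM)"
  define M where "M = {P\<in>S. \<not> oncurve P}"
  have finD: "finite D" using fin by (simp add: D_def)
  have DS: "D \<subseteq> S" by (auto simp: D_def)
  have Darc: "P \<in> arcA \<union> arcM" and Don: "oncurve P" "e \<le> fst P" if "P \<in> D" for P
    using that e_le by (auto simp: D_def arcA_def arcM_def)
  have "\<forall>P\<in>D. \<exists>c. x0 < c \<and> tgap c P = 0 \<and> (\<forall>d. x0 < d \<longrightarrow> d < c \<longrightarrow> tgap d P < 0)"
    by (metis Darc ex_tangent_through)
  then obtain \<kappa>0 where \<kappa>0: "\<And>P. P \<in> D \<Longrightarrow> x0 < \<kappa>0 P" "\<And>P. P \<in> D \<Longrightarrow> tgap (\<kappa>0 P) P = 0"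
    "\<And>P d. P \<in> D \<Longrightarrow> x0 < d \<Longrightarrow> d < \<kappa>0 P \<Longrightarrow> tgap d P < 0"
    by metis
  obtain c0 where c0: "x0 < c0" "\<And>P. P \<in> D \<Longrightarrow> c0 < \<kappa>0 P"
  proof (cases "D = {}")
    case True
    then show thesis using that[of "x0 + 1"] by auto
  next
    case False
    then have "x0 < Min (\<kappa>0 ` D)" using finD \<kappa>0(1) by simp
    then obtain c where "x0 < c" "c < Min (\<kappa>0 ` D)" using dense by blast
    then show thesis using that[of c] finD False by simp
  qed
  have ec0: "e < c0" using c0 e_le by simp
  \<comment> \<open>The five requirements hold for all sufficiently small \<epsilon> > 0. The second
    makes the path start above \<open>D\<close>, the third preserves the order of the crossings. The
    last two exclude that a lowered tangent through a point of \<open>D\<close> has a slope in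
    \<open>I\<close> or contains a point of \<open>S - D\<close>.\<close>
  have "\<forall>\<^sub>F \<epsilon> in at_right 0. \<epsilon> > (0::real)" by (simp add: eventually_at_right_less)
  moreover have "\<forall>\<^sub>F \<epsilon> in at_right 0. \<forall>P\<in>D. tgap c0 P + \<epsilon> < 0"
    using finD \<kappa>0(3) c0 by (intro eventually_ball_finite ballI eventually_add_neg) auto
  moreover have "\<forall>\<^sub>F \<epsilon> in at_right 0. \<forall>P\<in>D. \<forall>Q\<in>{Q\<in>D. xi Q < xi P}. tgap (\<kappa>0 P) Q + \<epsilon> < 0"
    using finD tgap_order[OF Darc \<kappa>0(1) \<kappa>0(2)] Don
    by (intro eventually_ball_finite ballI eventually_add_neg) auto
  moreover have "\<forall>\<^sub>F \<epsilon> in at_right 0. \<forall>P\<in>D. \<forall>\<mu>\<in>I. \<forall>c\<ge>c0. sl c = \<mu> \<longrightarrow> tgap c P + \<epsilon> \<noteq> 0"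
    using finD fin by (intro eventually_ball_finite ballI tgap_generic c0) auto
  moreover have "\<forall>\<^sub>F \<epsilon> in at_right 0. \<forall>P\<in>D. \<forall>r\<in>S - D. \<forall>c\<ge>c0. sl c = (snd P - snd r) / (fst P - fst r) \<longrightarrow> tgap c P + \<epsilon> \<noteq> 0"
    using finD fin by (intro eventually_ball_finite ballI tgap_generic c0) auto
  ultimately have "\<forall>\<^sub>F \<epsilon> in at_right (0::real). \<epsilon> > 0 \<and> (\<forall>P\<in>D. tgap c0 P + \<epsilon> < 0) \<and>
      (\<forall>P\<in>D. \<forall>Q\<in>{Q\<in>D. xi Q < xi P}. tgap (\<kappa>0 P) Q + \<epsilon> < 0) \<and>
      (\<forall>P\<in>D. \<forall>\<mu>\<in>I. \<forall>c\<ge>c0. sl c = \<mu> \<longrightarrow> tgap c P + \<epsilon> \<noteq> 0) \<and>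
      (\<forall>P\<in>D. \<forall>r\<in>S - D. \<forall>c\<ge>c0. sl c = (snd P - snd r) / (fst P - fst r) \<longrightarrow> tgap c P + \<epsilon> \<noteq> 0)"
    by (intro eventually_conj)
  then obtain \<epsilon> where E: "\<epsilon> > (0::real) \<and> (\<forall>P\<in>D. tgap c0 P + \<epsilon> < 0) \<and>
      (\<forall>P\<in>D. \<forall>Q\<in>{Q\<in>D. xi Q < xi P}. tgap (\<kappa>0 P) Q + \<epsilon> < 0) \<and>
      (\<forall>P\<in>D. \<forall>\<mu>\<in>I. \<forall>c\<ge>c0. sl c = \<mu> \<longrightarrow> tgap c P + \<epsilon> \<noteq> 0) \<and>
      (\<forall>P\<in>D. \<forall>r\<in>S - D. \<forall>c\<ge>c0. sl c = (snd P - snd r) / (fst P - fst r) \<longrightarrow> tgap c P + \<epsilon> \<noteq> 0)"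
    using eventually_happens'[OF trivial_limit_at_right_real] by blast
  have \<epsilon>: "\<epsilon> > (0::real)" "\<And>P. P \<in> D \<Longrightarrow> tgap c0 P + \<epsilon> < 0"
      "\<And>P Q. P \<in> D \<Longrightarrow> Q \<in> D \<Longrightarrow> xi Q < xi P \<Longrightarrow> tgap (\<kappa>0 P) Q + \<epsilon> < 0"
      "\<And>P \<mu> c. P \<in> D \<Longrightarrow> \<mu> \<in> I \<Longrightarrow> c \<ge> c0 \<Longrightarrow> sl c = \<mu> \<Longrightarrow> tgap c P + \<epsilon> \<noteq> 0"
      "\<And>P r c. P \<in> D \<Longrightarrow> r \<in> S - D \<Longrightarrow> c \<ge> c0 \<Longrightarrow> sl c = (snd P - snd r) / (fst P - fst r) \<Longrightarrow> tgap c P + \<epsilon> \<noteq> 0"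
    using E by blast+
  have "\<forall>P\<in>D. \<exists>\<kappa>. c0 < \<kappa> \<and> tgap \<kappa> P + \<epsilon> = 0 \<and> (\<forall>c. c0 \<le> c \<longrightarrow> c < \<kappa> \<longrightarrow> tgap c P + \<epsilon> < 0) \<and>
      (\<forall>c. \<kappa> < c \<longrightarrow> tgap c P + \<epsilon> > 0)"
  proof
    fix P assume "P \<in> D"
    show "\<exists>\<kappa>. c0 < \<kappa> \<and> tgap \<kappa> P + \<epsilon> = 0 \<and> (\<forall>c. c0 \<le> c \<longrightarrow> c < \<kappa> \<longrightarrow> tgap c P + \<epsilon> < 0) \<and>
        (\<forall>c. \<kappa> < c \<longrightarrow> tgap c P + \<epsilon> > 0)"
      by (rule tgap_cross[OF ec0 less_imp_le[OF c0(1)] \<epsilon>(2)[OF \<open>P \<in> D\<close>]]) blast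
  qed
  then obtain \<kappa> where \<kappa>: "\<And>P. P \<in> D \<Longrightarrow> c0 < \<kappa> P" "\<And>P. P \<in> D \<Longrightarrow> tgap (\<kappa> P) P + \<epsilon> = 0"
    "\<And>P c. P \<in> D \<Longrightarrow> c0 \<le> c \<Longrightarrow> c < \<kappa> P \<Longrightarrow> tgap c P + \<epsilon> < 0"
    "\<And>P c. P \<in> D \<Longrightarrow> \<kappa> P < c \<Longrightarrow> tgap c P + \<epsilon> > 0"
    by metis
  have ord: "\<kappa> P < \<kappa> Q" if "P \<in> D" "Q \<in> D" "xi Q < xi P" for P Q
  proof -
    \<comment> \<open>At the parameter of the tangent through \<open>P\<close> the lowered line has
      already crossed \<open>P\<close>, but not yet \<open>Q\<close>.\<close>
    have "\<kappa>0 P < \<kappa> Q"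
      using \<epsilon>(3)[OF that] \<kappa>(2)[OF that(2)] \<kappa>(4)[OF that(2), of "\<kappa>0 P"]
      by (cases "\<kappa> Q" "\<kappa>0 P" rule: linorder_cases) auto
    moreover have "\<not> tgap (\<kappa>0 P) P + \<epsilon> \<le> 0" using \<kappa>0(2)[OF that(1)] \<epsilon>(1) by simp
    then have "\<kappa> P < \<kappa>0 P"
      using \<kappa>(2)[OF that(1)] \<kappa>(3)[OF that(1), of "\<kappa>0 P"] c0(2)[OF that(1)]
      by (cases "\<kappa> P" "\<kappa>0 P" rule: linorder_cases) auto
    ultimately show ?thesis by simp
  qed
  have eqxi: "P = Q" if "P \<in> D" "Q \<in> D" "xi P = xi Q" for P Q
    using xi_inj Don that by blast
  have ord': "xi Q < xi P" if "P \<in> D" "Q \<in> D" "\<kappa> P < \<kappa> Q" for P Q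
    using ord[of Q P] eqxi[of P Q] that by (cases "xi P" "xi Q" rule: linorder_cases) auto
  have inj: "inj_on \<kappa> D"
    by (rule inj_onI) (metis eqxi less_irrefl linorder_neqE_linordered_idom ord)
  define t where "t c = g c - c * sl c - \<epsilon>" for c
  have gap: "gap (sl c) (t c) P = tgap c P + \<epsilon>" for c P
    by (simp add: gap_def t_def tgap_def algebra_simps)
  have ch: "chain S I {c0..} sl t D \<kappa> 1"
    unfolding chain_def gap
  proof (intro conjI)
    show "continuous_on {c0..} sl" "continuous_on {c0..} t"
      unfolding t_def using ec0 by (intro continuous_intros cont_sl cont_g; auto)+
    show "\<kappa> ` D \<subseteq> {c0..}" using \<kappa>(1) by (auto simp: less_imp_le)
  qed (use sm DS inj \<kappa> in \<open>auto simp: is_interval_1\<close>)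
  define Z where "Z = contacts (S - D) I {c0..} sl t"
  have Zsub: "Z \<subseteq> (\<Union>r\<in>M. {c\<in>{c0..}. tgap c r + \<epsilon> = 0}) \<union> {c\<in>{c0..}. sl c \<in> I}"
  proof
    fix c assume "c \<in> Z"
    then have c: "c0 \<le> c" "sl c \<in> I \<or> (\<exists>r\<in>S - D. tgap c r + \<epsilon> = 0)" by (auto simp: Z_def contacts_def gap)
    moreover have "r \<in> M" if "r \<in> S - D" "tgap c r + \<epsilon> = 0" for r
    proof (rule ccontr)
      assume "r \<notin> M"
      then have r: "oncurve r" "r \<notin> arcA" "r \<notin> arcM" using that by (auto simp: M_def D_def)
      have xc: "x0 < c" using c c0(1) by simp
      from r consider "r \<in> arcP" | "fst r < e \<or> r = (e, 0) \<and> x0 = e" by (rule oncurve_cases)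
      then have "tgap c r \<ge> 0"
      proof cases
        case 1
        then show ?thesis by (rule tgap_arcP[OF xc])
      next
        case 2
        then show ?thesis by (rule less_imp_le[OF tgap_off_curve[OF xc r(1)]])
      qed
      then show False using that \<epsilon>(1) by simp
    qed
    ultimately show "c \<in> (\<Union>r\<in>M. {c\<in>{c0..}. tgap c r + \<epsilon> = 0}) \<union> {c\<in>{c0..}. sl c \<in> I}" by auto
  qed
  have finM: "finite M" using fin by (simp add: M_def)
  have U: "finite (\<Union>r\<in>M. {c\<in>{c0..}. tgap c r + \<epsilon> = 0})" "card (\<Union>r\<in>M. {c\<in>{c0..}. tgap c r + \<epsilon> = 0}) \<le> card M * 2"
  proof -
    have two: "finite {c\<in>{c0..}. tgap c r + \<epsilon> = 0}" "card {c\<in>{c0..}. tgap c r + \<epsilon> = 0} \<le> 2" for r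
      using tgap_contacts[OF ec0, of r \<epsilon>] c0 by auto
    show "finite (\<Union>r\<in>M. {c\<in>{c0..}. tgap c r + \<epsilon> = 0})" using finM two by blast
    have "card (\<Union>r\<in>M. {c\<in>{c0..}. tgap c r + \<epsilon> = 0}) \<le> (\<Sum>r\<in>M. card {c\<in>{c0..}. tgap c r + \<epsilon> = 0})"
      by (rule card_UN_le[OF finM])
    also have "\<dots> \<le> (\<Sum>r\<in>M. 2)" using two by (intro sum_mono)
    finally show "card (\<Union>r\<in>M. {c\<in>{c0..}. tgap c r + \<epsilon> = 0}) \<le> card M * 2" by simp
  qed
  have V: "finite {c\<in>{c0..}. sl c \<in> I}" "card {c\<in>{c0..}. sl c \<in> I} \<le> card I"
  proof -
    have "inj_on sl {c\<in>{c0..}. sl c \<in> I}" by (rule inj_onI) (use sl_inj c0 in auto)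
    moreover have "sl ` {c\<in>{c0..}. sl c \<in> I} \<subseteq> I" by auto
    ultimately show "finite {c\<in>{c0..}. sl c \<in> I}" "card {c\<in>{c0..}. sl c \<in> I} \<le> card I"
      using fin(2) by (auto intro: inj_on_finite card_inj_on_le)
  qed
  have finZ: "finite Z" using Zsub U V finite_subset by blast
  have "card Z \<le> card M * 2 + card I"
    using card_mono[OF _ Zsub] card_Un_le[of "\<Union>r\<in>M. {c\<in>{c0..}. tgap c r + \<epsilon> = 0}" "{c\<in>{c0..}. sl c \<in> I}"] U V
    by auto
  have gen: "\<forall>P\<in>D. \<kappa> P \<notin> Z"
  proof (intro ballI notI)
    fix P assume P: "P \<in> D" and "\<kappa> P \<in> Z"
    then consider "sl (\<kappa> P) \<in> I" | r where "r \<in> S - D" "tgap (\<kappa> P) r + \<epsilon> = 0"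
      by (auto simp: Z_def contacts_def gap)
    then show False
    proof cases
      case 1
      then show False using \<epsilon>(4)[OF P 1] \<kappa>(1,2)[OF P] by simp
    next
      case 2
      have eq: "snd P - snd r = sl (\<kappa> P) * (fst P - fst r)"
        using 2(2) \<kappa>(2)[OF P] by (simp add: tgap_def algebra_simps)
      have "P \<noteq> r" using 2 P by auto
      then have "fst P \<noteq> fst r" using eq by (auto simp: prod_eq_iff)
      then show False using \<epsilon>(5)[OF P 2(1), of "\<kappa> P"] \<kappa>(1,2)[OF P] eq by (simp add: less_imp_le)
    qed
  qed
  define X where "X = \<kappa> ` (S \<inter> C)"
  have CD: "S \<inter> C \<subseteq> D" "C \<in> arcs" using C by (auto simp: D_def arcs_def)
  have "card X = card (S \<inter> C)"
    unfolding X_def using inj CD by (intro card_image) (auto intro: inj_on_subset)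
  obtain G where G: "G \<subseteq> X" "card X \<le> card G + 3"
    "\<And>a. a \<in> G \<Longrightarrow> \<exists>w\<in>X. \<exists>b\<in>X. \<exists>c\<in>X. w < a \<and> a < b \<and> b < c \<and> (\<forall>x\<in>X. a < x \<longrightarrow> b \<le> x)"
    using inner_subset[of X] fin by (auto simp: X_def)
  have "card G \<le> card Z"
  proof (rule card_le_if_separated)
    show "finite G" using G(1) fin by (auto simp: X_def intro: finite_subset)
    show "finite Z" by fact
    fix a assume a: "a \<in> G"
    then obtain w b c where wbc: "w \<in> X" "b \<in> X" "c \<in> X" "w < a" "a < b" "b < c" "\<And>x. x \<in> X \<Longrightarrow> a < x \<Longrightarrow> b \<le> x"
      using G(3) by metis
    have "a \<in> X" using a G(1) by blast
    obtain P0 where P0: "P0 \<in> S \<inter> C" "w = \<kappa> P0" using wbc(1) unfolding X_def by blast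
    obtain P1 where P1: "P1 \<in> S \<inter> C" "a = \<kappa> P1" using \<open>a \<in> X\<close> unfolding X_def by blast
    obtain P2 where P2: "P2 \<in> S \<inter> C" "b = \<kappa> P2" using wbc(2) unfolding X_def by blast
    obtain P3 where P3: "P3 \<in> S \<inter> C" "c = \<kappa> P3" using wbc(3) unfolding X_def by blast
    note P = P0(1) P1(1) P2(1) P3(1) and \<kappa>P = P0(2) P1(2) P2(2) P3(2)
    have PD: "P0 \<in> D" "P1 \<in> D" "P2 \<in> D" "P3 \<in> D" using P CD by auto
    have \<kappa>s: "\<kappa> P0 < \<kappa> P1" "\<kappa> P1 < \<kappa> P2" "\<kappa> P2 < \<kappa> P3" using wbc(4-6) \<kappa>P by simp_all
    have xis: "xi P3 < xi P2" "xi P2 < xi P1" "xi P1 < xi P0"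
      using ord'[OF PD(3,4) \<kappa>s(3)] ord'[OF PD(2,3) \<kappa>s(2)] ord'[OF PD(1,2) \<kappa>s(1)] .
    have adj: "\<forall>Q\<in>D. \<not> (\<kappa> P1 < \<kappa> Q \<and> \<kappa> Q < \<kappa> P2)"
    proof (intro ballI notI)
      fix Q assume Q: "Q \<in> D" "\<kappa> P1 < \<kappa> Q \<and> \<kappa> Q < \<kappa> P2"
      then have "xi P2 < xi Q" "xi Q < xi P1" using ord' PD by blast+
      then have "Q \<in> C" using xi_between[OF CD(2), of P2 P1 Q] P Don[OF Q(1)] by blast
      then have "\<kappa> Q \<in> X" using Q DS by (auto simp: X_def)
      then show False using wbc(7)[of "\<kappa> Q"] Q \<kappa>P by simp
    qed
    have "turn P2 P1 P3 * turn P2 P1 P0 > 0"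
      using turn_same_arc[OF CD(2)] P xis by blast
    then have "turn P1 P2 P0 * turn P1 P2 P3 > 0"
      by (simp add: turn_swap[of P1 P2] mult.commute)
    then obtain z where "z \<in> Z" "\<kappa> P1 < z" "z < \<kappa> P2"
      using chain_contact_between[OF ch PD(2,3) \<kappa>s(2) adj gen[unfolded Z_def] PD(1,4) \<kappa>s(1,3)]
      unfolding Z_def by blast
    then show "\<exists>z\<in>Z. a < z \<and> (\<forall>b\<in>G. a < b \<longrightarrow> z < b)"
      using wbc(7) G(1) \<kappa>P by (intro bexI[of _ z]) (auto intro: less_le_trans)
  qed
  then show ?thesis
    unfolding M_def[symmetric] using \<open>card X = card (S \<inter> C)\<close> G(2) \<open>card Z \<le> card M * 2 + card I\<close>
    by (simp add: algebra_simps)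
qed

end

lemma sides_meet_aff_mirror:
  fixes mir :: "real \<times> real \<Rightarrow> real \<times> real"
  assumes "sides_meet_aff S I" and mir: "mir = (\<lambda>P. (fst P, - snd P))"
  shows "sides_meet_aff (mir ` S) (uminus ` I)"
  unfolding sides_meet_aff_def
proof (intro allI impI)
  fix s t :: "real \<Rightarrow> real" and a b p1 p2
  assume A: "a < b" "continuous_on {a..b} s" "continuous_on {a..b} t" "p1 \<in> mir ` S" "p2 \<in> mir ` S" "p1 \<noteq> p2"
    "\<forall>p\<in>mir ` S. (gap (s a) (t a) p = 0) = (p = p1)" "s a \<notin> uminus ` I"
    "\<forall>p\<in>mir ` S. (gap (s b) (t b) p = 0) = (p = p2)" "s b \<notin> uminus ` I"
    "\<forall>\<tau>\<in>{a<..<b}. s \<tau> \<notin> uminus ` I \<and> (\<forall>p\<in>mir ` S. gap (s \<tau>) (t \<tau>) p \<noteq> 0)"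
  have mm: "mir (mir P) = P" for P by (simp add: mir)
  have g: "gap (- u) (- v) P = - gap u v (mir P)" for u v P by (simp add: gap_def mir)
  have u: "- x \<in> I \<longleftrightarrow> x \<in> uminus ` I" for x by (metis (no_types, lifting) imageE imageI minus_minus)
  have S: "mir p1 \<in> S" "mir p2 \<in> S" "mir p1 \<noteq> mir p2" using A(4-6) mm by auto
  have e1: "\<forall>p\<in>S. (gap (- s a) (- t a) p = 0) = (p = mir p1)"
    using A(7) mm unfolding g by (metis imageI neg_equal_0_iff_equal)
  have e2: "\<forall>p\<in>S. (gap (- s b) (- t b) p = 0) = (p = mir p2)"
    using A(9) mm unfolding g by (metis imageI neg_equal_0_iff_equal)
  have e3: "\<forall>\<tau>\<in>{a<..<b}. - s \<tau> \<notin> I \<and> (\<forall>p\<in>S. gap (- s \<tau>) (- t \<tau>) p \<noteq> 0)"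
    using A(11) unfolding g u by simp
  have e4: "- s a \<notin> I" "- s b \<notin> I" using A(8,10) unfolding u by auto
  have c: "continuous_on {a..b} (\<lambda>x. - s x)" "continuous_on {a..b} (\<lambda>x. - t x)" using A by (auto intro: continuous_intros)
  obtain \<sigma> where \<sigma>: "\<sigma> \<in> {1, -1::real}" "\<forall>p\<in>S. 0 \<le> \<sigma> * gap (- s a) (- t a) p * turn (mir p1) (mir p2) p"
    using assms(1)[unfolded sides_meet_aff_def, rule_format, OF A(1) c S, OF _ e4(1) _ e4(2)] e1 e2 e3 by blast
  have "turn (mir p1) (mir p2) p = - turn p1 p2 (mir p)" for p by (simp add: turn_def mir algebra_simps)
  then have "\<forall>p\<in>mir ` S. 0 \<le> \<sigma> * gap (s a) (t a) p * turn p1 p2 p"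
    using \<sigma>(2) mm unfolding g by auto
  then show "\<exists>\<sigma>\<in>{1, - 1}. \<forall>p\<in>mir ` S. 0 \<le> \<sigma> * gap (s a) (t a) p * turn p1 p2 p"
    using \<sigma>(1) by blast
qed

context wcubic
begin

text \<open>The tangents to the upper branch never cross \<open>arcP\<close>. Reflection turns
  \<open>arcP\<close> into \<open>arcM\<close> and preserves all the numbers involved.\<close>

theorem arc_card_le_all:
  assumes fin: "finite S" "finite I" and sm: "sides_meet_aff S I" and C: "C \<in> arcs"
  shows "card (S \<inter> C) \<le> 2 * (card {P\<in>S. \<not> oncurve P} + card I) + 3"
proof (cases "C = arcP")
  case False
  then show ?thesis using arc_card_le[OF fin sm] C by (auto simp: arcs_def)
next
  case True
  have inj: "inj_on mirror X" for X by (rule inj_onI) (metis mirror_simps(3))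
  have m: "mirror = (\<lambda>P. (fst P, - snd P))" by (simp add: mirror_def fun_eq_iff)
  have "card (mirror ` S \<inter> arcM) \<le> 2 * (card {P\<in>mirror ` S. \<not> oncurve P} + card (uminus ` I)) + 3"
    using arc_card_le[OF _ _ sides_meet_aff_mirror[OF sm m]] fin by simp
  moreover have "mirror ` S \<inter> arcM = mirror ` (S \<inter> arcP)"
    using mirror_arcs by auto
  moreover have "{P\<in>mirror ` S. \<not> oncurve P} = mirror ` {P\<in>S. \<not> oncurve P}" by auto
  ultimately show ?thesis using True by (simp add: card_image inj)
qed

section \<open>Chords and collinear points of the cubic\<close>

lemma chord_identity:
  assumes "oncurve P" "oncurve Q" "fst P \<noteq> fst Q" "s = (snd Q - snd P) / (fst Q - fst P)"
  shows "f x - (snd P + s * (x - fst P))^2 = (x - fst P) * (x - fst Q) * (x - (s^2 - fst P - fst Q))"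
proof -
  define a b t where "a = fst P" and "b = fst Q" and "t = snd P - s * fst P"
  have ab: "a \<noteq> b" using assms by (simp add: a_def b_def)
  have "s * (b - a) = snd Q - snd P" using assms ab by (simp add: a_def b_def)
  then have y: "snd P = s * a + t" "snd Q = s * b + t" by (simp_all add: t_def a_def b_def algebra_simps)
  have va: "(s * a + t)^2 = a^3 + p * a + q" and vb: "(s * b + t)^2 = b^3 + p * b + q"
    using assms(1,2) unfolding oncurve_def f_def y a_def[symmetric] b_def[symmetric] .
  have "(b - a) * (a^2 + a * b + b^2 - s^2 * (a + b) + (p - 2 * s * t)) = 0"
    using va vb unfolding power2_eq_square power3_eq_cube by algebra
  then have c1: "p = s^2 * (a + b) - (a^2 + a * b + b^2) + 2 * s * t" using ab by simp
  have c0: "q = (s * a + t)^2 - a^3 - p * a" using va by simp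
  have "snd P + s * (x - fst P) = s * x + t" by (simp add: t_def algebra_simps)
  then show ?thesis
    unfolding f_def c0 c1 a_def[symmetric] b_def[symmetric]
    by (simp add: power2_eq_square power3_eq_cube algebra_simps)
qed

lemma vertical_oncurve:
  assumes "oncurve P" "oncurve Q" "oncurve R" "fst P = fst Q" "fst R = fst Q" "P \<noteq> Q" "R \<noteq> P" "R \<noteq> Q"
  shows False
proof -
  have "\<bar>snd P\<bar> = g (fst Q)" "\<bar>snd Q\<bar> = g (fst Q)" "\<bar>snd R\<bar> = g (fst Q)"
    using assms oncurve_abs by metis+
  then show False using assms by (auto simp: prod_eq_iff)
qed

lemma turn_zero_third:
  assumes "oncurve P" "oncurve Q" "oncurve R" "P \<noteq> Q" "R \<noteq> P" "R \<noteq> Q" "turn P Q R = 0"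
    and "s = (snd Q - snd P) / (fst Q - fst P)"
  shows "fst P \<noteq> fst Q" "snd R = snd P + s * (fst R - fst P)" "fst R = s^2 - fst P - fst Q"
proof -
  show ne: "fst P \<noteq> fst Q"
  proof
    assume eq: "fst P = fst Q"
    then have "snd P \<noteq> snd Q" using assms(4) by (simp add: prod_eq_iff)
    then have "fst R = fst Q" using assms(7) eq by (simp add: turn_def)
    then show False using vertical_oncurve eq assms by blast
  qed
  show yR: "snd R = snd P + s * (fst R - fst P)"
  proof -
    have "s * (fst Q - fst P) = snd Q - snd P" using assms(8) ne by simp
    then have "(fst Q - fst P) * (s * (fst R - fst P) - (snd R - snd P)) = 0"
      using assms(7) unfolding turn_def by algebra
    then show ?thesis using ne by simp
  qed
  have yQ: "snd Q = snd P + s * (fst Q - fst P)" using assms(8) ne by simp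
  have "fst R \<noteq> fst P" "fst R \<noteq> fst Q"
    using yR yQ assms(5,6) by (auto simp: prod_eq_iff)
  moreover have "(fst R - fst P) * (fst R - fst Q) * (fst R - (s^2 - fst P - fst Q)) = 0"
    using chord_identity[OF assms(1,2) ne assms(8), of "fst R"] yR assms(3) by (simp add: oncurve_def)
  ultimately show "fst R = s^2 - fst P - fst Q" by simp
qed

lemma no_four_collinear:
  assumes "oncurve P" "oncurve Q" "oncurve R" "oncurve R'" "P \<noteq> Q" "R \<noteq> P" "R \<noteq> Q" "R' \<noteq> P" "R' \<noteq> Q"
    and "turn P Q R = 0" "turn P Q R' = 0"
  shows "R = R'"
  using turn_zero_third[OF assms(1,2,3,5,6,7,10) refl] turn_zero_third[OF assms(1,2,4,5,8,9,11) refl]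
  by (simp add: prod_eq_iff)

text \<open>If a line met the cubic in three points left of \<open>e\<close>, then f minus the
  square of its height would be a product of three positive factors at \<open>e\<close>, but there
  it is minus a square.\<close>

lemma no_three_left:
  assumes "oncurve P" "oncurve Q" "oncurve R" "P \<noteq> Q" "R \<noteq> P" "R \<noteq> Q" "fst P < e" "fst Q < e" "fst R < e"
  shows "turn P Q R \<noteq> 0"
proof
  assume z: "turn P Q R = 0"
  note t = turn_zero_third[OF assms(1-6) z refl]
  define s where "s = (snd Q - snd P) / (fst Q - fst P)"
  have "f e - (snd P + s * (e - fst P))^2 = (e - fst P) * (e - fst Q) * (e - fst R)"
    using chord_identity[OF assms(1,2) t(1) s_def, of e] t(3) by (simp add: s_def)
  moreover have "(e - fst P) * (e - fst Q) * (e - fst R) > 0" using assms by simp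
  moreover have "(snd P + s * (e - fst P))^2 \<ge> 0" by simp
  ultimately show False using fe by linarith
qed

lemma f'_e_nonneg: "f' e \<ge> 0"
proof (rule ccontr)
  assume "\<not> ?thesis"
  then obtain d where d: "d > 0" "\<And>h. h > 0 \<Longrightarrow> h < d \<Longrightarrow> f (e + h) < f e"
    using DERIV_neg_dec_right[OF DERIV_f[of e]] by force
  then have "f (e + d / 2) < 0" using fe by (metis half_gt_zero field_sum_of_halves less_add_same_cancel1)
  then show False using f_pos[of "e + d / 2"] d(1) by simp
qed

text \<open>The third intersection \<open>r\<close> of the line with the cubic satisfies r \<le> e,
  because \<open>chord_identity\<close> at \<open>e\<close> has a nonpositive left-hand side. Beyond
  \<open>P\<close> all three factors are then positive. If \<open>P\<close> itself has abscissa
  \<open>e\<close>, the identity is void there, and its derivative at \<open>e\<close> takes over,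
  with \<open>f'_e_nonneg\<close>.\<close>

lemma chord_below:
  assumes "oncurve o'" "fst o' < e" "oncurve P" "e \<le> fst P" "fst P < x"
    and s: "s = (snd P - snd o') / (fst P - fst o')"
  shows "(snd o' + s * (x - fst o'))^2 < f x"
proof -
  define r where "r = s^2 - fst o' - fst P"
  have ne: "fst o' \<noteq> fst P" using assms by auto
  have id: "f x - (snd o' + s * (x - fst o'))^2 = (x - fst o') * (x - fst P) * (x - r)" for x
    using chord_identity[OF assms(1,3) ne s, of x] by (simp add: r_def)
  have "r \<le> e"
  proof (cases "fst P = e")
    case False
    then have lt: "(e - fst o') * (e - fst P) < 0" using assms by (intro mult_pos_neg) auto
    have "(e - fst o') * (e - fst P) * (e - r) \<le> 0" using id[of e] fe by (metis diff_0 neg_le_0_iff_le zero_le_power2)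
    then show ?thesis using lt by (simp add: mult_le_0_iff)
  next
    case True
    then have "snd P = 0" using assms(3) fe by (simp add: oncurve_def)
    then have line: "snd o' + s * (x - fst o') = s * (x - e)" for x
      using s ne True by (simp add: field_simps)
    have "((\<lambda>x. f x - (s * (x - e))^2) has_real_derivative f' e) (at e)"
      by (auto intro!: derivative_eq_intros DERIV_f)
    moreover have "((\<lambda>x. (x - fst o') * (x - e) * (x - r)) has_real_derivative (e - fst o') * (e - r)) (at e)"
      by (auto intro!: derivative_eq_intros)
    moreover have "(\<lambda>x. f x - (s * (x - e))^2) = (\<lambda>x. (x - fst o') * (x - e) * (x - r))"
      using id True by (simp add: line fun_eq_iff)
    ultimately have "f' e = (e - fst o') * (e - r)" using DERIV_unique by metis
    then show ?thesis using f'_e_nonneg assms(2) by (simp add: zero_le_mult_iff)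
  qed
  then have "(x - fst o') * (x - fst P) * (x - r) > 0" using assms by (intro mult_pos_pos) auto
  then show ?thesis using id[of x] by linarith
qed

text \<open>A line turning about a point left of \<open>e\<close> meets the points with x \<ge> e in
  the order \<open>xi\<close>. This lets both families of supporting lines of the left part form
  chains with that order.\<close>

lemma slope_mono:
  assumes o': "oncurve o'" "fst o' < e" and P: "oncurve P" "e \<le> fst P" and Q: "oncurve Q" "e \<le> fst Q"
    and xi: "xi P < xi Q"
  shows "(snd P - snd o') / (fst P - fst o') < (snd Q - snd o') / (fst Q - fst o')"
proof -
  define sP sQ where "sP = (snd P - snd o') / (fst P - fst o')" and "sQ = (snd Q - snd o') / (fst Q - fst o')"
  have pos: "fst P - fst o' > 0" "fst Q - fst o' > 0" using assms by auto
  have yP: "snd P = snd o' + sP * (fst P - fst o')" and yQ: "snd Q = snd o' + sQ * (fst Q - fst o')"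
    using pos by (simp_all add: sP_def sQ_def)
  have zero: "fst R = e" if "oncurve R" "e \<le> fst R" "snd R = 0" for R
    using that f_pos[of "fst R"] by (cases "fst R = e") (auto simp: oncurve_def)
  have sq: "a < b" if "a^2 < b^2" "b > 0" for a b :: real using that power_less_imp_less_base[of a 2 b] by simp
  have sq': "b < a" if "a^2 < b^2" "b < 0" for a b :: real using sq[of "- a" "- b"] that by simp
  have up: ?thesis if "snd Q > 0" "fst P < fst Q"
  proof -
    have "(snd o' + sP * (fst Q - fst o'))^2 < (snd Q)^2"
      using chord_below[OF o' P that(2) sP_def] Q by (simp add: oncurve_def)
    then have "snd o' + sP * (fst Q - fst o') < snd Q" using sq that by blast
    then show ?thesis unfolding sP_def[symmetric] sQ_def[symmetric] using yQ pos by simp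
  qed
  have down: ?thesis if "snd P < 0" "fst Q < fst P"
  proof -
    have "(snd o' + sQ * (fst P - fst o'))^2 < (snd P)^2"
      using chord_below[OF o' Q that(2) sQ_def] P by (simp add: oncurve_def)
    then have "snd P < snd o' + sQ * (fst P - fst o')" using sq' that by blast
    then show ?thesis unfolding sP_def[symmetric] sQ_def[symmetric] using yP pos by simp
  qed
  show ?thesis
  proof (cases "snd Q > 0")
    case True
    then have xQ: "xi Q = fst Q - e" by (simp add: xi_def)
    consider "fst P < fst Q" | "fst P = fst Q" | "fst Q < fst P" by linarith
    then show ?thesis
    proof cases
      case 1
      then show ?thesis using up True by blast
    next
      case 2
      then have "\<bar>snd P\<bar> = \<bar>snd Q\<bar>" using P Q oncurve_abs by metis
      moreover have "P \<noteq> Q" using xi by auto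
      ultimately have "snd P < snd Q" using True 2 by (auto simp: prod_eq_iff)
      then show ?thesis using 2 pos by (simp add: divide_strict_right_mono)
    next
      case 3
      have "snd P < 0"
      proof (rule ccontr)
        assume "\<not> snd P < 0"
        moreover have "snd P \<noteq> 0" using zero[OF P] 3 Q by auto
        ultimately have "xi P = fst P - e" by (simp add: xi_def)
        then show False using xi xQ 3 by simp
      qed
      then show ?thesis using down 3 by blast
    qed
  next
    case False
    then have "xi Q = e - fst Q"
      using zero[OF Q] by (cases "snd Q = 0") (auto simp: xi_def sgn_if)
    moreover from this have "xi P < 0" using xi Q by simp
    then have "snd P < 0" using P by (auto simp: xi_def mult_less_0_iff)
    ultimately have "fst Q < fst P" using xi by (simp add: xi_def)
    then show ?thesis using down \<open>snd P < 0\<close> by blast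
  qed
qed

end

section \<open>Supporting lines of the left part\<close>

lemma card_le_two:
  fixes X :: "real set"
  assumes "\<And>a b c. a \<in> X \<Longrightarrow> b \<in> X \<Longrightarrow> c \<in> X \<Longrightarrow> a < b \<Longrightarrow> b < c \<Longrightarrow> False"
  shows "finite X \<and> card X \<le> 2"
proof (rule ccontr)
  assume no: "\<not> ?thesis"
  obtain Y where Y: "Y \<subseteq> X" "finite Y" "card Y = 3"
  proof (cases "finite X")
    case True
    then have "3 \<le> card X" using no by simp
    then show thesis using that obtain_subset_with_card_n by metis
  next
    case False
    then show thesis using that infinite_arbitrarily_large by metis
  qed
  have "Y \<noteq> {}" using Y by auto
  have "card {Min Y, Max Y} \<le> 2" by (simp add: card_insert_if)
  then have "\<not> Y \<subseteq> {Min Y, Max Y}" using Y(3) card_mono[of "{Min Y, Max Y}" Y] by fastforce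
  then obtain b where b: "b \<in> Y" "b \<noteq> Min Y" "b \<noteq> Max Y" by blast
  have "Min Y < b" "b < Max Y"
    using b Y Min_le[of Y b] Max_ge[of Y b] by (auto simp: less_le)
  then show False using assms[of "Min Y" b "Max Y"] b Y \<open>Y \<noteq> {}\<close> by (meson Max_in Min_in subsetD)
qed

text \<open>The parameters \<open>t\<close> of the lines \<open>y = s x + t\<close> of slope \<open>s\<close> that support a finite set \<open>K\<close> of points from
  above and from below, moved away from \<open>K\<close> by \<open>\<epsilon>\<close>.\<close>

definition upper_env :: "(real \<times> real) set \<Rightarrow> real \<Rightarrow> real \<Rightarrow> real" where
  "upper_env K \<epsilon> s = Max ((\<lambda>P. snd P - s * fst P) ` K) + \<epsilon>"

definition lower_env :: "(real \<times> real) set \<Rightarrow> real \<Rightarrow> real \<Rightarrow> real" where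
  "lower_env K \<epsilon> s = Min ((\<lambda>P. snd P - s * fst P) ` K) - \<epsilon>"

text \<open>For fixed \<open>P\<close>, \<open>L P\<close> is affine in the slope; a contact from
  above means that the maximum of these functions is -\<epsilon>, one from below that their minimum
  is \<epsilon>. If \<open>K\<close> lies strictly on one side of the vertical through
  \<open>r\<close>, all functions are strictly monotone in the same sense and each envelope gives
  one contact. Otherwise only one envelope has contacts, at most two by convexity; a flat piece at
  this level is excluded by the choice of \<epsilon>.\<close>

lemma envelope_contacts:
  assumes K: "finite K" "K \<noteq> {}" and "\<epsilon> > 0" and gen: "\<And>P. P \<in> K \<Longrightarrow> \<epsilon> \<noteq> snd r - snd P \<and> \<epsilon> \<noteq> snd P - snd r"
  defines "X \<equiv> {s. gap s (upper_env K \<epsilon> s) r = 0}" and "Y \<equiv> {s. gap s (lower_env K \<epsilon> s) r = 0}"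
  shows "finite X \<and> finite Y \<and> card X + card Y \<le> 2"
proof -
  define L where "L P s = (snd P - snd r) - s * (fst P - fst r)" for P s
  have X: "(\<forall>P\<in>K. L P s \<le> - \<epsilon>) \<and> (\<exists>P\<in>K. L P s = - \<epsilon>)" if "s \<in> X" for s
  proof -
    let ?A = "(\<lambda>P. snd P - s * fst P) ` K"
    have M: "Max ?A = snd r - s * fst r - \<epsilon>" using that by (simp add: X_def gap_def upper_env_def)
    have "Max ?A \<in> ?A" using K by (intro Max_in) auto
    then obtain P where "P \<in> K" "Max ?A = snd P - s * fst P" by (rule imageE)
    moreover have "\<forall>P\<in>K. snd P - s * fst P \<le> Max ?A" using K by auto
    ultimately show ?thesis unfolding M by (intro conjI ballI bexI[of _ P]) (auto simp: L_def algebra_simps)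
  qed
  have Y: "(\<forall>P\<in>K. L P s \<ge> \<epsilon>) \<and> (\<exists>P\<in>K. L P s = \<epsilon>)" if "s \<in> Y" for s
  proof -
    let ?A = "(\<lambda>P. snd P - s * fst P) ` K"
    have M: "Min ?A = snd r - s * fst r + \<epsilon>" using that by (simp add: Y_def gap_def lower_env_def)
    have "Min ?A \<in> ?A" using K by (intro Min_in) auto
    then obtain P where "P \<in> K" "Min ?A = snd P - s * fst P" by (rule imageE)
    moreover have "\<forall>P\<in>K. snd P - s * fst P \<ge> Min ?A" using K by auto
    ultimately show ?thesis unfolding M by (intro conjI ballI bexI[of _ P]) (auto simp: L_def algebra_simps)
  qed
  have one: "finite Z \<and> card Z \<le> 1" if "\<And>x y. x \<in> Z \<Longrightarrow> y \<in> Z \<Longrightarrow> x < y \<Longrightarrow> False" for Z :: "real set"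
  proof (cases "Z = {}")
    case False
    then obtain z where "z \<in> Z" by blast
    have "x = z" if "x \<in> Z" for x
      using \<open>\<And>x y. x \<in> Z \<Longrightarrow> y \<in> Z \<Longrightarrow> x < y \<Longrightarrow> False\<close> that \<open>z \<in> Z\<close> by (cases x z rule: linorder_cases) blast+
    then have "Z = {z}" using \<open>z \<in> Z\<close> by blast
    then show ?thesis by simp
  qed simp
  have Lmono: "L P y < L P x" if "x < y" "fst P > fst r" for P x y
  proof -
    have "(y - x) * (fst P - fst r) > 0" using that by simp
    then show ?thesis by (simp add: L_def algebra_simps)
  qed
  have Lmono': "L P x < L P y" if "x < y" "fst P < fst r" for P x y
  proof -
    have "(y - x) * (fst r - fst P) > 0" using that by simp
    then show ?thesis by (simp add: L_def algebra_simps)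
  qed
  consider "\<forall>P\<in>K. fst P < fst r" | "\<forall>P\<in>K. fst P > fst r" | P1 P2 where "P1 \<in> K" "P2 \<in> K" "fst P1 \<le> fst r" "fst r \<le> fst P2"
    by (meson not_less less_imp_le)
  then show ?thesis
  proof cases
    case 1
    have "False" if "x \<in> X" "y \<in> X" "x < y" for x y
      using X[OF that(1)] X[OF that(2)] Lmono'[OF that(3)] 1 by (metis not_less)
    moreover have "False" if "x \<in> Y" "y \<in> Y" "x < y" for x y
      using Y[OF that(1)] Y[OF that(2)] Lmono'[OF that(3)] 1 by (metis not_less)
    ultimately have "finite X \<and> card X \<le> 1" "finite Y \<and> card Y \<le> 1" using one by blast+
    then show ?thesis by simp
  next
    case 2
    have "False" if "x \<in> X" "y \<in> X" "x < y" for x y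
      using X[OF that(1)] X[OF that(2)] Lmono[OF that(3)] 2 by (metis not_less)
    moreover have "False" if "x \<in> Y" "y \<in> Y" "x < y" for x y
      using Y[OF that(1)] Y[OF that(2)] Lmono[OF that(3)] 2 by (metis not_less)
    ultimately have "finite X \<and> card X \<le> 1" "finite Y \<and> card Y \<le> 1" using one by blast+
    then show ?thesis by simp
  next
    case 3
    have XY: "X = {} \<or> Y = {}"
    proof (rule ccontr)
      assume "\<not> ?thesis"
      then obtain s s' where "s \<in> X" "s' \<in> Y" by blast
      then have "L P1 s \<le> - \<epsilon>" "L P2 s \<le> - \<epsilon>" "L P1 s' \<ge> \<epsilon>" "L P2 s' \<ge> \<epsilon>" using X Y 3 by blast+
      then have "(s - s') * (fst P1 - fst r) > 0" "(s - s') * (fst P2 - fst r) > 0"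
        using \<open>\<epsilon> > 0\<close> by (simp_all add: L_def algebra_simps)
      then show False using 3 by (auto simp: zero_less_mult_iff)
    qed
    have flat: "fst P = fst r" if "L P a \<le> L P b" "L P c \<le> L P b" "a < b" "b < c" for P a b c
      using that Lmono[of a b P] Lmono'[of b c P] by (cases "fst P" "fst r" rule: linorder_cases) auto
    have flat': "fst P = fst r" if "L P a \<ge> L P b" "L P c \<ge> L P b" "a < b" "b < c" for P a b c
      using that Lmono[of b c P] Lmono'[of a b P] by (cases "fst P" "fst r" rule: linorder_cases) auto
    have "finite X \<and> card X \<le> 2"
    proof (rule card_le_two)
      fix a b c assume abc: "a \<in> X" "b \<in> X" "c \<in> X" "a < b" "b < c"
      obtain P where P: "P \<in> K" "L P b = - \<epsilon>" using X[OF abc(2)] by blast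
      then have "L P a \<le> L P b" "L P c \<le> L P b" using X[OF abc(1)] X[OF abc(3)] by auto
      then have "fst P = fst r" using flat abc by blast
      then show False using gen[OF P(1)] P(2) by (simp add: L_def)
    qed
    moreover have "finite Y \<and> card Y \<le> 2"
    proof (rule card_le_two)
      fix a b c assume abc: "a \<in> Y" "b \<in> Y" "c \<in> Y" "a < b" "b < c"
      obtain P where P: "P \<in> K" "L P b = \<epsilon>" using Y[OF abc(2)] by blast
      then have "L P a \<ge> L P b" "L P c \<ge> L P b" using Y[OF abc(1)] Y[OF abc(3)] by auto
      then have "fst P = fst r" using flat' abc by blast
      then show False using gen[OF P(1)] P(2) by (simp add: L_def)
    qed
    ultimately show ?thesis using XY by auto
  qed
qed

section \<open>Points beyond the largest root\<close>

text \<open>All of \<open>K\<close> is left of \<open>P\<close>. So \<open>P\<close> lies above the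
  raised supporting line of slope s exactly if s is less than the slope from each raised point of
  \<open>K\<close> to \<open>P\<close>, and the crossing happens at the least of these slopes. The
  lower envelope leads to a maximum instead.\<close>

lemma gap_upper_env:
  fixes \<epsilon> :: real and P :: "real \<times> real"
  assumes K: "finite K" "K \<noteq> {}" and x: "\<And>Q. Q \<in> K \<Longrightarrow> fst Q < fst P"
  defines "k \<equiv> Min ((\<lambda>Q. (snd P - snd Q - \<epsilon>) / (fst P - fst Q)) ` K)"
  shows "s < k \<Longrightarrow> gap s (upper_env K \<epsilon> s) P > 0" "k < s \<Longrightarrow> gap s (upper_env K \<epsilon> s) P < 0"
    "gap k (upper_env K \<epsilon> k) P = 0"
proof -
  let ?A = "\<lambda>s. (\<lambda>Q. snd Q - s * fst Q) ` K" and ?B = "(\<lambda>Q. (snd P - snd Q - \<epsilon>) / (fst P - fst Q)) ` K"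
  have A: "finite (?A s)" "?A s \<noteq> {}" "finite ?B" "?B \<noteq> {}" for s using K by auto
  have pos: "gap s (upper_env K \<epsilon> s) P > 0 \<longleftrightarrow> s < k" for s
  proof -
    have "gap s (upper_env K \<epsilon> s) P > 0 \<longleftrightarrow> Max (?A s) < snd P - s * fst P - \<epsilon>"
      by (auto simp: gap_def upper_env_def)
    also have "\<dots> \<longleftrightarrow> (\<forall>Q\<in>K. snd Q - s * fst Q < snd P - s * fst P - \<epsilon>)"
      using A(1)[of s] A(2)[of s] by (subst Max_less_iff) auto
    also have "\<dots> \<longleftrightarrow> (\<forall>Q\<in>K. s < (snd P - snd Q - \<epsilon>) / (fst P - fst Q))"
      using x by (intro ball_cong refl) (simp add: field_simps)
    also have "\<dots> \<longleftrightarrow> s < k" unfolding k_def using A by (subst Min_gr_iff) auto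
    finally show ?thesis .
  qed
  have neg: "gap s (upper_env K \<epsilon> s) P < 0 \<longleftrightarrow> k < s" for s
  proof -
    have "gap s (upper_env K \<epsilon> s) P < 0 \<longleftrightarrow> snd P - s * fst P - \<epsilon> < Max (?A s)"
      by (auto simp: gap_def upper_env_def)
    also have "\<dots> \<longleftrightarrow> (\<exists>Q\<in>K. snd P - s * fst P - \<epsilon> < snd Q - s * fst Q)"
      using A(1)[of s] A(2)[of s] by (subst Max_gr_iff) auto
    also have "\<dots> \<longleftrightarrow> (\<exists>Q\<in>K. (snd P - snd Q - \<epsilon>) / (fst P - fst Q) < s)"
      using x by (intro bex_cong refl) (simp add: field_simps)
    also have "\<dots> \<longleftrightarrow> k < s" unfolding k_def using A by (subst Min_less_iff) auto
    finally show ?thesis .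
  qed
  show "s < k \<Longrightarrow> gap s (upper_env K \<epsilon> s) P > 0" "k < s \<Longrightarrow> gap s (upper_env K \<epsilon> s) P < 0"
    "gap k (upper_env K \<epsilon> k) P = 0"
    using pos[of s] neg[of s] pos[of k] neg[of k] by auto
qed

lemma gap_lower_env:
  fixes \<epsilon> :: real and P :: "real \<times> real"
  assumes K: "finite K" "K \<noteq> {}" and x: "\<And>Q. Q \<in> K \<Longrightarrow> fst Q < fst P"
  defines "k \<equiv> Max ((\<lambda>Q. (snd P - snd Q + \<epsilon>) / (fst P - fst Q)) ` K)"
  shows "s < k \<Longrightarrow> gap s (lower_env K \<epsilon> s) P > 0" "k < s \<Longrightarrow> gap s (lower_env K \<epsilon> s) P < 0"
    "gap k (lower_env K \<epsilon> k) P = 0"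
proof -
  let ?A = "\<lambda>s. (\<lambda>Q. snd Q - s * fst Q) ` K" and ?B = "(\<lambda>Q. (snd P - snd Q + \<epsilon>) / (fst P - fst Q)) ` K"
  have A: "finite (?A s)" "?A s \<noteq> {}" "finite ?B" "?B \<noteq> {}" for s using K by auto
  have pos: "gap s (lower_env K \<epsilon> s) P > 0 \<longleftrightarrow> s < k" for s
  proof -
    have "gap s (lower_env K \<epsilon> s) P > 0 \<longleftrightarrow> Min (?A s) < snd P - s * fst P + \<epsilon>"
      by (auto simp: gap_def lower_env_def)
    also have "\<dots> \<longleftrightarrow> (\<exists>Q\<in>K. snd Q - s * fst Q < snd P - s * fst P + \<epsilon>)"
      using A(1)[of s] A(2)[of s] by (subst Min_less_iff) auto
    also have "\<dots> \<longleftrightarrow> (\<exists>Q\<in>K. s < (snd P - snd Q + \<epsilon>) / (fst P - fst Q))"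
      using x by (intro bex_cong refl) (simp add: field_simps)
    also have "\<dots> \<longleftrightarrow> s < k" unfolding k_def using A by (subst Max_gr_iff) auto
    finally show ?thesis .
  qed
  have neg: "gap s (lower_env K \<epsilon> s) P < 0 \<longleftrightarrow> k < s" for s
  proof -
    have "gap s (lower_env K \<epsilon> s) P < 0 \<longleftrightarrow> snd P - s * fst P + \<epsilon> < Min (?A s)"
      by (auto simp: gap_def lower_env_def)
    also have "\<dots> \<longleftrightarrow> (\<forall>Q\<in>K. snd P - s * fst P + \<epsilon> < snd Q - s * fst Q)"
      using A(1)[of s] A(2)[of s] by (subst Min_gr_iff) auto
    also have "\<dots> \<longleftrightarrow> (\<forall>Q\<in>K. (snd P - snd Q + \<epsilon>) / (fst P - fst Q) < s)"
      using x by (intro ball_cong refl) (simp add: field_simps)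
    also have "\<dots> \<longleftrightarrow> k < s" unfolding k_def using A by (subst Max_less_iff) auto
    finally show ?thesis .
  qed
  show "s < k \<Longrightarrow> gap s (lower_env K \<epsilon> s) P > 0" "k < s \<Longrightarrow> gap s (lower_env K \<epsilon> s) P < 0"
    "gap k (lower_env K \<epsilon> k) P = 0"
    using pos[of s] neg[of s] pos[of k] neg[of k] by auto
qed

lemma continuous_on_Max_image:
  fixes L :: "'a \<Rightarrow> real \<Rightarrow> real"
  assumes "finite K" "K \<noteq> {}" "\<And>P. P \<in> K \<Longrightarrow> continuous_on X (L P)"
  shows "continuous_on X (\<lambda>s. Max ((\<lambda>P. L P s) ` K))"
  using assms
proof (induction K rule: finite_ne_induct)
  case (insert P K)
  then have "continuous_on X (\<lambda>s. max (L P s) (Max ((\<lambda>P. L P s) ` K)))"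
    by (intro continuous_on_max) auto
  then show ?case using insert by simp
qed simp

lemma cont_upper_env:
  assumes "finite K" "K \<noteq> {}"
  shows "continuous_on X (upper_env K \<epsilon>)"
  unfolding upper_env_def
  by (intro continuous_intros continuous_on_Max_image assms)

lemma lower_env_uminus:
  assumes "finite K" "K \<noteq> {}"
  shows "lower_env K \<epsilon> s = - (Max ((\<lambda>P. - (snd P - s * fst P)) ` K) + \<epsilon>)"
proof -
  have "Min ((\<lambda>P. snd P - s * fst P) ` K) = - Max ((\<lambda>P. - (snd P - s * fst P)) ` K)"
    using minus_Max_eq_Min[of "(\<lambda>P. - (snd P - s * fst P)) ` K"] assms by (simp add: image_image)
  then show ?thesis by (simp add: lower_env_def)
qed

lemma cont_lower_env:
  assumes "finite K" "K \<noteq> {}"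
  shows "continuous_on X (lower_env K \<epsilon>)"
  unfolding lower_env_uminus[OF assms, abs_def]
  by (intro continuous_intros continuous_on_Max_image assms)

lemma eventually_less_at_right:
  fixes h k :: "real \<Rightarrow> real"
  assumes "isCont h 0" "isCont k 0" "h 0 < k 0"
  shows "\<forall>\<^sub>F \<epsilon> in at_right 0. h \<epsilon> < k \<epsilon>"
proof (rule order_tendstoD(2)[of "\<lambda>\<epsilon>. h \<epsilon> - k \<epsilon>" "h 0 - k 0" _ 0, THEN eventually_mono])
  show "((\<lambda>\<epsilon>. h \<epsilon> - k \<epsilon>) \<longlongrightarrow> h 0 - k 0) (at_right 0)"
    using assms by (intro tendsto_diff) (auto simp: isCont_def intro: tendsto_mono[OF at_le])
qed (use assms in auto)

text \<open>Inclusion and exclusion: every point of \<open>D\<close> except the last has a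
  successor, and before it a contact in at least one chain; for the points of \<open>H\<close> there
  is a contact in both. Hence |D| - 1 + |H| is at most the number of all contacts.\<close>

lemma two_chains_count:
  fixes x k1 k2 :: "'a \<Rightarrow> real" and Z1 Z2 :: "real set"
  assumes D: "finite D" "inj_on x D" and Z: "finite Z1" "finite Z2" and "H \<subseteq> D"
    and mono: "\<And>P Q. P \<in> D \<Longrightarrow> Q \<in> D \<Longrightarrow> x P < x Q \<Longrightarrow> k1 P < k1 Q \<and> k2 P < k2 Q"
    and some: "\<And>P Q. P \<in> D \<Longrightarrow> Q \<in> D \<Longrightarrow> x P < x Q \<Longrightarrow> \<forall>R\<in>D. \<not> (x P < x R \<and> x R < x Q) \<Longrightarrow>
       (\<exists>z\<in>Z1. k1 P < z \<and> z < k1 Q) \<or> (\<exists>z\<in>Z2. k2 P < z \<and> z < k2 Q)"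
    and both: "\<And>P. P \<in> H \<Longrightarrow> \<exists>Q\<in>D. x P < x Q \<and> (\<forall>R\<in>D. \<not> (x P < x R \<and> x R < x Q)) \<and>
       (\<exists>z\<in>Z1. k1 P < z \<and> z < k1 Q) \<and> (\<exists>z\<in>Z2. k2 P < z \<and> z < k2 Q)"
  shows "card D + card H \<le> card Z1 + card Z2 + 1"
proof (cases "D = {}")
  case True
  then show ?thesis using assms(5) by simp
next
  case False
  have "Max (x ` D) \<in> x ` D" using D False by (intro Max_in) auto
  then obtain top where top: "top \<in> D" "x top = Max (x ` D)" by auto
  define E where "E = D - {top}"
  have cE: "card E + 1 = card D" using top(1) D False card_gt_0_iff[of D] by (simp add: E_def)
  have nxt: "\<exists>Q\<in>D. x P < x Q \<and> (\<forall>R\<in>D. \<not> (x P < x R \<and> x R < x Q))" if P: "P \<in> E" for P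
  proof -
    have "P \<in> D" "P \<noteq> top" using P by (auto simp: E_def)
    moreover have "x P \<le> x top" using \<open>P \<in> D\<close> top D(1) by simp
    ultimately have "x P < x top" using top(1) D(2) by (auto simp: order_le_less dest: inj_onD)
    then have ne: "{y\<in>x ` D. x P < y} \<noteq> {}" "finite {y\<in>x ` D. x P < y}" using top(1) D by auto
    obtain Q where Q: "Q \<in> D" "x Q = Min {y\<in>x ` D. x P < y}" "x P < x Q"
      using Min_in[OF ne(2,1)] by auto
    have "\<not> (x P < x R \<and> x R < x Q)" if "R \<in> D" for R
      using Min_le[OF ne(2), of "x R"] that Q by auto
    then show ?thesis using Q by blast
  qed
  define adj where "adj P Q \<longleftrightarrow> Q \<in> D \<and> x P < x Q \<and> (\<forall>R\<in>D. \<not> (x P < x R \<and> x R < x Q))" for P Q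
  define G1 where "G1 = {P\<in>E. \<exists>Q. adj P Q \<and> (\<exists>z\<in>Z1. k1 P < z \<and> z < k1 Q)}"
  define G2 where "G2 = {P\<in>E. \<exists>Q. adj P Q \<and> (\<exists>z\<in>Z2. k2 P < z \<and> z < k2 Q)}"
  have cnt: "card G \<le> card Z" if Z: "finite Z" and G: "G \<subseteq> E" "\<And>P. P \<in> G \<Longrightarrow> \<exists>Q. adj P Q \<and> (\<exists>z\<in>Z. k P < z \<and> z < k Q)"
    and m: "\<And>P Q. P \<in> D \<Longrightarrow> Q \<in> D \<Longrightarrow> x P < x Q \<Longrightarrow> k P < k Q" for G k and Z :: "real set"
  proof -
    have GD: "P \<in> D" if "P \<in> G" for P using that G(1) by (auto simp: E_def)
    have tri: "x P < x Q" if "P \<in> D" "Q \<in> D" "k P < k Q" for P Q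
      using m[of Q P] that D(2) by (cases "x P" "x Q" rule: linorder_cases) (auto dest: inj_onD)
    have "inj_on k G"
    proof (rule inj_onI)
      fix P Q assume "P \<in> G" "Q \<in> G" "k P = k Q"
      then show "P = Q" using m[of P Q] m[of Q P] GD D(2)
        by (cases "x P" "x Q" rule: linorder_cases) (auto dest: inj_onD)
    qed
    moreover have "card (k ` G) \<le> card Z"
    proof (rule card_le_if_separated)
      show "finite (k ` G)" using D(1) GD by (meson finite_imageI finite_subset subsetI)
      fix a assume "a \<in> k ` G"
      then obtain P where P: "P \<in> G" "a = k P" by blast
      then obtain Q z where Q: "adj P Q" "z \<in> Z" "k P < z" "z < k Q" using G(2) by blast
      have "z < k R" if "R \<in> G" "k P < k R" for R
      proof -
        have "x P < x R" using tri that P GD by blast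
        then have "x Q \<le> x R" using Q(1) GD[OF that(1)] by (auto simp: adj_def not_less)
        then have "k Q \<le> k R"
          using m[of Q R] Q(1) GD[OF that(1)] D(2) by (cases "x Q = x R") (auto simp: adj_def dest: inj_onD)
        then show ?thesis using Q(4) by simp
      qed
      then show "\<exists>z\<in>Z. a < z \<and> (\<forall>b\<in>k ` G. a < b \<longrightarrow> z < b)" using P Q by blast
    qed (rule Z)
    ultimately show ?thesis by (simp add: card_image)
  qed
  have "card G1 \<le> card Z1" by (rule cnt[of Z1 G1 k1]) (use Z mono in \<open>auto simp: G1_def\<close>)
  moreover have "card G2 \<le> card Z2" by (rule cnt[of Z2 G2 k2]) (use Z mono in \<open>auto simp: G2_def\<close>)
  moreover have fin: "finite E" "finite G1" "finite G2" using D by (auto simp: E_def G1_def G2_def)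
  moreover have "E \<subseteq> G1 \<union> G2"
  proof
    fix P assume P: "P \<in> E"
    then obtain Q where Q: "Q \<in> D" "x P < x Q" "\<forall>R\<in>D. \<not> (x P < x R \<and> x R < x Q)" using nxt by blast
    then show "P \<in> G1 \<union> G2" using some[OF _ Q] P Q by (auto simp: G1_def G2_def E_def adj_def)
  qed
  then have "card E \<le> card (G1 \<union> G2)" using fin by (intro card_mono) auto
  moreover have "H \<subseteq> G1 \<inter> G2"
  proof
    fix P assume P: "P \<in> H"
    then obtain Q where Q: "Q \<in> D" "x P < x Q" "\<forall>R\<in>D. \<not> (x P < x R \<and> x R < x Q)"
      "\<exists>z\<in>Z1. k1 P < z \<and> z < k1 Q" "\<exists>z\<in>Z2. k2 P < z \<and> z < k2 Q" using both by blast
    have "x Q \<le> x top" using top Q(1) D by simp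
    then have "P \<in> E" using P \<open>H \<subseteq> D\<close> Q(2) by (auto simp: E_def)
    then show "P \<in> G1 \<inter> G2" using Q by (auto simp: G1_def G2_def adj_def)
  qed
  then have "card H \<le> card (G1 \<inter> G2)" using fin by (intro card_mono) auto
  moreover have "card G1 + card G2 = card (G1 \<union> G2) + card (G1 \<inter> G2)" using fin by (intro card_Un_Int)
  ultimately show ?thesis using cE by linarith
qed

context wcubic
begin

section \<open>Combining the upper and the lower envelope\<close>

lemma oncurve_right_cases:
  assumes "oncurve P" "e \<le> fst P"
  shows "P \<in> arcA \<or> P \<in> arcP \<or> P \<in> arcM \<or> P = (e, 0) \<and> x0 = e"
proof (cases "P \<in> arcA \<or> P \<in> arcM")
  case False
  then show ?thesis using assms(2) by (auto elim: oncurve_cases[OF assms(1)])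
qed blast

text \<open>Three points are lost on each of the three arcs, which makes 9.\<close>

lemma inner_right:
  assumes "finite D" "\<And>P. P \<in> D \<Longrightarrow> oncurve P \<and> e \<le> fst P"
  obtains H where "H \<subseteq> D" "card D \<le> card H + 9"
    "\<And>P. P \<in> H \<Longrightarrow> \<exists>C\<in>arcs. P \<in> C \<and> (\<exists>P0\<in>D\<inter>C. \<exists>Q\<in>D\<inter>C. \<exists>P3\<in>D\<inter>C. xi P0 < xi P \<and> xi P < xi Q \<and> xi Q < xi P3 \<and>
        (\<forall>R\<in>D. \<not> (xi P < xi R \<and> xi R < xi Q)))"
proof -
  have inj: "inj_on xi D" using xi_inj assms(2) by (intro inj_onI) blast
  have "\<exists>H\<subseteq>D\<inter>C. card (D \<inter> C) \<le> card H + 3 \<and> (\<forall>P\<in>H. \<exists>P0\<in>D\<inter>C. \<exists>Q\<in>D\<inter>C. \<exists>P3\<in>D\<inter>C. xi P0 < xi P \<and> xi P < xi Q \<and> xi Q < xi P3 \<and>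
        (\<forall>R\<in>D. \<not> (xi P < xi R \<and> xi R < xi Q)))" if C: "C \<in> arcs" for C
  proof -
    obtain G where G: "G \<subseteq> xi ` (D \<inter> C)" "card (xi ` (D \<inter> C)) \<le> card G + 3"
      "\<And>a. a \<in> G \<Longrightarrow> \<exists>w\<in>xi ` (D \<inter> C). \<exists>b\<in>xi ` (D \<inter> C). \<exists>c\<in>xi ` (D \<inter> C). w < a \<and> a < b \<and> b < c \<and> (\<forall>x\<in>xi ` (D \<inter> C). a < x \<longrightarrow> b \<le> x)"
      using inner_subset[of "xi ` (D \<inter> C)"] assms(1) by blast
    define H where "H = {P\<in>D \<inter> C. xi P \<in> G}"
    have "xi ` H = G" using G(1) by (auto simp: H_def)
    moreover have "inj_on xi H" "inj_on xi (D \<inter> C)" using inj by (auto simp: H_def inj_on_def)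
    ultimately have "card H = card G" "card (D \<inter> C) = card (xi ` (D \<inter> C))" by (simp_all add: card_image flip: \<open>xi ` H = G\<close>)
    moreover have "\<exists>P0\<in>D\<inter>C. \<exists>Q\<in>D\<inter>C. \<exists>P3\<in>D\<inter>C. xi P0 < xi P \<and> xi P < xi Q \<and> xi Q < xi P3 \<and>
        (\<forall>R\<in>D. \<not> (xi P < xi R \<and> xi R < xi Q))" if P: "P \<in> H" for P
    proof -
      have "xi P \<in> G" "P \<in> C" using P by (auto simp: H_def)
      then obtain w b c where wbc: "w \<in> xi ` (D \<inter> C)" "b \<in> xi ` (D \<inter> C)" "c \<in> xi ` (D \<inter> C)" "w < xi P" "xi P < b" "b < c"
        "\<forall>x\<in>xi ` (D \<inter> C). xi P < x \<longrightarrow> b \<le> x" using G(3) by metis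
      obtain P0 where P0: "P0 \<in> D \<inter> C" "w = xi P0" using wbc(1) by blast
      obtain Q where Q: "Q \<in> D \<inter> C" "b = xi Q" using wbc(2) by blast
      obtain P3 where P3: "P3 \<in> D \<inter> C" "c = xi P3" using wbc(3) by blast
      have "\<not> (xi P < xi R \<and> xi R < xi Q)" if "R \<in> D" for R
      proof
        assume R: "xi P < xi R \<and> xi R < xi Q"
        then have "R \<in> C" using xi_between[OF C \<open>P \<in> C\<close>, of Q R] Q assms(2)[OF that] by blast
        then show False using wbc(7) R that Q(2) by force
      qed
      then show ?thesis using P0 Q P3 wbc by blast
    qed
    ultimately show ?thesis using G(2) by (intro exI[of _ H]) (auto simp: H_def)
  qed
  then have "\<forall>C\<in>arcs. \<exists>H. H\<subseteq>D\<inter>C \<and> card (D \<inter> C) \<le> card H + 3 \<and> (\<forall>P\<in>H. \<exists>P0\<in>D\<inter>C. \<exists>Q\<in>D\<inter>C. \<exists>P3\<in>D\<inter>C. xi P0 < xi P \<and> xi P < xi Q \<and> xi Q < xi P3 \<and>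
        (\<forall>R\<in>D. \<not> (xi P < xi R \<and> xi R < xi Q)))" by blast
  from bchoice[OF this] obtain h where hh: "\<forall>C\<in>arcs. h C\<subseteq>D\<inter>C \<and> card (D \<inter> C) \<le> card (h C) + 3 \<and> (\<forall>P\<in>h C. \<exists>P0\<in>D\<inter>C. \<exists>Q\<in>D\<inter>C. \<exists>P3\<in>D\<inter>C. xi P0 < xi P \<and> xi P < xi Q \<and> xi Q < xi P3 \<and>
        (\<forall>R\<in>D. \<not> (xi P < xi R \<and> xi R < xi Q)))" by (rule exE)
  have h: "\<And>C. C \<in> arcs \<Longrightarrow> h C \<subseteq> D \<inter> C" "\<And>C. C \<in> arcs \<Longrightarrow> card (D \<inter> C) \<le> card (h C) + 3"
    "\<And>C P. C \<in> arcs \<Longrightarrow> P \<in> h C \<Longrightarrow> \<exists>P0\<in>D\<inter>C. \<exists>Q\<in>D\<inter>C. \<exists>P3\<in>D\<inter>C. xi P0 < xi P \<and> xi P < xi Q \<and> xi Q < xi P3 \<and>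
        (\<forall>R\<in>D. \<not> (xi P < xi R \<and> xi R < xi Q))"
    using hh by blast+
  have ar: "arcA \<in> arcs" "arcP \<in> arcs" "arcM \<in> arcs" by (auto simp: arcs_def)
  have disj: "arcA \<inter> arcP = {}" "arcA \<inter> arcM = {}" "arcP \<inter> arcM = {}" by (auto simp: arcA_def arcP_def arcM_def)
  define H where "H = h arcA \<union> (h arcP \<union> h arcM)"
  have fin: "finite (h C)" if "C \<in> arcs" for C using h(1)[OF that] assms(1) finite_subset by blast
  have "h arcP \<inter> h arcM = {}" "h arcA \<inter> (h arcP \<union> h arcM) = {}"
    using h(1)[OF ar(1)] h(1)[OF ar(2)] h(1)[OF ar(3)] disj by blast+
  then have cH: "card H = card (h arcA) + (card (h arcP) + card (h arcM))"
    unfolding H_def using fin ar by (simp add: card_Un_disjoint)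
  show thesis
  proof (rule that[of H])
    show "H \<subseteq> D" using h(1) ar by (auto simp: H_def)
    have D: "D \<subseteq> (D \<inter> arcA) \<union> ((D \<inter> arcP) \<union> ((D \<inter> arcM) \<union> (if x0 = e then {(e, 0)} else {})))"
      using oncurve_right_cases assms(2) by fastforce
    have "card D \<le> card (D \<inter> arcA) + (card (D \<inter> arcP) + (card (D \<inter> arcM) + card (if x0 = e then {(e, 0 :: real)} else {})))"
      using card_mono[OF _ D] assms(1) card_Un_le[of "D \<inter> arcA"] card_Un_le[of "D \<inter> arcP"] card_Un_le[of "D \<inter> arcM"]
      by (smt (verit, ccfv_threshold) add_mono finite.emptyI finite.insertI finite_Int finite_UnI le_trans nat_add_left_cancel_le)
    \<comment> \<open>A singular point outside the arcs costs nothing extra: it occurs only if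
      \<open>arcA\<close> is empty, where the allowance of three is free.\<close>
    moreover have "card (D \<inter> arcA) = 0 \<and> card (if x0 = e then {(e, 0 :: real)} else {}) = 1 \<or> card (if x0 = e then {(e, 0 :: real)} else {}) = 0"
    proof (cases "x0 = e")
      case True
      have "arcA = {}" unfolding arcA_def using True by auto
      then show ?thesis using True by simp
    qed simp
    ultimately show "card D \<le> card H + 9" using cH h(2)[OF ar(1)] h(2)[OF ar(2)] h(2)[OF ar(3)] by linarith
    fix P assume "P \<in> H"
    then obtain C where "C \<in> arcs" "P \<in> h C" using ar by (auto simp: H_def)
    then show "\<exists>C\<in>arcs. P \<in> C \<and> (\<exists>P0\<in>D\<inter>C. \<exists>Q\<in>D\<inter>C. \<exists>P3\<in>D\<inter>C. xi P0 < xi P \<and> xi P < xi Q \<and> xi Q < xi P3 \<and>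
        (\<forall>R\<in>D. \<not> (xi P < xi R \<and> xi R < xi Q)))"
      using h(1)[of C] h(3)[of C P] by blast
  qed
qed

text \<open>Together the two envelopes meet each point off the cubic at most twice and each slope of
  \<open>I\<close> twice. With \<open>H\<close> from \<open>inner_right\<close>,
  \<open>two_chains_count\<close> gives 2 |D| - 9 \<le> 2 (|M| + |I|) + 1.\<close>

theorem right_card_le:
  assumes fin: "finite S" "finite I" and sm: "sides_meet_aff S I"
  defines "K \<equiv> {P\<in>S. oncurve P \<and> fst P < e}" and "D \<equiv> {P\<in>S. oncurve P \<and> e \<le> fst P}"
    and "M \<equiv> {P\<in>S. \<not> oncurve P}"
  assumes "K \<noteq> {}"
  shows "card D \<le> card M + card I + 5"
\<comment> \<open>Four points on the right are required for the contradiction below, because a line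
  may contain three points of the cubic.\<close>
proof (cases "card D \<le> 3")
  case False
  have finKDM: "finite K" "finite D" "finite M" using fin by (auto simp: K_def D_def M_def)
  note K = finKDM(1) \<open>K \<noteq> {}\<close>
  have DS: "D \<subseteq> S" by (auto simp: D_def)
  have Don: "oncurve P" "e \<le> fst P" if "P \<in> D" for P using that by (auto simp: D_def)
  have Kon: "oncurve P" "fst P < e" if "P \<in> K" for P using that by (auto simp: K_def)
  have KD: "fst Q < fst P" if "Q \<in> K" "P \<in> D" for P Q using Kon(2)[OF that(1)] Don(2)[OF that(2)] by simp
  define mx mn where "mx s = Max ((\<lambda>P. snd P - s * fst P) ` K)" and "mn s = Min ((\<lambda>P. snd P - s * fst P) ` K)" for s :: real
  have evs: "\<forall>\<^sub>F \<epsilon> in at_right (0::real). (snd P - snd r - \<epsilon>) / (fst P - fst r) < (snd Q - snd r - \<epsilon>) / (fst Q - fst r)"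
    "\<forall>\<^sub>F \<epsilon> in at_right (0::real). (snd P - snd r + \<epsilon>) / (fst P - fst r) < (snd Q - snd r + \<epsilon>) / (fst Q - fst r)"
    if "P \<in> D" "Q \<in> {Q\<in>D. xi P < xi Q}" "r \<in> K" for P Q r
  proof -
    have "Q \<in> D" "xi P < xi Q" using that(2) by auto
    then have lt: "(snd P - snd r) / (fst P - fst r) < (snd Q - snd r) / (fst Q - fst r)"
      using slope_mono[OF Kon[OF that(3)] Don[OF that(1)] Don[of Q]] by blast
    have ne: "fst P \<noteq> fst r" "fst Q \<noteq> fst r" using KD[OF that(3,1)] KD[OF that(3) \<open>Q \<in> D\<close>] by auto
    show "\<forall>\<^sub>F \<epsilon> in at_right (0::real). (snd P - snd r - \<epsilon>) / (fst P - fst r) < (snd Q - snd r - \<epsilon>) / (fst Q - fst r)"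
      "\<forall>\<^sub>F \<epsilon> in at_right (0::real). (snd P - snd r + \<epsilon>) / (fst P - fst r) < (snd Q - snd r + \<epsilon>) / (fst Q - fst r)"
      by (rule eventually_less_at_right; use lt ne in \<open>auto intro!: continuous_intros\<close>)+
  qed
  \<comment> \<open>Small \<epsilon> preserves the strict order of the slopes of
    \<open>slope_mono\<close>. The remaining conditions exclude finitely many values: flat contacts
    in \<open>envelope_contacts\<close>, and lines of either family through a point of
    \<open>D\<close> that also meet \<open>M\<close> or have a slope in \<open>I\<close>.\<close>
  have "\<forall>\<^sub>F \<epsilon> in at_right 0. \<epsilon> > (0::real)" by (simp add: eventually_at_right_less)
  moreover have "\<forall>\<^sub>F \<epsilon> in at_right (0::real). \<forall>P\<in>D. \<forall>Q\<in>{Q\<in>D. xi P < xi Q}. \<forall>r\<in>K.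
      (snd P - snd r - \<epsilon>) / (fst P - fst r) < (snd Q - snd r - \<epsilon>) / (fst Q - fst r)"
    using finKDM(1,2) by (intro eventually_ball_finite ballI evs) auto
  moreover have "\<forall>\<^sub>F \<epsilon> in at_right (0::real). \<forall>P\<in>D. \<forall>Q\<in>{Q\<in>D. xi P < xi Q}. \<forall>r\<in>K.
      (snd P - snd r + \<epsilon>) / (fst P - fst r) < (snd Q - snd r + \<epsilon>) / (fst Q - fst r)"
    using finKDM(1,2) by (intro eventually_ball_finite ballI evs) auto
  moreover have "\<forall>\<^sub>F \<epsilon> in at_right (0::real). \<forall>r\<in>M. \<forall>P\<in>K. \<epsilon> \<noteq> snd r - snd P \<and> \<epsilon> \<noteq> snd P - snd r"
    using finKDM by (intro eventually_ball_finite ballI eventually_conj eventually_ne_at_right) auto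
  moreover have "\<forall>\<^sub>F \<epsilon> in at_right (0::real). \<forall>P\<in>D. \<forall>r\<in>M.
      \<epsilon> \<noteq> snd P - (snd P - snd r) / (fst P - fst r) * fst P - mx ((snd P - snd r) / (fst P - fst r)) \<and>
      \<epsilon> \<noteq> mn ((snd P - snd r) / (fst P - fst r)) - (snd P - (snd P - snd r) / (fst P - fst r) * fst P)"
    using finKDM by (intro eventually_ball_finite ballI eventually_conj eventually_ne_at_right) auto
  moreover have "\<forall>\<^sub>F \<epsilon> in at_right (0::real). \<forall>P\<in>D. \<forall>s\<in>I. \<epsilon> \<noteq> snd P - s * fst P - mx s \<and> \<epsilon> \<noteq> mn s - (snd P - s * fst P)"
    using finKDM fin by (intro eventually_ball_finite ballI eventually_conj eventually_ne_at_right) auto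
  ultimately have ev: "\<forall>\<^sub>F \<epsilon> in at_right (0::real). \<epsilon> > 0 \<and>
    (\<forall>P\<in>D. \<forall>Q\<in>{Q\<in>D. xi P < xi Q}. \<forall>r\<in>K. (snd P - snd r - \<epsilon>) / (fst P - fst r) < (snd Q - snd r - \<epsilon>) / (fst Q - fst r)) \<and>
    (\<forall>P\<in>D. \<forall>Q\<in>{Q\<in>D. xi P < xi Q}. \<forall>r\<in>K. (snd P - snd r + \<epsilon>) / (fst P - fst r) < (snd Q - snd r + \<epsilon>) / (fst Q - fst r)) \<and>
    (\<forall>r\<in>M. \<forall>P\<in>K. \<epsilon> \<noteq> snd r - snd P \<and> \<epsilon> \<noteq> snd P - snd r) \<and>
    (\<forall>P\<in>D. \<forall>r\<in>M.
      \<epsilon> \<noteq> snd P - (snd P - snd r) / (fst P - fst r) * fst P - mx ((snd P - snd r) / (fst P - fst r)) \<and>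
      \<epsilon> \<noteq> mn ((snd P - snd r) / (fst P - fst r)) - (snd P - (snd P - snd r) / (fst P - fst r) * fst P)) \<and>
    (\<forall>P\<in>D. \<forall>s\<in>I. \<epsilon> \<noteq> snd P - s * fst P - mx s \<and> \<epsilon> \<noteq> mn s - (snd P - s * fst P))"
    by (intro eventually_conj)
  obtain \<epsilon> where E: "\<epsilon> > 0 \<and>
    (\<forall>P\<in>D. \<forall>Q\<in>{Q\<in>D. xi P < xi Q}. \<forall>r\<in>K. (snd P - snd r - \<epsilon>) / (fst P - fst r) < (snd Q - snd r - \<epsilon>) / (fst Q - fst r)) \<and>
    (\<forall>P\<in>D. \<forall>Q\<in>{Q\<in>D. xi P < xi Q}. \<forall>r\<in>K. (snd P - snd r + \<epsilon>) / (fst P - fst r) < (snd Q - snd r + \<epsilon>) / (fst Q - fst r)) \<and>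
    (\<forall>r\<in>M. \<forall>P\<in>K. \<epsilon> \<noteq> snd r - snd P \<and> \<epsilon> \<noteq> snd P - snd r) \<and>
    (\<forall>P\<in>D. \<forall>r\<in>M.
      \<epsilon> \<noteq> snd P - (snd P - snd r) / (fst P - fst r) * fst P - mx ((snd P - snd r) / (fst P - fst r)) \<and>
      \<epsilon> \<noteq> mn ((snd P - snd r) / (fst P - fst r)) - (snd P - (snd P - snd r) / (fst P - fst r) * fst P)) \<and>
    (\<forall>P\<in>D. \<forall>s\<in>I. \<epsilon> \<noteq> snd P - s * fst P - mx s \<and> \<epsilon> \<noteq> mn s - (snd P - s * fst P))"
    using eventually_happens'[OF trivial_limit_at_right_real ev] by blast
  have "\<epsilon> > 0" using E by blast
  define \<kappa>1 \<kappa>2 where "\<kappa>1 P = Min ((\<lambda>Q. (snd P - snd Q - \<epsilon>) / (fst P - fst Q)) ` K)"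
    and "\<kappa>2 P = Max ((\<lambda>Q. (snd P - snd Q + \<epsilon>) / (fst P - fst Q)) ` K)" for P
  define W1 W2 where "W1 = upper_env K \<epsilon>" and "W2 = lower_env K \<epsilon>"
  have g1: "s < \<kappa>1 P \<Longrightarrow> gap s (W1 s) P > 0" "\<kappa>1 P < s \<Longrightarrow> gap s (W1 s) P < 0" "gap (\<kappa>1 P) (W1 (\<kappa>1 P)) P = 0"
    if "P \<in> D" for P s
    using gap_upper_env[OF K KD[OF _ that]] unfolding \<kappa>1_def W1_def by blast+
  have g2: "s < \<kappa>2 P \<Longrightarrow> gap s (W2 s) P > 0" "\<kappa>2 P < s \<Longrightarrow> gap s (W2 s) P < 0" "gap (\<kappa>2 P) (W2 (\<kappa>2 P)) P = 0"
    if "P \<in> D" for P s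
    using gap_lower_env[OF K KD[OF _ that]] unfolding \<kappa>2_def W2_def by blast+
  have mono: "\<kappa>1 P < \<kappa>1 Q \<and> \<kappa>2 P < \<kappa>2 Q" if "P \<in> D" "Q \<in> D" "xi P < xi Q" for P Q
  proof
    let ?k1 = "\<lambda>P r. (snd P - snd r - \<epsilon>) / (fst P - fst r)" and ?k2 = "\<lambda>P r. (snd P - snd r + \<epsilon>) / (fst P - fst r)"
    have "\<kappa>1 Q \<in> ?k1 Q ` K" unfolding \<kappa>1_def using K by (intro Min_in) auto
    then obtain r where r: "r \<in> K" "\<kappa>1 Q = ?k1 Q r" by (rule imageE)
    have "\<kappa>1 P \<le> ?k1 P r" unfolding \<kappa>1_def using K r(1) by simp
    also have "?k1 P r < ?k1 Q r" using E that r(1) by blast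
    finally show "\<kappa>1 P < \<kappa>1 Q" using r(2) by simp
    have "\<kappa>2 P \<in> ?k2 P ` K" unfolding \<kappa>2_def using K by (intro Max_in) auto
    then obtain r where r: "r \<in> K" "\<kappa>2 P = ?k2 P r" by (rule imageE)
    have "?k2 P r < ?k2 Q r" using E that r(1) by blast
    also have "?k2 Q r \<le> \<kappa>2 Q" unfolding \<kappa>2_def using K r(1) by simp
    finally show "\<kappa>2 P < \<kappa>2 Q" using r(2) by simp
  qed
  have inj: "inj_on xi D" using xi_inj Don by (intro inj_onI) blast
  have inj\<kappa>: "inj_on \<kappa>1 D" "inj_on \<kappa>2 D"
  proof -
    have "P = Q" if "P \<in> D" "Q \<in> D" "\<kappa>1 P = \<kappa>1 Q \<or> \<kappa>2 P = \<kappa>2 Q" for P Q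
      using mono[of P Q] mono[of Q P] that inj by (cases "xi P" "xi Q" rule: linorder_cases) (auto dest: inj_onD)
    then show "inj_on \<kappa>1 D" "inj_on \<kappa>2 D" by (auto intro: inj_onI)
  qed
  have ch1: "chain S I UNIV (\<lambda>s. s) W1 D \<kappa>1 (-1)"
    unfolding chain_def using sm DS inj\<kappa> g1 cont_upper_env[OF K] by (auto simp: W1_def)
  have ch2: "chain S I UNIV (\<lambda>s. s) W2 D \<kappa>2 (-1)"
    unfolding chain_def using sm DS inj\<kappa> g2 cont_lower_env[OF K] by (auto simp: W2_def)
  define Z1 Z2 where "Z1 = contacts (S - D) I UNIV (\<lambda>s. s) W1" and "Z2 = contacts (S - D) I UNIV (\<lambda>s. s) W2"
  have Kneg: "gap s (W1 s) r < 0" "gap s (W2 s) r > 0" if "r \<in> K" for r s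
  proof -
    have "snd r - s * fst r \<le> mx s" "mn s \<le> snd r - s * fst r" using K that by (simp_all add: mx_def mn_def)
    then show "gap s (W1 s) r < 0" "gap s (W2 s) r > 0"
      using \<open>\<epsilon> > 0\<close> by (simp_all add: gap_def W1_def W2_def upper_env_def lower_env_def mx_def mn_def)
  qed
  have SDM: "r \<in> K \<or> r \<in> M" if "r \<in> S - D" for r using that by (auto simp: K_def M_def D_def)
  have Zsub: "Z1 \<subseteq> (\<Union>r\<in>M. {s. gap s (W1 s) r = 0}) \<union> I" "Z2 \<subseteq> (\<Union>r\<in>M. {s. gap s (W2 s) r = 0}) \<union> I"
  proof -
    have "c \<in> I \<or> (\<exists>r\<in>M. gap c (W1 c) r = 0)" if cZ: "c \<in> Z1" for c
    proof (rule ccontr)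
      assume n: "\<not> ?thesis"
      then obtain r where "r \<in> S - D" "gap c (W1 c) r = 0" using cZ unfolding Z1_def contacts_def by blast
      then show False using SDM[of r] Kneg(1)[of r c] n by fastforce
    qed
    then show "Z1 \<subseteq> (\<Union>r\<in>M. {s. gap s (W1 s) r = 0}) \<union> I" by blast
    have "c \<in> I \<or> (\<exists>r\<in>M. gap c (W2 c) r = 0)" if cZ: "c \<in> Z2" for c
    proof (rule ccontr)
      assume n: "\<not> ?thesis"
      then obtain r where "r \<in> S - D" "gap c (W2 c) r = 0" using cZ unfolding Z2_def contacts_def by blast
      then show False using SDM[of r] Kneg(2)[of r c] n by fastforce
    qed
    then show "Z2 \<subseteq> (\<Union>r\<in>M. {s. gap s (W2 s) r = 0}) \<union> I" by blast
  qed
  have two: "finite {s. gap s (W1 s) r = 0} \<and> finite {s. gap s (W2 s) r = 0} \<and>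
      card {s. gap s (W1 s) r = 0} + card {s. gap s (W2 s) r = 0} \<le> 2" if "r \<in> M" for r
    unfolding W1_def W2_def using E that by (intro envelope_contacts[OF K]) blast+
  have finZ: "finite Z1" "finite Z2"
  proof -
    have "finite ((\<Union>r\<in>M. {s. gap s (W1 s) r = 0}) \<union> I)" "finite ((\<Union>r\<in>M. {s. gap s (W2 s) r = 0}) \<union> I)"
      using two finKDM(3) fin(2) by blast+
    then show "finite Z1" "finite Z2" using Zsub by (blast intro: finite_subset)+
  qed
  have "card Z1 \<le> (\<Sum>r\<in>M. card {s. gap s (W1 s) r = 0}) + card I" "card Z2 \<le> (\<Sum>r\<in>M. card {s. gap s (W2 s) r = 0}) + card I"
  proof -
    have c: "card Z \<le> (\<Sum>r\<in>M. card (A r)) + card I" if "Z \<subseteq> (\<Union>r\<in>M. A r) \<union> I" "\<And>r. r \<in> M \<Longrightarrow> finite (A r)" for Z and A :: "real \<times> real \<Rightarrow> real set"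
    proof -
      have "card Z \<le> card ((\<Union>r\<in>M. A r) \<union> I)" using that finKDM fin by (intro card_mono) auto
      also have "\<dots> \<le> card (\<Union>r\<in>M. A r) + card I" by (rule card_Un_le)
      also have "\<dots> \<le> (\<Sum>r\<in>M. card (A r)) + card I" using card_UN_le[OF finKDM(3)] by simp
      finally show ?thesis .
    qed
    show "card Z1 \<le> (\<Sum>r\<in>M. card {s. gap s (W1 s) r = 0}) + card I" using c[OF Zsub(1)] two by blast
    show "card Z2 \<le> (\<Sum>r\<in>M. card {s. gap s (W2 s) r = 0}) + card I" using c[OF Zsub(2)] two by blast
  qed
  moreover have "(\<Sum>r\<in>M. card {s. gap s (W1 s) r = 0}) + (\<Sum>r\<in>M. card {s. gap s (W2 s) r = 0}) \<le> 2 * card M"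
  proof -
    have "(\<Sum>r\<in>M. card {s. gap s (W1 s) r = 0} + card {s. gap s (W2 s) r = 0}) \<le> (\<Sum>r\<in>M. 2)"
      using two by (intro sum_mono) blast
    then show ?thesis by (simp add: sum.distrib mult.commute)
  qed
  ultimately have cZ: "card Z1 + card Z2 \<le> 2 * (card M + card I)" by simp
  have gen: "\<kappa>1 P \<notin> Z1 \<and> \<kappa>2 P \<notin> Z2" if P: "P \<in> D" for P
  proof -
    have nM: "P \<noteq> r" if "r \<in> M" for r using that P by (auto simp: M_def D_def)
    have sl: "k = (snd P - snd r) / (fst P - fst r)" if "gap k w P = 0" "gap k w r = 0" "r \<in> M" for k w r
    proof -
      have eq: "snd P - snd r = k * (fst P - fst r)" using that by (simp add: gap_def algebra_simps)
      then have "fst P \<noteq> fst r" using nM[OF that(3)] by (auto simp: prod_eq_iff)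
      then show ?thesis using eq by simp
    qed
    have v1: "\<epsilon> = snd P - k * fst P - mx k" if "k = \<kappa>1 P" for k
      using g1(3)[OF P] that by (simp add: gap_def W1_def upper_env_def mx_def)
    have v2: "\<epsilon> = mn k - (snd P - k * fst P)" if "k = \<kappa>2 P" for k
      using g2(3)[OF P] that by (simp add: gap_def W2_def lower_env_def mn_def)
    have "\<kappa>1 P \<notin> I" "\<kappa>2 P \<notin> I" using E P v1[OF refl] v2[OF refl] by blast+
    moreover have "gap (\<kappa>1 P) (W1 (\<kappa>1 P)) r \<noteq> 0" if "r \<in> M" for r
      using sl[OF g1(3)[OF P] _ that] v1[OF refl] E P that by metis
    moreover have "gap (\<kappa>2 P) (W2 (\<kappa>2 P)) r \<noteq> 0" if "r \<in> M" for r
      using sl[OF g2(3)[OF P] _ that] v2[OF refl] E P that by metis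
    ultimately show ?thesis using Zsub by blast
  qed
  have gen1: "\<forall>P\<in>D. \<kappa>1 P \<notin> Z1" and gen2: "\<forall>P\<in>D. \<kappa>2 P \<notin> Z2" using gen by auto
  have between: "\<forall>R\<in>D. \<not> (\<kappa>1 P < \<kappa>1 R \<and> \<kappa>1 R < \<kappa>1 Q)" "\<forall>R\<in>D. \<not> (\<kappa>2 P < \<kappa>2 R \<and> \<kappa>2 R < \<kappa>2 Q)"
    if "P \<in> D" "Q \<in> D" "\<forall>R\<in>D. \<not> (xi P < xi R \<and> xi R < xi Q)" for P Q
  proof -
    have tri: "xi A < xi B" if "A \<in> D" "B \<in> D" "\<kappa>1 A < \<kappa>1 B \<or> \<kappa>2 A < \<kappa>2 B" for A B
      using mono[of B A] that inj by (cases "xi A" "xi B" rule: linorder_cases) (auto dest: inj_onD)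
    show "\<forall>R\<in>D. \<not> (\<kappa>1 P < \<kappa>1 R \<and> \<kappa>1 R < \<kappa>1 Q)" "\<forall>R\<in>D. \<not> (\<kappa>2 P < \<kappa>2 R \<and> \<kappa>2 R < \<kappa>2 Q)"
      using tri that by blast+
  qed
  obtain H where H: "H \<subseteq> D" "card D \<le> card H + 9"
    "\<And>P. P \<in> H \<Longrightarrow> \<exists>C\<in>arcs. P \<in> C \<and> (\<exists>P0\<in>D\<inter>C. \<exists>Q\<in>D\<inter>C. \<exists>P3\<in>D\<inter>C. xi P0 < xi P \<and> xi P < xi Q \<and> xi Q < xi P3 \<and>
        (\<forall>R\<in>D. \<not> (xi P < xi R \<and> xi R < xi Q)))"
    using inner_right[of D] finKDM(2) Don by blast
  have "card D + card H \<le> card Z1 + card Z2 + 1"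
  proof (rule two_chains_count[of D xi Z1 Z2 H \<kappa>1 \<kappa>2])
    fix P assume P: "P \<in> H"
    then obtain C P0 Q P3 where C: "C \<in> arcs" "P \<in> C" "P0 \<in> D \<inter> C" "Q \<in> D \<inter> C" "P3 \<in> D \<inter> C"
      "xi P0 < xi P" "xi P < xi Q" "xi Q < xi P3" and adj: "\<forall>R\<in>D. \<not> (xi P < xi R \<and> xi R < xi Q)"
      using H(3) by blast
    have PD: "P0 \<in> D" "P \<in> D" "Q \<in> D" "P3 \<in> D" using C P H(1) by auto
    have t: "turn P Q P0 * turn P Q P3 > 0" using turn_same_arc[OF C(1)] C by blast
    have m: "\<kappa>1 P0 < \<kappa>1 P" "\<kappa>1 P < \<kappa>1 Q" "\<kappa>1 Q < \<kappa>1 P3" "\<kappa>2 P0 < \<kappa>2 P" "\<kappa>2 P < \<kappa>2 Q" "\<kappa>2 Q < \<kappa>2 P3"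
      using mono PD C by blast+
    have "\<exists>z\<in>Z1. \<kappa>1 P < z \<and> z < \<kappa>1 Q"
      unfolding Z1_def
      by (rule chain_contact_between[OF ch1 PD(2,3) m(2) between(1)[OF PD(2,3) adj] gen1[unfolded Z1_def] PD(1,4) m(1,3) t])
    moreover have "\<exists>z\<in>Z2. \<kappa>2 P < z \<and> z < \<kappa>2 Q"
      unfolding Z2_def
      by (rule chain_contact_between[OF ch2 PD(2,3) m(5) between(2)[OF PD(2,3) adj] gen2[unfolded Z2_def] PD(1,4) m(4,6) t])
    ultimately show "\<exists>Q\<in>D. xi P < xi Q \<and> (\<forall>R\<in>D. \<not> (xi P < xi R \<and> xi R < xi Q)) \<and>
        (\<exists>z\<in>Z1. \<kappa>1 P < z \<and> z < \<kappa>1 Q) \<and> (\<exists>z\<in>Z2. \<kappa>2 P < z \<and> z < \<kappa>2 Q)"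
      using PD C adj by blast
  next
    fix P Q assume PQ: "P \<in> D" "Q \<in> D" "xi P < xi Q" and adj: "\<forall>R\<in>D. \<not> (xi P < xi R \<and> xi R < xi Q)"
    show "(\<exists>z\<in>Z1. \<kappa>1 P < z \<and> z < \<kappa>1 Q) \<or> (\<exists>z\<in>Z2. \<kappa>2 P < z \<and> z < \<kappa>2 Q)"
    proof (rule ccontr)
      assume "\<not> ?thesis"
      then have free: "Z1 \<inter> {\<kappa>1 P<..<\<kappa>1 Q} = {}" "Z2 \<inter> {\<kappa>2 P<..<\<kappa>2 Q} = {}" by auto
      have m: "\<kappa>1 P < \<kappa>1 Q" "\<kappa>2 P < \<kappa>2 Q" using mono PQ by blast+
      obtain \<sigma>1 where \<sigma>1: "\<sigma>1 \<in> {1, -1::real}" "\<forall>r\<in>S. 0 \<le> \<sigma>1 * gap (\<kappa>1 P) (W1 (\<kappa>1 P)) r * turn P Q r"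
        using chain_step[OF ch1 PQ(1,2) m(1) between(1)[OF PQ(1,2) adj]] gen1 PQ free(1) unfolding Z1_def by blast
      obtain \<sigma>2 where \<sigma>2: "\<sigma>2 \<in> {1, -1::real}" "\<forall>r\<in>S. 0 \<le> \<sigma>2 * gap (\<kappa>2 P) (W2 (\<kappa>2 P)) r * turn P Q r"
        using chain_step[OF ch2 PQ(1,2) m(2) between(2)[OF PQ(1,2) adj]] gen2 PQ free(2) unfolding Z2_def by blast
      define T1 T2 where "T1 = gap (\<kappa>1 P) (W1 (\<kappa>1 P))" and "T2 = gap (\<kappa>2 P) (W2 (\<kappa>2 P))"
      obtain k where k: "k \<in> K" using K by blast
      then have kS: "k \<in> S" by (auto simp: K_def)
      have "turn P Q k \<noteq> 0"
      proof
        assume "turn P Q k = 0"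
        then have "(snd P - snd k) * (fst Q - fst k) = (snd Q - snd k) * (fst P - fst k)"
          unfolding turn_def by (simp add: algebra_simps)
        moreover have "fst P - fst k > 0" "fst Q - fst k > 0" using KD[OF k] PQ by auto
        ultimately have "(snd P - snd k) / (fst P - fst k) = (snd Q - snd k) / (fst Q - fst k)"
          by (simp add: frac_eq_eq)
        then show False using slope_mono[OF Kon[OF k] Don[OF PQ(1)] Don[OF PQ(2)] PQ(3)] by simp
      qed
      moreover have "T1 k < 0" "T2 k > 0" using Kneg[OF k] by (auto simp: T1_def T2_def)
      moreover have "0 \<le> \<sigma>1 * T1 k * turn P Q k" "0 \<le> \<sigma>2 * T2 k * turn P Q k"
        using \<sigma>1(2) \<sigma>2(2) kS by (auto simp: T1_def T2_def)
      \<comment> \<open>A point of \<open>K\<close> lies between the two supporting lines, below the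
        one and above the other, and not on the line \<open>P Q\<close>. So the two signs
        differ.\<close>
      ultimately have opp: "\<sigma>1 * \<sigma>2 = -1"
        using \<sigma>1(1) \<sigma>2(1) by (auto simp: zero_le_mult_iff mult_le_0_iff)
      \<comment> \<open>A point of \<open>D\<close> other than \<open>P\<close> lies on the same
        side of both lines, since both have crossed the same points. With opposite signs this is
        possible only on the line \<open>P Q\<close>; so all of \<open>D\<close> would be
        collinear.\<close>
      have on_line: "turn P Q R = 0" if R: "R \<in> D" "R \<noteq> P" for R
      proof (rule ccontr)
        assume nz: "turn P Q R \<noteq> 0"
        have "xi R \<noteq> xi P" using inj R PQ(1) by (auto dest: inj_onD)
        then consider "xi P < xi R" | "xi R < xi P" by linarith
        then have pos: "T1 R * T2 R > 0"
        proof cases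
          case 1
          then have "T1 R > 0" "T2 R > 0" using g1(1)[OF R(1)] g2(1)[OF R(1)] mono[OF PQ(1) R(1)] by (auto simp: T1_def T2_def)
          then show ?thesis by simp
        next
          case 2
          then have "T1 R < 0" "T2 R < 0"
            using g1(2)[OF R(1)] g2(2)[OF R(1)] mono[OF R(1) PQ(1)] by (auto simp: T1_def T2_def)
          then show ?thesis by (simp add: mult_neg_neg)
        qed
        have "R \<in> S" using R DS by blast
        have "0 \<le> (\<sigma>1 * T1 R * turn P Q R) * (\<sigma>2 * T2 R * turn P Q R)"
          unfolding T1_def T2_def by (rule mult_nonneg_nonneg[OF bspec[OF \<sigma>1(2) \<open>R \<in> S\<close>] bspec[OF \<sigma>2(2) \<open>R \<in> S\<close>]])
        then have "0 \<le> (\<sigma>1 * \<sigma>2) * ((T1 R * T2 R) * (turn P Q R)^2)"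
          by (simp add: power2_eq_square mult_ac)
        moreover have "(T1 R * T2 R) * (turn P Q R)^2 > 0" using nz pos by simp
        ultimately show False unfolding opp by simp
      qed
      have PneQ: "P \<noteq> Q" using PQ(3) by auto
      have "card (D - {P, Q}) \<ge> card D - card {P, Q}" by (rule diff_card_le_card_Diff) simp
      moreover have "card {P, Q} = 2" using PneQ by simp
      ultimately have "card (D - {P, Q}) \<ge> 2" using False by simp
      then obtain R R' where R: "R \<in> D - {P, Q}" "R' \<in> D - {P, Q}" "R \<noteq> R'"
        by (metis card_le_Suc0_iff_eq finKDM(2) finite_Diff not_less_eq_eq numeral_2_eq_2)
      then show False
        using no_four_collinear[of P Q R R'] on_line PneQ Don PQ by blast
    qed
  qed (use finKDM(2) inj finZ H(1) mono in auto)
  then show ?thesis using H(2) cZ by simp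
qed simp

end

section \<open>Points before the largest root\<close>

text \<open>The affine form of \<open>double_neighbours_pencil\<close>: vertices on the line dual to
  \<open>o'\<close> are slopes of lines through \<open>o'\<close>, and the product conditions keep
  all other dual points out of the double angle between \<open>s1\<close> and \<open>s2\<close>. A
  dual point vertically above or below \<open>o'\<close> satisfies them automatically.\<close>

definition pencil_aff :: "(real \<times> real) set \<Rightarrow> real set \<Rightarrow> bool" where
  "pencil_aff S I \<longleftrightarrow> (\<forall>o'\<in>S. \<forall>p1\<in>S. \<forall>p2\<in>S. \<forall>s1 s2.
     fst p1 \<noteq> fst o' \<longrightarrow> fst p2 \<noteq> fst o' \<longrightarrow> s1 < s2 \<longrightarrow>
     snd p1 - snd o' = s1 * (fst p1 - fst o') \<longrightarrow> snd p2 - snd o' = s2 * (fst p2 - fst o') \<longrightarrow>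
     (\<forall>p\<in>S - {o', p1, p2}. (snd p - snd o' - s1 * (fst p - fst o')) * (snd p - snd o' - s2 * (fst p - fst o')) > 0) \<longrightarrow>
     (\<forall>\<mu>\<in>I. (\<mu> - s1) * (\<mu> - s2) > 0) \<longrightarrow>
     (\<forall>p\<in>S - {o'}. \<forall>p'\<in>S - {o'}. \<forall>p''\<in>S - {o'}. turn p p' p'' = 0))"

lemma pencil_affD:
  assumes "pencil_aff S I" "o' \<in> S" "p1 \<in> S" "p2 \<in> S" "fst p1 \<noteq> fst o'" "fst p2 \<noteq> fst o'" "s1 < s2"
    "snd p1 - snd o' = s1 * (fst p1 - fst o')" "snd p2 - snd o' = s2 * (fst p2 - fst o')"
    "\<And>p. p \<in> S - {o', p1, p2} \<Longrightarrow>
      (snd p - snd o' - s1 * (fst p - fst o')) * (snd p - snd o' - s2 * (fst p - fst o')) > 0"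
    "\<And>\<mu>. \<mu> \<in> I \<Longrightarrow> (\<mu> - s1) * (\<mu> - s2) > 0"
  shows "\<forall>p\<in>S - {o'}. \<forall>p'\<in>S - {o'}. \<forall>p''\<in>S - {o'}. turn p p' p'' = 0"
proof -
  from assms(1)[unfolded pencil_aff_def, THEN bspec, OF assms(2), THEN bspec, OF assms(3), THEN bspec, OF assms(4),
      THEN spec, THEN spec, THEN mp, OF assms(5), THEN mp, OF assms(6), THEN mp, OF assms(7), THEN mp, OF assms(8),
      THEN mp, OF assms(9)] assms(10,11)
  show ?thesis by blast
qed

lemma ex_three_distinct:
  assumes "3 \<le> card A"
  obtains a b c where "a \<in> A" "b \<in> A" "c \<in> A" "a \<noteq> b" "a \<noteq> c" "b \<noteq> c"
proof -
  obtain B where "B \<subseteq> A" "card B = 3" using obtain_subset_with_card_n[OF assms] by metis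
  then show thesis using that by (auto simp: card_3_iff)
qed

context wcubic
begin

text \<open>Fix \<open>o'\<close> in \<open>K\<close>. No three points of \<open>K\<close> are
  collinear, so different points of \<open>K\<close> not vertical to \<open>o'\<close> have
  different slopes. A slope not shared with \<open>D\<close>, \<open>M\<close> or \<open>I\<close>
  is a double point on the line dual to \<open>o'\<close>, and between two neighbouring ones lies a
  slope of \<open>N\<close>. So |G| \<le> |N| + 1, and at most two points of \<open>K\<close> are on
  the vertical through \<open>o'\<close>, itself included.\<close>

theorem left_card_le:
  assumes fin: "finite S" "finite I" and pc: "pencil_aff S I"
  defines "K \<equiv> {P\<in>S. oncurve P \<and> fst P < e}" and "D \<equiv> {P\<in>S. oncurve P \<and> e \<le> fst P}"
    and "M \<equiv> {P\<in>S. \<not> oncurve P}"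
  shows "card K \<le> 2 * (card D + card M + card I) + 3"
proof (cases "card K \<le> 3")
  case False
  have finKDM: "finite K" "finite D" "finite M" using fin by (auto simp: K_def D_def M_def)
  have Kon: "oncurve P" "fst P < e" "P \<in> S" if "P \<in> K" for P using that by (auto simp: K_def)
  have "K \<noteq> {}" using False by auto
  then obtain o' where o': "o' \<in> K" by blast
  define O' where "O' = {P\<in>K. fst P \<noteq> fst o'}"
  define slp where "slp P = (snd P - snd o') / (fst P - fst o')" for P :: "real \<times> real"
  have slp: "snd P - snd o' = slp P * (fst P - fst o')" if "fst P \<noteq> fst o'" for P
    using that by (simp add: slp_def)
  define X where "X = {P\<in>D \<union> M. fst P \<noteq> fst o'}"
  define N where "N = slp ` X \<union> I"
  define G where "G = slp ` O' - N"
  have finO: "finite O'" using finKDM(1) by (simp add: O'_def)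
  have finN: "finite N" "finite G" using finKDM fin finO by (simp_all add: N_def X_def G_def)
  have cN: "card N \<le> card D + card M + card I"
  proof -
    have "card N \<le> card (slp ` X) + card I" unfolding N_def by (rule card_Un_le)
    also have "card (slp ` X) \<le> card X" using finKDM by (intro card_image_le) (simp add: X_def)
    also have "card X \<le> card (D \<union> M)" using finKDM by (intro card_mono) (auto simp: X_def)
    also have "\<dots> \<le> card D + card M" by (rule card_Un_le)
    finally show ?thesis by simp
  qed
  have inj: "inj_on slp O'"
  proof (rule inj_onI, rule ccontr)
    fix P Q assume PQ: "P \<in> O'" "Q \<in> O'" "slp P = slp Q" "P \<noteq> Q"
    then have on: "P \<in> K" "Q \<in> K" "fst P \<noteq> fst o'" "fst Q \<noteq> fst o'" by (auto simp: O'_def)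
    have "turn o' P Q = 0" unfolding turn_def slp[OF on(3)] slp[OF on(4)] PQ(3) by (simp add: algebra_simps)
    moreover have "P \<noteq> o'" "Q \<noteq> o'" using on by auto
    ultimately show False
      using no_three_left[of o' P Q] Kon o' on PQ(4) by metis
  qed
  have vert: "card {P\<in>K. fst P = fst o'} \<le> 2"
  proof (rule ccontr)
    assume "\<not> ?thesis"
    then have "3 \<le> card {P\<in>K. fst P = fst o'}" by simp
    then obtain P Q R where "P \<in> {P\<in>K. fst P = fst o'}" "Q \<in> {P\<in>K. fst P = fst o'}" "R \<in> {P\<in>K. fst P = fst o'}"
      "P \<noteq> Q" "P \<noteq> R" "Q \<noteq> R" by (rule ex_three_distinct)
    then show False using vertical_oncurve[of P Q R] Kon by auto
  qed
  have "O' \<union> {P\<in>K. fst P = fst o'} = K" by (auto simp: O'_def)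
  then have cK: "card K \<le> card O' + 2"
    using card_Un_le[of O' "{P\<in>K. fst P = fst o'}"] vert by simp
  have "card (slp ` O') \<le> card (G \<union> N)" using finN by (intro card_mono) (auto simp: G_def)
  also have "\<dots> \<le> card G + card N" by (rule card_Un_le)
  finally have cO: "card O' \<le> card G + card N" using inj by (simp add: card_image)
  have key: "\<exists>z\<in>N. a < z \<and> z < b" if ab: "a \<in> G" "b \<in> G" "a < b" and adj: "\<forall>x\<in>G. \<not> (a < x \<and> x < b)" for a b
  proof (rule ccontr)
    assume no: "\<not> ?thesis"
    obtain p1 p2 where p: "p1 \<in> O'" "a = slp p1" "p2 \<in> O'" "b = slp p2" using ab by (auto simp: G_def)
    have ne: "fst p1 \<noteq> fst o'" "fst p2 \<noteq> fst o'" "p1 \<in> K" "p2 \<in> K" using p by (auto simp: O'_def)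
    have out: "(x - a) * (x - b) > 0" if "x \<noteq> a" "x \<noteq> b" "\<not> (a < x \<and> x < b)" for x
      using that \<open>a < b\<close> by (auto simp: zero_less_mult_iff)
    have abN: "a \<notin> N" "b \<notin> N" using ab by (auto simp: G_def)
    have pos: "(snd P - snd o' - a * (fst P - fst o')) * (snd P - snd o' - b * (fst P - fst o')) > 0"
      if P: "P \<in> S - {o', p1, p2}" for P
    proof (cases "fst P = fst o'")
      case True
      then have "snd P - snd o' \<noteq> 0" using P by (auto simp: prod_eq_iff)
      then show ?thesis using True by (auto simp: zero_less_mult_iff)
    next
      case False
      have "slp P \<noteq> a \<and> slp P \<noteq> b \<and> \<not> (a < slp P \<and> slp P < b)"
      proof (cases "P \<in> X")
        case True
        then have "slp P \<in> N" by (auto simp: N_def)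
        then show ?thesis using no abN by blast
      next
        case nX: False
        then have PO: "P \<in> O'" using False P by (auto simp: X_def O'_def D_def M_def K_def)
        have "slp P \<noteq> a" "slp P \<noteq> b" using inj_on_eq_iff[OF inj PO] p P by auto
        moreover have "slp P \<in> G \<or> slp P \<in> N" using PO by (auto simp: G_def)
        ultimately show ?thesis using adj no by blast
      qed
      then have "(slp P - a) * (slp P - b) > 0" using out by blast
      moreover have "(snd P - snd o' - a * (fst P - fst o')) * (snd P - snd o' - b * (fst P - fst o'))
          = (slp P - a) * (slp P - b) * (fst P - fst o')^2"
        unfolding slp[OF False] by (simp add: algebra_simps power2_eq_square)
      ultimately show ?thesis using False by simp
    qed
    have mu: "(\<mu> - a) * (\<mu> - b) > 0" if "\<mu> \<in> I" for \<mu>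
      using out[of \<mu>] no abN that by (auto simp: N_def)
    have oS: "o' \<in> S" "p1 \<in> S" "p2 \<in> S" using Kon o' ne by auto
    have sl1: "snd p1 - snd o' = a * (fst p1 - fst o')" "snd p2 - snd o' = b * (fst p2 - fst o')"
      using slp ne p by auto
    have col: "\<forall>p\<in>S - {o'}. \<forall>p'\<in>S - {o'}. \<forall>p''\<in>S - {o'}. turn p p' p'' = 0"
      by (rule pencil_affD[OF pc oS ne(1,2) ab(3) sl1 pos mu])
    \<comment> \<open>If two double points were neighbours, all points except \<open>o'\<close>
      would be collinear, against \<open>no_three_left\<close>.\<close>
    have "3 \<le> card (K - {o'})" using False o' finKDM by simp
    then obtain P Q R where PQR: "P \<in> K - {o'}" "Q \<in> K - {o'}" "R \<in> K - {o'}" "P \<noteq> Q" "P \<noteq> R" "Q \<noteq> R"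
      by (rule ex_three_distinct)
    have "P \<in> S - {o'}" "Q \<in> S - {o'}" "R \<in> S - {o'}" using PQR Kon by auto
    then have "turn P Q R = 0" using col by blast
    then show False
      using no_three_left[of P Q R] PQR Kon by blast
  qed
  have "card G \<le> card N + 1"
  proof (cases "G = {}")
    case False
    have "card (G - {Max G}) \<le> card N"
    proof (rule card_le_if_separated)
      fix a assume a: "a \<in> G - {Max G}"
      have "a < Max G" using a finN(2) by (simp add: order.not_eq_order_implies_strict)
      define Y where "Y = {x\<in>G. a < x}"
      have Y: "finite Y" "Y \<noteq> {}" using finN(2) Max_in[OF finN(2) False] \<open>a < Max G\<close> by (auto simp: Y_def)
      define b where "b = Min Y"
      have b: "b \<in> G" "a < b" using Min_in[OF Y] by (auto simp: b_def Y_def)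
      have bmin: "b \<le> x" if "x \<in> G" "a < x" for x unfolding b_def using Y(1) that by (simp add: Y_def)
      then have "\<forall>x\<in>G. \<not> (a < x \<and> x < b)" by (meson leD)
      then obtain z where "z \<in> N" "a < z" "z < b" using key[of a b] a b by blast
      then show "\<exists>z\<in>N. a < z \<and> (\<forall>b\<in>G - {Max G}. a < b \<longrightarrow> z < b)" using bmin by fastforce
    qed (use finN in auto)
    then show ?thesis using finN False by simp
  qed simp
  then have "card K \<le> card N + 1 + card N + 2" using cK cO by simp
  also have "\<dots> \<le> 2 * (card D + card M + card I) + 3" using cN by simp
  finally show ?thesis .
qed simp

theorem oncurve_card_le:
  assumes fin: "finite S" "finite I" and sm: "sides_meet_aff S I" and pc: "pencil_aff S I"
  shows "card {P\<in>S. oncurve P} + 1 \<le> 7 * (card {P\<in>S. \<not> oncurve P} + card I) + 21"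
proof -
  define m where "m = card {P\<in>S. \<not> oncurve P} + card I"
  define K where "K = {P\<in>S. oncurve P \<and> fst P < e}"
  define D where "D = {P\<in>S. oncurve P \<and> e \<le> fst P}"
  have KD: "{P\<in>S. oncurve P} = K \<union> D" by (auto simp: K_def D_def)
  have cKD: "card {P\<in>S. oncurve P} \<le> card K + card D" unfolding KD by (rule card_Un_le)
  show ?thesis
  \<comment> \<open>For small \<open>K\<close> the three arcs and a possible singular point bound
    \<open>D\<close> by 6 m + 10, with total 7 m + 20. For larger \<open>K\<close>, |D| \<le> m + 5
    and |K| \<le> 4 m + 13. The unit left over is reserved for the flex at infinity.\<close>
  proof (cases "card K \<le> m + 10")
    case True
    have ar: "arcA \<in> arcs" "arcP \<in> arcs" "arcM \<in> arcs" by (auto simp: arcs_def)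
    have "D \<subseteq> (S \<inter> arcA) \<union> ((S \<inter> arcP) \<union> ((S \<inter> arcM) \<union> {(e, 0)}))"
      using oncurve_right_cases by (auto simp: D_def)
    then have "card D \<le> card ((S \<inter> arcA) \<union> ((S \<inter> arcP) \<union> ((S \<inter> arcM) \<union> {(e, 0)})))"
      using fin by (intro card_mono) auto
    also have "\<dots> \<le> card (S \<inter> arcA) + (card (S \<inter> arcP) + (card (S \<inter> arcM) + card {(e, 0 :: real)}))"
      by (intro order_trans[OF card_Un_le] add_left_mono order_refl)
    finally have "card D \<le> 3 * (2 * m + 3) + 1"
      using arc_card_le_all[OF fin sm ar(1)] arc_card_le_all[OF fin sm ar(2)] arc_card_le_all[OF fin sm ar(3)]
      by (simp add: m_def)
    then show ?thesis using cKD True unfolding m_def[symmetric] by simp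
  next
    case False
    then have "K \<noteq> {}" by auto
    then have "card D \<le> m + 5" using right_card_le[OF fin sm] by (simp add: m_def K_def D_def)
    moreover have "card K \<le> 2 * (card D + m) + 3"
      using left_card_le[OF fin pc] by (simp add: m_def K_def D_def add.assoc)
    ultimately show ?thesis using cKD unfolding m_def[symmetric] by simp
  qed
qed

end

text \<open>The greatest point where the cubic is nonpositive is its largest root. At this root
  \<open>\<Psi>\<close> equals minus a square, and it tends to infinity, so it has a zero to the
  right.\<close>

lemma ex_wcubic: "\<exists>e x0. wcubic p q e x0"
proof -
  define F where "F x = x^3 + p * x + q" for x :: real
  have contF: "continuous_on A F" for A unfolding F_def by (intro continuous_intros)
  have top: "filterlim F at_top at_top" "filterlim F at_bot at_bot" unfolding F_def by real_asymp+
  obtain b where b: "\<And>x. b \<le> x \<Longrightarrow> F x > 0"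
    using filterlim_at_top_dense[THEN iffD1, OF top(1)] unfolding eventually_at_top_linorder by blast
  obtain a where a: "\<And>x. x \<le> a \<Longrightarrow> F x < 0"
    using filterlim_at_bot_dense[THEN iffD1, OF top(2)] unfolding eventually_at_bot_linorder by blast
  have "a \<le> b" using a[of b] b[of b] by (cases "a \<le> b") auto
  define Z where "Z = {x\<in>{a..b}. F x \<le> 0}"
  have "Z = {a..b} \<inter> {x. F x \<le> 0}" by (auto simp: Z_def)
  then have "compact Z"
    using closed_Collect_le[OF contF continuous_on_const, of 0] by (simp add: compact_Int_closed)
  moreover have "a \<in> Z" using a[of a] \<open>a \<le> b\<close> by (simp add: Z_def)
  ultimately obtain e where e: "e \<in> Z" "\<And>x. x \<in> Z \<Longrightarrow> x \<le> e"
    using compact_attains_sup[of Z] by blast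
  have pos: "F x > 0" if "e < x" for x
  proof (rule ccontr)
    assume "\<not> F x > 0"
    then have "x \<in> Z" using that e(1) b[of x] by (cases "x \<le> b") (auto simp: Z_def)
    then show False using e(2) that by force
  qed
  have "F e = 0"
  proof (rule ccontr)
    assume "F e \<noteq> 0"
    then have neg: "F e < 0" "e \<le> b" using e(1) by (auto simp: Z_def)
    then obtain x where "e \<le> x" "x \<le> b" "F x = 0"
      using IVT'[of F e 0 b] b[of b] contF by auto
    then show False using pos[of x] \<open>F e \<noteq> 0\<close> by (cases "x = e") auto
  qed
  define \<Psi> where "\<Psi> x = 12 * x * F x - (3 * x^2 + p)^2" for x
  have "\<Psi> e \<le> 0" by (simp add: \<Psi>_def \<open>F e = 0\<close>)
  have top\<Psi>: "filterlim \<Psi> at_top at_top" unfolding \<Psi>_def F_def by real_asymp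
  obtain c where c: "\<And>x. c \<le> x \<Longrightarrow> \<Psi> x > 0"
    using filterlim_at_top_dense[THEN iffD1, OF top\<Psi>] unfolding eventually_at_top_linorder by blast
  have "continuous_on A \<Psi>" for A unfolding \<Psi>_def by (intro continuous_intros contF)
  then obtain x0 where x0: "e \<le> x0" "\<Psi> x0 = 0"
    using IVT'[of \<Psi> e 0 "max c e"] c[of "max c e"] \<open>\<Psi> e \<le> 0\<close> by (auto simp: less_imp_le)
  have "wcubic p q e x0"
    unfolding wcubic_def using \<open>F e = 0\<close> pos x0 by (simp add: F_def \<Psi>_def)
  then show ?thesis by blast
qed

theorem weierstrass_card_le:
  fixes S :: "(real \<times> real) set" and p q :: real
  assumes "finite S" "finite I" "sides_meet_aff S I" "pencil_aff S I"
  defines "T \<equiv> {P\<in>S. (snd P)^2 = (fst P)^3 + p * fst P + q}"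
  shows "card T + 1 \<le> 7 * (card (S - T) + card I) + 21"
proof -
  obtain e x0 where "wcubic p q e x0" using ex_wcubic by blast
  note w = this
  have "T = {P\<in>S. wcubic.oncurve p q P}" "S - T = {P\<in>S. \<not> wcubic.oncurve p q P}"
    by (auto simp: T_def wcubic.oncurve_def[OF w])
  then show ?thesis using wcubic.oncurve_card_le[OF w assms(1-4)] by simp
qed

section \<open>Weierstrass form of real cubics\<close>

abbreviation vec3 :: "real \<Rightarrow> real \<Rightarrow> real \<Rightarrow> real^3" where
  "vec3 x y z \<equiv> vector [x, y, z]"

lemma vec3_eta: "vec3 (v $ 1) (v $ 2) (v $ 3) = v"
  by (simp add: vec_eq_iff forall_3 vector_3)

lemma inner_vec3: "a \<bullet> vec3 x y z = a $ 1 * x + a $ 2 * y + a $ 3 * z"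
  by (simp add: inner_vec_def sum_3 vector_3)

definition cubic_poly :: "real \<Rightarrow> real \<Rightarrow> real \<Rightarrow> real \<Rightarrow> real \<Rightarrow> real \<Rightarrow> real \<Rightarrow> real \<Rightarrow> real \<Rightarrow> real \<Rightarrow> real \<Rightarrow> real \<Rightarrow> real \<Rightarrow> real" where
  "cubic_poly a b c d e f g h i j x y z =
     a*x^3 + b*x^2*y + c*x*y^2 + d*y^3 + z*(e*x^2 + f*x*y + g*y^2) + z^2*(h*x + i*y) + j*z^3"

definition cubic_form :: "(real^3 \<Rightarrow> real) \<Rightarrow> bool" where
  "cubic_form \<phi> \<longleftrightarrow> (\<exists>a b c d e f g h i j. \<forall>x y z. \<phi> (vec3 x y z) = cubic_poly a b c d e f g h i j x y z)"

lemma cubic_form_add: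
  assumes "cubic_form \<phi>" "cubic_form \<psi>"
  shows "cubic_form (\<lambda>v. \<phi> v + \<psi> v)"
proof -
  obtain a b c d e f g h i j where 1: "\<And>x y z. \<phi> (vec3 x y z) = cubic_poly a b c d e f g h i j x y z"
    using assms(1) unfolding cubic_form_def by blast
  obtain a' b' c' d' e' f' g' h' i' j' where 2: "\<And>x y z. \<psi> (vec3 x y z) = cubic_poly a' b' c' d' e' f' g' h' i' j' x y z"
    using assms(2) unfolding cubic_form_def by blast
  have "\<forall>x y z. \<phi> (vec3 x y z) + \<psi> (vec3 x y z)
      = cubic_poly (a+a') (b+b') (c+c') (d+d') (e+e') (f+f') (g+g') (h+h') (i+i') (j+j') x y z"
    unfolding 1 2 cubic_poly_def by (simp add: algebra_simps)
  then show ?thesis unfolding cubic_form_def by blast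
qed

lemma cubic_form_prod:
  "cubic_form (\<lambda>v. k * ((a \<bullet> v) * (b \<bullet> v) * (c \<bullet> v)))"
proof -
  define a1 a2 a3 b1 b2 b3 c1 c2 c3 where "a1 = a $ 1" "a2 = a $ 2" "a3 = a $ 3" "b1 = b $ 1" "b2 = b $ 2" "b3 = b $ 3"
    "c1 = c $ 1" "c2 = c $ 2" "c3 = c $ 3"
  note defs = this
  have "\<forall>x y z. k * ((a \<bullet> vec3 x y z) * (b \<bullet> vec3 x y z) * (c \<bullet> vec3 x y z)) = cubic_poly
      (k*(a1*b1*c1)) (k*(a1*b1*c2+a1*b2*c1+a2*b1*c1)) (k*(a1*b2*c2+a2*b1*c2+a2*b2*c1)) (k*(a2*b2*c2))
      (k*(a1*b1*c3+a1*b3*c1+a3*b1*c1)) (k*(a1*b2*c3+a1*b3*c2+a2*b1*c3+a2*b3*c1+a3*b1*c2+a3*b2*c1)) (k*(a2*b2*c3+a2*b3*c2+a3*b2*c2))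
      (k*(a1*b3*c3+a3*b1*c3+a3*b3*c1)) (k*(a2*b3*c3+a3*b2*c3+a3*b3*c2)) (k*(a3*b3*c3)) x y z"
    unfolding inner_vec3 defs[symmetric] cubic_poly_def by (intro allI) algebra
  then show ?thesis unfolding cubic_form_def by blast
qed

lemma cubic_form_subst:
  assumes "cubic_form \<phi>"
  shows "cubic_form (\<lambda>v. \<phi> (N *v v))"
proof -
  obtain a b c d e f g h i j where \<phi>: "\<And>x y z. \<phi> (vec3 x y z) = cubic_poly a b c d e f g h i j x y z"
    using assms unfolding cubic_form_def by blast
  have comp: "(N *v v) $ k = N $ k \<bullet> v" for k v
    by (simp add: matrix_vector_mult_def inner_vec_def)
  let ?l = "\<lambda>k v. N $ k \<bullet> v"
  have "\<phi> (N *v v) = a*(?l 1 v * ?l 1 v * ?l 1 v) + b*(?l 1 v * ?l 1 v * ?l 2 v) + c*(?l 1 v * ?l 2 v * ?l 2 v) + d*(?l 2 v * ?l 2 v * ?l 2 v)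
      + e*(?l 1 v * ?l 1 v * ?l 3 v) + f*(?l 1 v * ?l 2 v * ?l 3 v) + g*(?l 2 v * ?l 2 v * ?l 3 v)
      + h*(?l 1 v * ?l 3 v * ?l 3 v) + i*(?l 2 v * ?l 3 v * ?l 3 v) + j*(?l 3 v * ?l 3 v * ?l 3 v)" for v
  proof -
    have "\<phi> (N *v v) = cubic_poly a b c d e f g h i j (?l 1 v) (?l 2 v) (?l 3 v)"
      using \<phi>[of "?l 1 v" "?l 2 v" "?l 3 v"] vec3_eta[of "N *v v"] by (simp add: comp)
    then show ?thesis by (simp add: cubic_poly_def algebra_simps power2_eq_square power3_eq_cube)
  qed
  then show ?thesis by (simp add: cubic_form_add cubic_form_prod)
qed

text \<open>The trace of irreducibility at the level of real functions; in this form it passes to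
  all linear changes of coordinates.\<close>

definition vanishes_on_no_line :: "(real^3 \<Rightarrow> real) \<Rightarrow> bool" where
  "vanishes_on_no_line \<phi> \<longleftrightarrow> (\<forall>a. a \<noteq> 0 \<longrightarrow> (\<exists>v. a \<bullet> v = 0 \<and> \<phi> v \<noteq> 0))"

lemma vanishes_on_no_line_subst:
  assumes "vanishes_on_no_line \<phi>" "invertible N"
  shows "vanishes_on_no_line (\<lambda>v. \<phi> (N *v v))"
  unfolding vanishes_on_no_line_def
proof (intro allI impI)
  fix a :: "real^3" assume a: "a \<noteq> 0"
  obtain N' where N': "N ** N' = mat 1" "N' ** N = mat 1" using assms(2) unfolding invertible_def by blast
  define b where "b = a v* N'"
  have "b v* N = a" by (simp add: b_def vector_matrix_mul_assoc N')
  then have "b \<noteq> 0" using a by auto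
  then obtain w where w: "b \<bullet> w = 0" "\<phi> w \<noteq> 0" using assms(1) unfolding vanishes_on_no_line_def by blast
  have "a \<bullet> (N' *v w) = 0" using w(1) by (simp add: b_def dot_lmul_matrix)
  moreover have "N *v (N' *v w) = w" by (simp add: matrix_vector_mul_assoc N')
  ultimately show "\<exists>v. a \<bullet> v = 0 \<and> \<phi> (N *v v) \<noteq> 0" using w(2) by metis
qed

definition weierstrass :: "(real^3 \<Rightarrow> real) \<Rightarrow> bool" where
  "weierstrass \<phi> \<longleftrightarrow> (\<exists>(N :: real^3^3) \<kappa> p q. invertible N \<and> \<kappa> \<noteq> 0 \<and>
     (\<forall>x y z. \<phi> (N *v vec3 x y z) = \<kappa> * (y^2 * z - x^3 - p*x*z^2 - q*z^3)))"

lemma weierstrass_subst: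
  fixes N :: "real^3^3"
  assumes "weierstrass (\<lambda>v. \<phi> (N *v v))" "invertible N"
  shows "weierstrass \<phi>"
proof -
  obtain M :: "real^3^3" and \<kappa> p q where M: "invertible M" "\<kappa> \<noteq> 0"
    "\<And>x y z. \<phi> (N *v (M *v vec3 x y z)) = \<kappa> * (y^2 * z - x^3 - p*x*z^2 - q*z^3)"
    using assms(1) unfolding weierstrass_def by blast
  have "\<forall>x y z. \<phi> ((N ** M) *v vec3 x y z) = \<kappa> * (y^2 * z - x^3 - p*x*z^2 - q*z^3)"
    using M(3) by (simp add: matrix_vector_mul_assoc)
  moreover have "invertible (N ** M)" using assms(2) M(1) by (rule invertible_mult)
  ultimately show ?thesis using M(2) unfolding weierstrass_def by blast
qed

abbreviation matrix3 :: "real \<Rightarrow> real \<Rightarrow> real \<Rightarrow> real \<Rightarrow> real \<Rightarrow> real \<Rightarrow> real \<Rightarrow> real \<Rightarrow> real \<Rightarrow> real^3^3" where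
  "matrix3 a b c d e f g h i \<equiv> vector [vec3 a b c, vec3 d e f, vec3 g h i]"

lemma matrix3_mult:
  "matrix3 a b c d e f g h i *v vec3 x y z = vec3 (a*x + b*y + c*z) (d*x + e*y + f*z) (g*x + h*y + i*z)"
  by (simp add: vec_eq_iff forall_3 vector_3 matrix_vector_mult_def sum_3)

lemma invertible_matrix3:
  assumes "a*(e*i - f*h) - b*(d*i - f*g) + c*(d*h - e*g) \<noteq> 0"
  shows "invertible (matrix3 a b c d e f g h i)"
proof -
  have "det (matrix3 a b c d e f g h i) = a*(e*i - f*h) - b*(d*i - f*g) + c*(d*h - e*g)"
    by (simp add: det_3 vector_3 algebra_simps)
  then show ?thesis using assms by (simp add: invertible_det_nz)
qed

definition admissible :: "(real^3 \<Rightarrow> real) \<Rightarrow> bool" where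
  "admissible \<phi> \<longleftrightarrow> cubic_form \<phi> \<and> vanishes_on_no_line \<phi>"

lemma admissible_subst: "admissible \<phi> \<Longrightarrow> invertible N \<Longrightarrow> admissible (\<lambda>v. \<phi> (N *v v))"
  unfolding admissible_def using cubic_form_subst vanishes_on_no_line_subst by blast

lemma weierstrass_transform:
  assumes "admissible \<phi>" and "a*(e*i - f*h) - b*(d*i - f*g) + c*(d*h - e*g) \<noteq> 0"
    and "\<And>\<psi>. admissible \<psi> \<Longrightarrow> (\<And>x y z. \<psi> (vec3 x y z) = \<phi> (vec3 (a*x + b*y + c*z) (d*x + e*y + f*z) (g*x + h*y + i*z)))
      \<Longrightarrow> weierstrass \<psi>"
  shows "weierstrass \<phi>"
proof (rule weierstrass_subst)
  show "invertible (matrix3 a b c d e f g h i)" using assms(2) by (rule invertible_matrix3)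
  then show "weierstrass (\<lambda>v. \<phi> (matrix3 a b c d e f g h i *v v))"
    using assms(1) by (intro assms(3) admissible_subst) (simp_all add: matrix3_mult)
qed

lemma not_vanishing:
  assumes "admissible \<phi>" "(a, b, c) \<noteq> (0, 0, 0)"
  obtains x y z where "a*x + b*y + c*z = 0" "\<phi> (vec3 x y z) \<noteq> 0"
proof -
  have "vec3 a b c \<noteq> 0" using assms(2) by (auto simp: vec_eq_iff forall_3 vector_3)
  then obtain v where "vec3 a b c \<bullet> v = 0" "\<phi> v \<noteq> 0"
    using assms(1) unfolding admissible_def vanishes_on_no_line_def by blast
  then show thesis using that[of "v $ 1" "v $ 2" "v $ 3"] vec3_eta[of v]
    by (simp add: inner_vec_def sum_3 vector_3)
qed

lemma real_cube_root: obtains r :: real where "r^3 = c"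
  using odd_real_root_pow[of 3 c] by auto

text \<open>A flex at \<open>[0:1:0]\<close> with tangent \<open>z = 0\<close>.\<close>

lemma weierstrass_flex:
  assumes adm: "admissible \<phi>" and \<phi>: "\<And>x y z. \<phi> (vec3 x y z) = cubic_poly l 0 0 0 a b c d e f x y z" and c: "c \<noteq> 0"
  shows "weierstrass \<phi>"
proof -
  obtain x y z where "z = 0" "\<phi> (vec3 x y z) \<noteq> 0" by (rule not_vanishing[OF adm, of 0 0 1]) auto
  then have l: "l \<noteq> 0" by (auto simp: \<phi> cubic_poly_def)
  \<comment> \<open>The line z = 0 is no component, so \<open>l\<close> is nonzero. A real cube root
    matches the coefficients of x^3 and y^2 z; \<open>\<beta>\<close> and \<open>\<epsilon>\<close>
    below complete the square in y, and \<open>t\<close> removes the term x^2 z.\<close>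
  obtain r where r: "r^3 = c / l" by (rule real_cube_root)
  then have r0: "r \<noteq> 0" using c l by auto
  have lr: "l * r^3 = c" using r l by simp
  define \<beta> \<epsilon> where "\<beta> = b / (2*c)" and "\<epsilon> = e / (2*c)"
  have \<beta>: "b = 2*c*\<beta>" "e = 2*c*\<epsilon>" using c by (auto simp: \<beta>_def \<epsilon>_def)
  define t where "t = (a - c*\<beta>^2) / (3*l)"
  have t: "a = 3*l*t + c*\<beta>^2" using l by (simp add: t_def)
  define p' q' where "p' = d - 2*c*\<beta>*\<epsilon> - 3*l*t^2" and "q' = f - c*\<epsilon>^2 - d*t + 2*c*\<beta>*\<epsilon>*t + 2*l*t^3"
  have p': "d = p' + 2*c*\<beta>*\<epsilon> + 3*l*t^2" by (simp add: p'_def)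
  have q': "f = q' + c*\<epsilon>^2 + d*t - 2*c*\<beta>*\<epsilon>*t - 2*l*t^3" by (simp add: q'_def)
  define N where "N = matrix3 (-r) 0 (-t) (\<beta>*r) 1 (\<beta>*t - \<epsilon>) 0 0 1"
  have "invertible N" unfolding N_def using r0 by (intro invertible_matrix3) simp
  moreover have "\<phi> (N *v vec3 x y z) = c * (y^2 * z - x^3 - (p'*r/c)*x*z^2 - (-q'/c)*z^3)" for x y z
  proof -
    have "\<phi> (N *v vec3 x y z) = c*y^2*z - (l*r^3)*x^3 - p'*r*x*z^2 + q'*z^3"
      unfolding N_def matrix3_mult \<phi> cubic_poly_def \<beta> t q' p' by algebra
    also have "\<dots> = c * (y^2 * z - x^3 - (p'*r/c)*x*z^2 - (-q'/c)*z^3)"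
      unfolding lr using c by (simp add: field_simps)
    finally show ?thesis .
  qed
  ultimately show ?thesis using c unfolding weierstrass_def by blast
qed

section \<open>Cubics with a real singular point\<close>

lemma complex_cube_root: obtains \<zeta> :: complex where "\<zeta>^3 = c"
proof
  show "rcis (root 3 (cmod c)) (Arg c / 3) ^ 3 = c"
    by (simp add: DeMoivre2 odd_real_root_pow rcis_cmod_Arg)
qed

lemma monic_cubic_root:
  fixes b c d :: real
  obtains u where "u^3 + b*u^2 + c*u + d = 0"
proof -
  define F where "F u = u^3 + b*u^2 + c*u + d" for u
  have top: "filterlim F at_top at_top" "filterlim F at_bot at_bot" unfolding F_def by real_asymp+
  obtain y where y: "\<And>x. y \<le> x \<Longrightarrow> F x > 0"
    using filterlim_at_top_dense[THEN iffD1, OF top(1)] unfolding eventually_at_top_linorder by blast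
  obtain x where x: "\<And>u. u \<le> x \<Longrightarrow> F u < 0"
    using filterlim_at_bot_dense[THEN iffD1, OF top(2)] unfolding eventually_at_bot_linorder by blast
  have "continuous_on {min x y..y} F" unfolding F_def by (intro continuous_intros)
  then obtain u where "F u = 0"
    using IVT'[of F "min x y" 0 y] x[of "min x y"] y[of y] by (auto simp: less_imp_le)
  then show thesis using that by (simp add: F_def)
qed

text \<open>The singular point is [0:0:1], with tangent cone x^2 - \<delta> y^2. Solving (\<beta> +
  \<alpha> t)^3 = c + b t with t^2 = \<delta> amounts to two real cube roots, one complex one or a
  cube root of dual numbers, according to the sign of \<delta>. Then \<phi> = (z - linear form in x
  and y) (x^2 - \<delta> y^2) + (\<alpha> x + \<beta> y)^3, which exhibits a flex and its
  tangent.\<close>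

lemma weierstrass_nodal_normal:
  assumes adm: "admissible \<phi>" and \<phi>: "\<And>x y z. \<phi> (vec3 x y z) = cubic_poly 0 0 b c 1 0 (-\<delta>) 0 0 0 x y z"
  shows "weierstrass \<phi>"
proof -
  obtain x1 y1 z1 where "z1 = 0" "\<phi> (vec3 x1 y1 z1) \<noteq> 0" by (rule not_vanishing[OF adm, of 0 0 1]) auto
  then have bc: "b \<noteq> 0 \<or> c \<noteq> 0" by (auto simp: \<phi> cubic_poly_def)
  \<comment> \<open>modulo \<open>x\<^sup>2 - \<delta> y\<^sup>2\<close> the binary cubic is the cube of a real linear form\<close>
  have "\<exists>\<alpha> \<beta>. \<alpha>^3*\<delta> + 3*\<alpha>*\<beta>^2 = b \<and> 3*\<alpha>^2*\<beta>*\<delta> + \<beta>^3 = c"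
  proof (cases \<delta> "0 :: real" rule: linorder_cases)
    case greater
    define r where "r = sqrt \<delta>"
    have r: "r \<noteq> 0" "\<delta> = r^2" using greater by (auto simp: r_def)
    obtain u where u: "u^3 = c + r*b" by (rule real_cube_root)
    obtain w where w: "w^3 = c - r*b" by (rule real_cube_root)
    define \<alpha> \<beta> where "\<alpha> = (u - w)/(2*r)" and "\<beta> = (u + w)/2"
    have uw: "u = \<beta> + r*\<alpha>" "w = \<beta> - r*\<alpha>" using r by (simp_all add: \<alpha>_def \<beta>_def field_simps)
    have "2 * r * (\<alpha>^3*\<delta> + 3*\<alpha>*\<beta>^2) = u^3 - w^3" unfolding uw r(2) by algebra
    also have "\<dots> = 2 * r * b" using u w by simp
    finally have "\<alpha>^3*\<delta> + 3*\<alpha>*\<beta>^2 = b" using r by simp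
    moreover have "2 * (3*\<alpha>^2*\<beta>*\<delta> + \<beta>^3) = u^3 + w^3" unfolding uw r(2) by algebra
    ultimately show ?thesis using u w by (intro exI[of _ \<alpha>] exI[of _ \<beta>]) simp
  next
    case less
    define r where "r = sqrt (-\<delta>)"
    have r: "r \<noteq> 0" "r^2 = -\<delta>" using less by (auto simp: r_def)
    obtain \<zeta> where \<zeta>: "\<zeta>^3 = Complex c (r*b)" by (rule complex_cube_root)
    define \<alpha> \<beta> where "\<alpha> = Im \<zeta> / r" and "\<beta> = Re \<zeta>"
    have im: "Im \<zeta> = r*\<alpha>" using r by (simp add: \<alpha>_def)
    have "\<beta>^3 - 3*\<beta>*(r*\<alpha>)^2 = c" "3*\<beta>^2*(r*\<alpha>) - (r*\<alpha>)^3 = r*b"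
      using arg_cong[OF \<zeta>, of Re] arg_cong[OF \<zeta>, of Im]
      by (simp_all add: power3_eq_cube power2_eq_square im flip: \<beta>_def) (simp_all add: algebra_simps)
    moreover have "3*\<beta>^2*(r*\<alpha>) - (r*\<alpha>)^3 = r*(\<alpha>^3*\<delta> + 3*\<alpha>*\<beta>^2)"
      "\<beta>^3 - 3*\<beta>*(r*\<alpha>)^2 = 3*\<alpha>^2*\<beta>*\<delta> + \<beta>^3"
      using r(2) by algebra+
    ultimately show ?thesis using r(1) by (intro exI[of _ \<alpha>] exI[of _ \<beta>]) simp
  next
    case equal
    obtain x2 y2 z2 where "x2 = 0" "\<phi> (vec3 x2 y2 z2) \<noteq> 0" by (rule not_vanishing[OF adm, of 1 0 0]) auto
    then have c: "c \<noteq> 0" using equal by (auto simp: \<phi> cubic_poly_def)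
    obtain \<beta> where \<beta>: "\<beta>^3 = c" by (rule real_cube_root)
    then have "\<beta> \<noteq> 0" using c by auto
    then show ?thesis using \<beta> equal by (intro exI[of _ "b / (3*\<beta>^2)"] exI[of _ \<beta>]) simp
  qed
  then obtain \<alpha> \<beta> where \<alpha>\<beta>: "b = \<alpha>^3*\<delta> + 3*\<alpha>*\<beta>^2" "c = 3*\<alpha>^2*\<beta>*\<delta> + \<beta>^3" by auto
  have \<alpha>\<beta>0: "\<alpha> \<noteq> 0 \<or> \<beta> \<noteq> 0" using bc unfolding \<alpha>\<beta> by auto
  then have n0: "\<alpha>^2 + \<beta>^2 \<noteq> 0" by (simp add: sum_power2_eq_zero_iff)
  have dec: "\<phi> (vec3 x y z) = (z - (\<alpha>^3*x + 3*\<alpha>^2*\<beta>*y)) * (x^2 - \<delta>*y^2) + (\<alpha>*x + \<beta>*y)^3" for x y z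
    unfolding \<phi> cubic_poly_def \<alpha>\<beta> by algebra
  define g where "g = \<beta>^2 - \<delta>*\<alpha>^2"
  \<comment> \<open>If \<open>g\<close> were 0, \<alpha> x + \<beta> y would divide the tangent cone
    and thus \<phi>, whose zero set would contain a line.\<close>
  have g: "g \<noteq> 0"
  proof
    assume "g = 0"
    obtain x y z where xyz: "\<alpha>*x + \<beta>*y = 0" "\<phi> (vec3 x y z) \<noteq> 0"
      by (rule not_vanishing[OF adm, of \<alpha> \<beta> 0]) (use \<alpha>\<beta>0 in auto)
    have "(\<alpha>^2 + \<beta>^2)^2 * (x^2 - \<delta>*y^2) = g * (\<beta>*x - \<alpha>*y)^2"
      using xyz(1) unfolding g_def by algebra
    then have "x^2 - \<delta>*y^2 = 0" using n0 \<open>g = 0\<close> by (auto simp del: sum_power2_eq_zero_iff)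
    then show False using xyz unfolding dec by simp
  qed
  define n where "n = \<alpha>^2 + \<beta>^2"
  show ?thesis
  proof (rule weierstrass_transform[OF adm, where a = \<alpha> and b = \<beta> and c = 0 and d = \<beta> and e = "-\<alpha>" and f = 0
        and g = "\<alpha>^3*\<alpha> + 3*\<alpha>^2*\<beta>*\<beta>" and h = "\<alpha>^3*\<beta> - 3*\<alpha>^2*\<beta>*\<alpha>" and i = 1])
    show "\<alpha> * (- \<alpha> * 1 - 0 * (\<alpha>^3*\<beta> - 3*\<alpha>^2*\<beta>*\<alpha>)) - \<beta> * (\<beta> * 1 - 0 * (\<alpha>^3*\<alpha> + 3*\<alpha>^2*\<beta>*\<beta>)) +
      0 * (\<beta> * (\<alpha>^3*\<beta> - 3*\<alpha>^2*\<beta>*\<alpha>) - - \<alpha> * (\<alpha>^3*\<alpha> + 3*\<alpha>^2*\<beta>*\<beta>)) \<noteq> 0" (is "?E \<noteq> 0")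
    proof -
      have "?E = - (\<alpha>^2 + \<beta>^2)" by (simp add: power2_eq_square)
      then show ?thesis using n0 by linarith
    qed
    fix \<psi> assume a: "admissible \<psi>" and \<psi>: "\<And>x y z. \<psi> (vec3 x y z) = \<phi> (vec3 (\<alpha>*x + \<beta>*y + 0*z) (\<beta>*x + -\<alpha>*y + 0*z)
       ((\<alpha>^3*\<alpha> + 3*\<alpha>^2*\<beta>*\<beta>)*x + (\<alpha>^3*\<beta> - 3*\<alpha>^2*\<beta>*\<alpha>)*y + 1*z))"
    have "\<psi> (vec3 x y z) = cubic_poly (n^3) 0 0 0 (\<alpha>^2 - \<delta>*\<beta>^2) (2*\<alpha>*\<beta>*(1 + \<delta>)) g 0 0 0 x y z" for x y z
      unfolding \<psi> dec cubic_poly_def n_def g_def by algebra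
    then show "weierstrass \<psi>" by (rule weierstrass_flex[OF a _ g])
  qed
qed

lemma weierstrass_singular_A:
  assumes adm: "admissible \<phi>" and \<phi>: "\<And>x y z. \<phi> (vec3 x y z) = cubic_poly a b c d A B C 0 0 0 x y z" and A: "A \<noteq> 0"
  shows "weierstrass \<phi>"
proof -
  define \<sigma> where "\<sigma> = B / (2*A)"
  have B: "B = 2*A*\<sigma>" using A by (simp add: \<sigma>_def)
  define \<delta> where "\<delta> = \<sigma>^2 - C/A"
  have C: "C = A*\<sigma>^2 - A*\<delta>" using A by (simp add: \<delta>_def field_simps)
  define k l where "k = a" and "l = b - 3*a*\<sigma>"
  \<comment> \<open>\<open>x \<mapsto> x - \<sigma> y\<close> completes the square, and the multiple \<open>k x + l y\<close> is absorbed in \<open>z\<close>\<close>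
  show ?thesis
  proof (rule weierstrass_transform[OF adm, where a = 1 and b = "-\<sigma>" and c = 0 and d = 0 and e = 1 and f = 0
        and g = "-k/A" and h = "-l/A" and i = "1/A"])
    fix \<psi> assume a: "admissible \<psi>" and *: "\<And>x y z. \<psi> (vec3 x y z) = \<phi> (vec3 (1*x + -\<sigma>*y + 0*z) (0*x + 1*y + 0*z)
       ((-k/A)*x + (-l/A)*y + (1/A)*z))"
    have "(-k/A)*x + (-l/A)*y + (1/A)*z = (z - k*x - l*y)/A" for x y z using A by (simp add: field_simps)
    then have \<psi>: "\<psi> (vec3 x y z) = \<phi> (vec3 (x - \<sigma>*y) y ((z - k*x - l*y)/A))" for x y z
      unfolding * by simp
    have "\<psi> (vec3 x y z) = cubic_poly 0 0 (c - 2*\<sigma>*b + 3*a*\<sigma>^2 + k*\<delta>) (d - \<sigma>*c + \<sigma>^2*b - a*\<sigma>^3 + l*\<delta>) 1 0 (-\<delta>) 0 0 0 x y z" for x y z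
    proof -
      have "z - k*x - l*y = A * ((z - k*x - l*y)/A)" using A by simp
      then show ?thesis unfolding \<psi> \<phi> cubic_poly_def B C k_def l_def by algebra
    qed
    then show "weierstrass \<psi>" by (rule weierstrass_nodal_normal[OF a])
  qed (use A in simp)
qed

lemma weierstrass_singular:
  assumes adm: "admissible \<phi>" and \<phi>: "\<And>x y z. \<phi> (vec3 x y z) = cubic_poly a b c d A B C 0 0 0 x y z"
  shows "weierstrass \<phi>"
proof -
  have C_case: "weierstrass \<phi>" if adm: "admissible \<phi>" and \<phi>: "\<And>x y z. \<phi> (vec3 x y z) = cubic_poly a b c d A B C 0 0 0 x y z" and C: "C \<noteq> 0"
    for \<phi> a b c d A B C
  proof (rule weierstrass_transform[OF adm, where a = 0 and b = 1 and c = 0 and d = 1 and e = 0 and f = 0 and g = 0 and h = 0 and i = 1])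
    fix \<psi> assume a: "admissible \<psi>" and \<psi>: "\<And>x y z. \<psi> (vec3 x y z) = \<phi> (vec3 (0*x + 1*y + 0*z) (1*x + 0*y + 0*z) (0*x + 0*y + 1*z))"
    have "\<psi> (vec3 x y z) = cubic_poly d c b a C B A 0 0 0 x y z" for x y z
      unfolding \<psi> \<phi> cubic_poly_def by algebra
    then show "weierstrass \<psi>" by (rule weierstrass_singular_A[OF a _ C])
  qed simp
  consider "A \<noteq> 0" | "C \<noteq> 0" | "A = 0" "B \<noteq> 0" "C = 0" | "A = 0" "B = 0" "C = 0" by blast
  then show ?thesis
  proof cases
    case 1
    then show ?thesis by (rule weierstrass_singular_A[OF adm \<phi>])
  next
    case 2
    then show ?thesis by (rule C_case[OF adm \<phi>])
  next
    case 3
    show ?thesis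
    proof (rule weierstrass_transform[OF adm, where a = 1 and b = 1 and c = 0 and d = 0 and e = 1 and f = 0 and g = 0 and h = 0 and i = 1])
      fix \<psi> assume a: "admissible \<psi>" and \<psi>: "\<And>x y z. \<psi> (vec3 x y z) = \<phi> (vec3 (1*x + 1*y + 0*z) (0*x + 1*y + 0*z) (0*x + 0*y + 1*z))"
      have "\<psi> (vec3 x y z) = cubic_poly a (3*a + b) (3*a + 2*b + c) (a + b + c + d) 0 B B 0 0 0 x y z" for x y z
        unfolding \<psi> \<phi> cubic_poly_def using 3 by algebra
      then show "weierstrass \<psi>" by (rule C_case[OF a _ \<open>B \<noteq> 0\<close>])
    qed simp
  next
    case 4
    \<comment> \<open>then \<open>\<phi>\<close> is a binary cubic, which has a real linear factor\<close>
    have "\<exists>u w. (u, w) \<noteq> (0, 0) \<and> a*u^3 + b*u^2*w + c*u*w^2 + d*w^3 = 0"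
    proof (cases "a = 0")
      case True
      then show ?thesis by (intro exI[of _ 1] exI[of _ 0]) simp
    next
      case False
      obtain u where u: "u^3 + (b/a)*u^2 + (c/a)*u + d/a = 0" by (rule monic_cubic_root)
      have "a*u^3 + b*u^2*1 + c*u*1^2 + d*1^3 = a * (u^3 + (b/a)*u^2 + (c/a)*u + d/a)"
        using False by (simp add: field_simps)
      then show ?thesis unfolding u by (intro exI[of _ u] exI[of _ 1]) simp
    qed
    then obtain u w where uv: "(u, w) \<noteq> (0, 0)" "a*u^3 + b*u^2*w + c*u*w^2 + d*w^3 = 0" by blast
    obtain x y z where xyz: "w*x + -u*y + 0*z = 0" "\<phi> (vec3 x y z) \<noteq> 0"
      by (rule not_vanishing[OF adm, of w "-u" 0]) (use uv in auto)
    have "u^3 * \<phi> (vec3 x y z) = 0" "w^3 * \<phi> (vec3 x y z) = 0"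
      unfolding \<phi> cubic_poly_def using uv(2) xyz(1) 4 by algebra+
    then show ?thesis using uv(1) xyz(2) by auto
  qed
qed

section \<open>Cubics with exactly one real point on some line\<close>

lemma disc_neg_factor:
  fixes a b c d :: real
  assumes disc: "18*a*b*c*d - 4*b^3*d + b^2*c^2 - 4*a*c^3 - 27*a^2*d^2 < 0"
  obtains r s u m w where "(r, s) \<noteq> (0, 0)" "m^2 < 4*u*w"
    "\<And>x z. a*x^3 + b*x^2*z + c*x*z^2 + d*z^3 = (r*x + s*z) * (u*x^2 + m*x*z + w*z^2)"
proof (cases "a = 0")
  case True
  have "b^2 * (c^2 - 4*b*d) < 0" using disc True by (simp add: power2_eq_square power3_eq_cube algebra_simps)
  then have "c^2 < 4*b*d" by (simp add: mult_less_0_iff)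
  moreover have "a*x^3 + b*x^2*z + c*x*z^2 + d*z^3 = (0*x + 1*z) * (b*x^2 + c*x*z + d*z^2)" for x z
    using True by algebra
  ultimately show thesis by (intro that[of 0 1 c b d]) auto
next
  case False
  obtain t where "t^3 + (b/a)*t^2 + (c/a)*t + d/a = 0" by (rule monic_cubic_root)
  moreover have "a*t^3 + b*t^2 + c*t + d = a * (t^3 + (b/a)*t^2 + (c/a)*t + d/a)"
    using False by (simp add: field_simps)
  ultimately have t: "d = -(a*t^3 + b*t^2 + c*t)" by simp
  define m w where "m = b + a*t" and "w = c + m*t"
  have fac: "a*x^3 + b*x^2*z + c*x*z^2 + d*z^3 = (1*x + -t*z) * (a*x^2 + m*x*z + w*z^2)" for x z
    unfolding t m_def w_def by algebra
  \<comment> \<open>The discriminant of a product is the discriminant of the quadratic factor times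
    the square of its value at the root of the linear factor.\<close>
  have "18*a*b*c*d - 4*b^3*d + b^2*c^2 - 4*a*c^3 - 27*a^2*d^2 = (m^2 - 4*a*w) * (a*t^2 + m*t + w)^2"
    unfolding t m_def w_def by algebra
  then have "m^2 < 4*a*w" using disc by (simp add: mult_less_0_iff)
  then show thesis using fac by (intro that[of 1 "-t" m a w]) auto
qed

lemma first_zero:
  fixes h :: "real \<Rightarrow> real"
  assumes "continuous_on UNIV h" "h 0 > 0" "0 < B" "h B < 0"
  obtains a where "a > 0" "h a = 0" "\<And>x. 0 \<le> x \<Longrightarrow> x < a \<Longrightarrow> h x > 0"
proof -
  define Z where "Z = {0..B} \<inter> {x. h x \<le> 0}"
  have "compact Z" unfolding Z_def
    using closed_Collect_le[OF assms(1) continuous_on_const, of 0] by (simp add: compact_Int_closed)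
  moreover have "B \<in> Z" using assms by (simp add: Z_def)
  ultimately obtain a where a: "a \<in> Z" "\<And>x. x \<in> Z \<Longrightarrow> a \<le> x" using compact_attains_inf[of Z] by blast
  have pos: "h x > 0" if "0 \<le> x" "x < a" for x
  proof (rule ccontr)
    assume "\<not> h x > 0"
    then have "x \<in> Z" using that a(1) by (auto simp: Z_def)
    then show False using a(2)[of x] that by simp
  qed
  have "a > 0" using a(1) assms(2) by (cases "a = 0") (auto simp: Z_def)
  have "h a = 0"
  proof (rule ccontr)
    assume "h a \<noteq> 0"
    then have "h a < 0" using a(1) by (simp add: Z_def)
    then obtain x where "0 \<le> x" "x \<le> a" "h x = 0"
      using IVT2'[of h a 0 0] assms(2) \<open>a > 0\<close> continuous_on_subset[OF assms(1)] by (auto simp: less_imp_le)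
    then show False using pos[of x] \<open>h a \<noteq> 0\<close> by (cases "x = a") auto
  qed
  then show thesis using that \<open>a > 0\<close> pos by blast
qed

text \<open>The branch \<open>y = -d / (b + sqrt (b\<^sup>2 - x d))\<close> of the cubic \<open>x y\<^sup>2 + 2 b y + d = 0\<close> through the axis \<open>x = 0\<close>
  closes up at the zeros of \<open>b\<^sup>2 - x d\<close>. Its slope tends to \<open>-\<infinity>\<close> at both ends, unless one of them is singular;
  hence the slope has an interior maximum, which is a flex.\<close>

lemma singular_or_flex:
  fixes b d3 d2 d1 d0 :: real
  assumes b: "b > 0" and d3: "d3 > 0"
  defines "d x \<equiv> d3*x^3 + d2*x^2 + d1*x + d0" and "d' x \<equiv> 3*d3*x^2 + 2*d2*x + d1"
  obtains (singular) c y where "c*y^2 + 2*b*y + d c = 0" "c*y + b = 0" "y^2 + d' c = 0"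
    | (flex) c y y' where "c*y^2 + 2*b*y + d c = 0" "y^2 + 2*(c*y + b)*y' + d' c = 0"
        "4*y*y' + 2*c*y'^2 + 6*d3*c + 2*d2 = 0" "c*y + b \<noteq> 0"
proof -
  define D where "D x = b^2 - x * d x" for x
  have D_at: "D x = b^2 - x * (d3*x^3 + d2*x^2 + d1*x + d0)" for x by (simp add: D_def d_def)
  have contD: "continuous_on X D" "continuous_on X d" "continuous_on X d'" for X
    unfolding D_at[abs_def] d_def[abs_def] d'_def[abs_def] by (intro continuous_intros)+
  have DD: "(D has_real_derivative - d x - x * d' x) (at x)" for x
    unfolding D_at[abs_def] d_def d'_def
    by (auto intro!: derivative_eq_intros simp: algebra_simps power2_eq_square power3_eq_cube)
  have Dd: "(d has_real_derivative d' x) (at x)" for x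
    unfolding d_def[abs_def] d'_def by (auto intro!: derivative_eq_intros)
  have Dd': "(d' has_real_derivative 6*d3*x + 2*d2) (at x)" for x
    unfolding d'_def[abs_def] by (auto intro!: derivative_eq_intros)
  have "D 0 > 0" using b by (simp add: D_def)
  have lim: "filterlim D at_bot at_top" "filterlim D at_bot at_bot"
    unfolding D_at[abs_def] using d3 by real_asymp+
  have "\<forall>\<^sub>F x in at_top. D x < 0 \<and> x > 0" "\<forall>\<^sub>F x in at_bot. D x < 0 \<and> x < 0"
    using lim unfolding filterlim_at_bot_dense by (auto intro!: eventually_conj eventually_gt_at_top eventually_gt_at_bot)
  then obtain B1 B2 where B: "D B2 < 0" "B2 > 0" "D B1 < 0" "B1 < 0"
    using eventually_happens'[OF trivial_limit_at_top_linorder] eventually_happens'[OF trivial_limit_at_bot_linorder] by blast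
  obtain a2 where a2: "a2 > 0" "D a2 = 0" "\<And>x. 0 \<le> x \<Longrightarrow> x < a2 \<Longrightarrow> D x > 0"
    using first_zero[OF contD(1) \<open>D 0 > 0\<close> B(2,1)] by blast
  have "continuous_on UNIV (\<lambda>x. D (- x))" by (rule continuous_on_compose2[OF contD(1)[of UNIV]]) (auto intro: continuous_intros)
  then obtain a1' where a1': "a1' > 0" "D (- a1') = 0" "\<And>x. 0 \<le> x \<Longrightarrow> x < a1' \<Longrightarrow> D (- x) > 0"
    using first_zero[of "\<lambda>x. D (- x)" "- B1"] \<open>D 0 > 0\<close> B(3,4) by auto
  define a1 where "a1 = - a1'"
  have a1: "a1 < 0" "D a1 = 0" using a1' by (auto simp: a1_def)
  have Dpos: "D x > 0" if "a1 < x" "x < a2" for x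
    using a2(3)[of x] a1'(3)[of "- x"] that by (cases "0 \<le> x") (auto simp: a1_def)
  have Dnn: "D x \<ge> 0" if "a1 \<le> x" "x \<le> a2" for x
    using Dpos[of x] a1(2) a2(2) that by (cases "x = a1 \<or> x = a2") (auto simp: less_imp_le)
  define R where "R x = sqrt (D x)" for x
  define Y where "Y x = - d x / (b + R x)" for x
  define N where "N x = (Y x)^2 + d' x" for x
  define Y1 where "Y1 x = - N x / (2 * R x)" for x
  have R: "R x \<ge> 0" "(R x)^2 = D x" if "a1 \<le> x" "x \<le> a2" for x using Dnn[OF that] by (auto simp: R_def)
  have bR: "b + R x > 0" if "a1 \<le> x" "x \<le> a2" for x using R(1)[OF that] b by simp
  have xY: "x * Y x + b = R x" if "a1 \<le> x" "x \<le> a2" for x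
  proof -
    have "(x * Y x + b) * (b + R x) = - x * d x + b * (b + R x)"
      using bR[OF that] by (simp add: Y_def field_simps)
    also have "\<dots> = R x * (b + R x)" using R(2)[OF that] by (simp add: D_def algebra_simps power2_eq_square)
    finally show ?thesis using bR[OF that] by simp
  qed
  have onc: "x * (Y x)^2 + 2*b*Y x + d x = 0" if "a1 \<le> x" "x \<le> a2" for x
  proof -
    have "Y x * (b + R x) + d x = 0" using bR[OF that] by (simp add: Y_def)
    then show ?thesis unfolding xY[OF that, symmetric] by (simp add: algebra_simps power2_eq_square)
  qed
  \<comment> \<open>The derivative of \<open>D\<close> at an end \<open>a\<close> is
    \<open>- a * N a\<close>, and \<open>D\<close> is nonnegative between the ends; so
    \<open>N a\<close> is nonnegative. If it is 0, the end is a singular point. Otherwise the slope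
    -N / (2 R) tends to minus infinity there.\<close>
  have ends: "thesis \<or> N a > 0" if a: "a = a1 \<or> a = a2" for a
  proof -
    have ran: "a1 \<le> a" "a \<le> a2" "a \<noteq> 0" "R a = 0" using a a1 a2 by (auto simp: R_def)
    have Y: "a * Y a = - b" using xY[OF ran(1,2)] ran(4) by simp
    have "D a = 0" using a a1 a2 by auto
    then have "a * d a = b^2" by (simp add: D_def)
    then have "a * d a = (a * Y a)^2" unfolding Y by simp
    then have "a * d a = a * (a * (Y a)^2)" by (simp add: power2_eq_square algebra_simps)
    then have "d a = a * (Y a)^2" using ran(3) by simp
    then have "- d a - a * d' a = - a * N a" by (simp add: N_def algebra_simps)
    then have der: "(D has_real_derivative - a * N a) (at a)" using DD[of a] by simp
    have "N a \<ge> 0"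
    proof (rule ccontr)
      assume neg: "\<not> N a \<ge> 0"
      show False
      proof (cases "a = a1")
        case True
        then have "- a * N a < 0" using neg a1 True by (simp add: zero_less_mult_iff not_le)
        from DERIV_neg_dec_right[OF der this] obtain e where e: "e > 0" "\<And>h. 0 < h \<Longrightarrow> h < e \<Longrightarrow> D (a + h) < D a" by blast
        define h where "h = min (e/2) (- a1)"
        have "0 < h" "h < e" "a + h \<le> 0" using e(1) a1 True by (auto simp: h_def min_def)
        then show False using e(2)[of h] Dnn[of "a + h"] True a1 a2 by auto
      next
        case False
        then have "a = a2" using a by simp
        then have "- a * N a > 0" using neg a2 \<open>a = a2\<close> by (simp add: mult_less_0_iff not_le)
        from DERIV_pos_inc_left[OF der this] obtain e where e: "e > 0" "\<And>h. 0 < h \<Longrightarrow> h < e \<Longrightarrow> D (a - h) < D a" by blast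
        define h where "h = min (e/2) a2"
        have "0 < h" "h < e" "a - h \<ge> 0" using e(1) a2 \<open>a = a2\<close> by (auto simp: h_def min_def)
        then show False using e(2)[of h] Dnn[of "a - h"] \<open>a = a2\<close> a1 a2 by auto
      qed
    qed
    moreover have thesis if "N a = 0"
      using singular[of a "Y a"] onc[OF ran(1,2)] xY[OF ran(1,2)] ran(4) that by (simp add: N_def)
    ultimately show ?thesis by (auto simp: less_le)
  qed
  show thesis
  proof (cases "N a1 > 0 \<and> N a2 > 0")
    case False
    then show thesis using ends by blast
  next
    case True
    \<comment> \<open>\<open>J x \<le> 0\<close> says that the slope at x is at least its value at
      0. Written without division it makes sense at the ends, where it fails; so this set is compact
      in the open interval and the slope attains its maximum.\<close>
    define m0 where "m0 = Y1 0"
    define J where "J x = N x + 2 * m0 * R x" for x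
    have contR: "continuous_on {a1..a2} R" unfolding R_def[abs_def] by (intro continuous_intros contD)
    have contY: "continuous_on {a1..a2} Y" unfolding Y_def[abs_def]
      by (intro continuous_intros contD contR) (use bR in force)
    have contN: "continuous_on {a1..a2} N" unfolding N_def[abs_def] by (intro continuous_intros contD contY)
    have contJ: "continuous_on {a1..a2} J" unfolding J_def[abs_def] by (intro continuous_intros contN contR)
    define K where "K = {x\<in>{a1..a2}. J x \<le> 0}"
    have "closed K" unfolding K_def by (rule continuous_on_closed_Collect_le[OF contJ]) (auto intro: continuous_intros)
    then have "compact K" using compact_Int_closed[of "{a1..a2}" K] by (simp add: K_def Int_def conj_commute cong: conj_cong)
    have R0: "R 0 > 0" using b by (simp add: R_def D_def)
    have "J 0 = 0" using R0 by (simp add: J_def m0_def Y1_def)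
    then have "0 \<in> K" using a1 a2 by (simp add: K_def)
    have "a1 \<notin> K" "a2 \<notin> K" using True a1 a2 by (auto simp: K_def J_def R_def)
    then have Kin: "a1 < x \<and> x < a2" if "x \<in> K" for x using that by (cases "x = a1 \<or> x = a2") (auto simp: K_def)
    have Rpos: "R x > 0" if "a1 < x" "x < a2" for x using Dpos[OF that] by (simp add: R_def)
    have contY1: "continuous_on K Y1" unfolding Y1_def[abs_def]
      by (intro continuous_intros continuous_on_subset[OF contN] continuous_on_subset[OF contR])
        (use Kin Rpos in \<open>force simp: K_def\<close>)+
    obtain c where c: "c \<in> K" "\<And>x. x \<in> K \<Longrightarrow> Y1 x \<le> Y1 c"
      using continuous_attains_sup[OF \<open>compact K\<close> _ contY1] \<open>0 \<in> K\<close> by blast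
    have cin: "a1 < c" "c < a2" using Kin c(1) by auto
    have max: "Y1 x \<le> Y1 c" if x: "a1 < x" "x < a2" for x
    proof (cases "x \<in> K")
      case False
      then have "J x > 0" using x by (simp add: K_def)
      then have "Y1 x < m0" using Rpos[OF x] by (simp add: J_def Y1_def field_simps)
      also have "m0 \<le> Y1 c" using c(2) \<open>0 \<in> K\<close> by (simp add: m0_def)
      finally show ?thesis by simp
    qed (rule c(2))
    have DR: "(R has_real_derivative (- d x - x * d' x) / (2 * R x)) (at x)" if "a1 < x" "x < a2" for x
      unfolding R_def[abs_def] using Dpos[OF that] DD[of x]
      by (auto intro!: derivative_eq_intros simp: field_simps)
    have DY: "(Y has_real_derivative Y1 x) (at x)" if x: "a1 < x" "x < a2" for x
    proof -
      have ne: "b + R x \<noteq> 0" "R x \<noteq> 0" using bR[of x] Rpos[OF x] x by auto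
      have "(Y has_real_derivative (- d' x * (b + R x) - (- d x) * ((- d x - x * d' x) / (2 * R x))) / ((b + R x) * (b + R x))) (at x)"
        unfolding Y_def[abs_def]
        by (rule DERIV_cong[OF DERIV_divide[OF DERIV_minus[OF Dd] DERIV_add[OF DERIV_const DR[OF x]] ne(1)]]) simp
      moreover have "(- d' x * (b + R x) - (- d x) * ((- d x - x * d' x) / (2 * R x))) / ((b + R x) * (b + R x)) = Y1 x"
      proof -
        have "(R x)^2 = b^2 - x * d x" using R(2)[of x] x by (simp add: D_def)
        then have "- d' x * (b + R x) * (2 * R x) - d x * (d x + x * d' x) = - ((d x)^2) - d' x * (b + R x)^2" by algebra
        moreover have "(- d' x * (b + R x) - (- d x) * ((- d x - x * d' x) / (2 * R x))) / ((b + R x) * (b + R x))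
            = (- d' x * (b + R x) * (2 * R x) - d x * (d x + x * d' x)) / ((2 * R x) * (b + R x)^2)"
          using ne by (simp add: field_simps power2_eq_square)
        moreover have "(- ((d x)^2) - d' x * (b + R x)^2) / ((2 * R x) * (b + R x)^2) = Y1 x"
          using ne by (simp add: Y1_def N_def Y_def field_simps)
        ultimately show ?thesis by simp
      qed
      ultimately show ?thesis by simp
    qed
    have DN: "(N has_real_derivative 2 * Y x * Y1 x + (6*d3*x + 2*d2)) (at x)" if "a1 < x" "x < a2" for x
      unfolding N_def[abs_def] by (auto intro!: derivative_eq_intros DY[OF that] Dd')
    have Rc: "R c \<noteq> 0" using Rpos[OF cin] by simp
    have "\<exists>\<Delta>. (Y1 has_real_derivative \<Delta>) (at c)"
      unfolding Y1_def[abs_def]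
      by (rule exI, rule DERIV_divide[OF DERIV_minus[OF DN[OF cin]] DERIV_cmult[OF DR[OF cin]]]) (use Rc in simp)
    then obtain \<Delta> where \<Delta>: "(Y1 has_real_derivative \<Delta>) (at c)" by blast
    have "\<Delta> = 0"
    proof (rule DERIV_local_max[OF \<Delta>])
      show "0 < min (c - a1) (a2 - c)" using cin by simp
      show "\<forall>y. \<bar>c - y\<bar> < min (c - a1) (a2 - c) \<longrightarrow> Y1 y \<le> Y1 c" using max by auto
    qed
    \<comment> \<open>The equation of the curve, differentiated once along the branch. Another
      derivative, at the point where the slope is stationary, yields the condition for a
      flex.\<close>
    define H where "H x = N x + 2 * (x * Y x + b) * Y1 x" for x
    have H0: "H x = 0" if "a1 < x" "x < a2" for x
      using xY[of x] Rpos[OF that] that by (simp add: H_def Y1_def)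
    have "(H has_real_derivative 2 * Y c * Y1 c + (6*d3*c + 2*d2) + 2 * (Y c + c * Y1 c) * Y1 c) (at c)"
      unfolding H_def[abs_def]
      by (auto intro!: derivative_eq_intros DN[OF cin] DY[OF cin] \<Delta>[unfolded \<open>\<Delta> = 0\<close>] simp: algebra_simps)
    moreover have "(H has_real_derivative 0) (at c)"
      by (rule has_field_derivative_transform_within_open[of "\<lambda>_. 0" 0 c "{a1<..<a2}"]) (use cin H0 in auto)
    ultimately have "2 * Y c * Y1 c + (6*d3*c + 2*d2) + 2 * (Y c + c * Y1 c) * Y1 c = 0" by (rule DERIV_unique)
    then have "4*Y c*Y1 c + 2*c*(Y1 c)^2 + 6*d3*c + 2*d2 = 0" by (simp add: algebra_simps power2_eq_square)
    moreover have "(Y c)^2 + 2*(c*Y c + b)*Y1 c + d' c = 0" using H0[OF cin] by (simp add: H_def N_def algebra_simps)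
    ultimately show thesis
      using flex[of c "Y c" "Y1 c"] onc[of c] xY[of c] cin Rc by simp
  qed
qed

text \<open>For z = 1 the cubic is x y^2 + 2 b y + d(x). If b = 0, the asymptote x = 0 meets it
  three times at [0:1:0], which is a flex. A change of sign of y reduces b < 0 to b > 0, where
  \<open>singular_or_flex\<close> supplies the point that is moved to the standard position.\<close>

lemma weierstrass_definite_normal:
  assumes adm: "admissible \<phi>" and \<phi>: "\<And>x y z. \<phi> (vec3 x y z) = cubic_poly d3 0 1 0 d2 0 0 d1 (2*b) d0 x y z" and d3: "d3 > 0"
  shows "weierstrass \<phi>"
proof -
  have pos: "weierstrass \<phi>"
    if adm: "admissible \<phi>" and \<phi>: "\<And>x y z. \<phi> (vec3 x y z) = cubic_poly d3 0 1 0 d2 0 0 d1 (2*b) d0 x y z" and b: "b > 0" for \<phi> b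
    using b d3
  proof (cases rule: singular_or_flex[of b d3 d2 d1 d0])
    case (singular c t)
    show ?thesis
    proof (rule weierstrass_transform[OF adm, where a = 1 and b = 0 and c = c and d = 0 and e = 1 and f = t and g = 0 and h = 0 and i = 1])
      fix \<psi> assume a: "admissible \<psi>" and \<psi>: "\<And>x y z. \<psi> (vec3 x y z) = \<phi> (vec3 (1*x + 0*y + c*z) (0*x + 1*y + t*z) (0*x + 0*y + 1*z))"
      have "\<psi> (vec3 x y z) = cubic_poly d3 0 1 0 (3*c*d3 + d2) (2*t) c 0 0 0 x y z" for x y z
        unfolding \<psi> \<phi> cubic_poly_def using singular by algebra
      then show "weierstrass \<psi>" by (rule weierstrass_singular[OF a])
    qed simp
  next
    case (flex c t t')
    show ?thesis
    proof (rule weierstrass_transform[OF adm, where a = 1 and b = c and c = 0 and d = t' and e = t and f = 1 and g = 0 and h = 1 and i = 0])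
      fix \<psi> assume a: "admissible \<psi>" and \<psi>: "\<And>x y z. \<psi> (vec3 x y z) = \<phi> (vec3 (1*x + c*y + 0*z) (t'*x + t*y + 1*z) (0*x + 1*y + 0*z))"
      have "\<psi> (vec3 x y z) = cubic_poly (d3 + t'^2) 0 0 0 (2*t') (2*t + 2*c*t') (2*(c*t + b)) 1 c 0 x y z" for x y z
        unfolding \<psi> \<phi> cubic_poly_def using flex(1-3) by algebra
      then show "weierstrass \<psi>" by (rule weierstrass_flex[OF a]) (use flex(4) in simp)
    qed simp
  qed
  consider "b = 0" | "b > 0" | "b < 0" by linarith
  then show ?thesis
  proof cases
    case 1
    show ?thesis
    proof (rule weierstrass_transform[OF adm, where a = 0 and b = 0 and c = 1 and d = 0 and e = 1 and f = 0 and g = 1 and h = 0 and i = 0])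
      fix \<psi> assume a: "admissible \<psi>" and \<psi>: "\<And>x y z. \<psi> (vec3 x y z) = \<phi> (vec3 (0*x + 0*y + 1*z) (0*x + 1*y + 0*z) (1*x + 0*y + 0*z))"
      have "\<psi> (vec3 x y z) = cubic_poly d0 0 0 0 d1 0 1 d2 0 d3 x y z" for x y z
        unfolding \<psi> \<phi> cubic_poly_def using 1 by algebra
      then show "weierstrass \<psi>" by (rule weierstrass_flex[OF a]) simp
    qed simp
  next
    case 2
    then show ?thesis by (rule pos[OF adm \<phi>])
  next
    case 3
    show ?thesis
    proof (rule weierstrass_transform[OF adm, where a = 1 and b = 0 and c = 0 and d = 0 and e = "-1" and f = 0 and g = 0 and h = 0 and i = 1])
      fix \<psi> assume a: "admissible \<psi>" and \<psi>: "\<And>x y z. \<psi> (vec3 x y z) = \<phi> (vec3 (1*x + 0*y + 0*z) (0*x + -1*y + 0*z) (0*x + 0*y + 1*z))"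
      have "\<psi> (vec3 x y z) = cubic_poly d3 0 1 0 d2 0 0 d1 (2*-b) d0 x y z" for x y z
        unfolding \<psi> \<phi> cubic_poly_def by algebra
      then show "weierstrass \<psi>" by (rule pos[OF a]) (use 3 in simp)
    qed simp
  qed
qed

text \<open>The only real point on z = 0 is [0:1:0]. Translating x by g makes x = 0 the asymptote
  there, and a shear in y removes the terms x^2 y and x y z. The condition on \<open>m\<close> and
  \<open>u\<close> makes the new coefficient of x^3 positive.\<close>

lemma weierstrass_definite_monic:
  assumes adm: "admissible \<phi>" and \<phi>: "\<And>x y z. \<phi> (vec3 x y z) = cubic_poly u m 1 0 e f g h i j x y z" and def: "m^2 < 4*u"
  shows "weierstrass \<phi>"
proof -
  define \<mu> where "\<mu> = m/2"
  define \<beta> where "\<beta> = g*\<mu> - f/2"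
  define \<tau> where "\<tau> = \<mu>*g + \<beta>"
  define \<delta> where "\<delta> = u - \<mu>^2"
  have m: "m = 2*\<mu>" "f = 2*(g*\<mu> - \<beta>)" "u = \<delta> + \<mu>^2" by (simp_all add: \<mu>_def \<beta>_def \<delta>_def)
  have "\<delta> > 0" using def unfolding m by (simp add: power2_eq_square)
  define b where "b = (- 2*g*\<beta> - f*g + 2*g*\<tau> + i) / 2"
  have b: "2*b = - 2*g*\<beta> - f*g + 2*g*\<tau> + i" by (simp add: b_def)
  show ?thesis
  proof (rule weierstrass_transform[OF adm, where a = 1 and b = 0 and c = "-g" and d = "-\<mu>" and e = 1 and f = \<tau> and g = 0 and h = 0 and i = 1])
    fix \<psi> assume a: "admissible \<psi>" and \<psi>: "\<And>x y z. \<psi> (vec3 x y z) = \<phi> (vec3 (1*x + 0*y + -g*z) (-\<mu>*x + 1*y + \<tau>*z) (0*x + 0*y + 1*z))"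
    have "\<psi> (vec3 x y z) = cubic_poly \<delta> 0 1 0 (-3*g*\<delta> + e - f*\<mu> + g*\<mu>^2) 0 0
       (\<beta>^2 + 3*g^2*\<delta> - 2*g*e + f*(\<tau> + g*\<mu>) - 2*g*\<mu>*\<tau> + h - i*\<mu>) (2*b)
       (-g*\<beta>^2 - g^3*\<delta> + e*g^2 - f*g*\<tau> + g*\<tau>^2 - h*g + i*\<tau> + j) x y z" for x y z
      unfolding \<psi> \<phi> cubic_poly_def b m \<tau>_def by algebra
    then show "weierstrass \<psi>" by (rule weierstrass_definite_normal[OF a]) fact
  qed simp
qed

lemma weierstrass_definite:
  assumes adm: "admissible \<phi>" and \<phi>: "\<And>x y. \<phi> (vec3 x y 0) = x * (u*x^2 + m*x*y + w*y^2)" and def: "m^2 < 4*u*w"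
  shows "weierstrass \<phi>"
proof -
  have w: "w \<noteq> 0" using def by (auto simp: not_less)
  obtain a b c d e f g h i j where \<phi>': "\<And>x y z. \<phi> (vec3 x y z) = cubic_poly a b c d e f g h i j x y z"
    using adm unfolding admissible_def cubic_form_def by blast
  have eq: "a*x^3 + b*x^2*y + c*x*y^2 + d*y^3 = x * (u*x^2 + m*x*y + w*y^2)" for x y
    using \<phi>[of x y] \<phi>'[of x y 0] by (simp add: cubic_poly_def)
  have abcd: "a = u" "b = m" "c = w" "d = 0" using eq[of 1 0] eq[of 0 1] eq[of 1 1] eq[of 1 "-1"] by auto
  show ?thesis
  proof (rule weierstrass_transform[OF adm, where a = "1/w" and b = 0 and c = 0 and d = 0 and e = 1 and f = 0 and g = 0 and h = 0 and i = 1])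
    fix \<psi> assume a: "admissible \<psi>" and \<psi>: "\<And>x y z. \<psi> (vec3 x y z) = \<phi> (vec3 (1/w*x + 0*y + 0*z) (0*x + 1*y + 0*z) (0*x + 0*y + 1*z))"
    have "\<psi> (vec3 x y z) = cubic_poly (u/w^3) (m/w^2) 1 0 (e/w^2) (f/w) g (h/w) i j x y z" for x y z
      unfolding \<psi> \<phi>' abcd cubic_poly_def using w by (simp add: power_divide)
    moreover have "(m/w^2)^2 < 4*(u/w^3)"
    proof -
      have "(m/w^2)^2 = m^2 / (w^2)^2" by (simp add: power_divide)
      also have "\<dots> < (4*u*w) / (w^2)^2" using def w by (intro divide_strict_right_mono) auto
      also have "\<dots> = 4*(u/w^3)" using w by (simp add: field_simps power2_eq_square power3_eq_cube)
      finally show ?thesis .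
    qed
    ultimately show "weierstrass \<psi>" by (rule weierstrass_definite_monic[OF a])
  qed (use w in simp)
qed

text \<open>At a smooth point that is no flex, a small rotation of the tangent line in the right direction
  meets the cubic in a single real point.\<close>

lemma weierstrass_smooth:
  assumes adm: "admissible \<phi>" and \<phi>: "\<And>x y z. \<phi> (vec3 x y z) = cubic_poly a b c d e f g 0 n 0 x y z" and n: "n \<noteq> 0"
  shows "weierstrass \<phi>"
proof (cases "e = 0")
  case True
  show ?thesis
  proof (rule weierstrass_transform[OF adm, where a = 1 and b = 0 and c = 0 and d = 0 and e = 0 and f = 1 and g = 0 and h = 1 and i = 0])
    fix \<psi> assume adm: "admissible \<psi>" and \<psi>: "\<And>x y z. \<psi> (vec3 x y z) = \<phi> (vec3 (1*x + 0*y + 0*z) (0*x + 0*y + 1*z) (0*x + 1*y + 0*z))"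
    have "\<psi> (vec3 x y z) = cubic_poly a 0 0 0 b f n c g d x y z" for x y z
      unfolding \<psi> \<phi> cubic_poly_def using True by algebra
    then show "weierstrass \<psi>" by (rule weierstrass_flex[OF adm _ n])
  qed simp
next
  case False
  \<comment> \<open>The discriminant of \<phi> restricted to the line y = \<eta> z, divided by
    \<eta>. Its value at 0 is -4 e^3 n.\<close>
  define E where "E \<eta> = 18*a*(e+b*\<eta>)*\<eta>*(f+c*\<eta>)*(n+g*\<eta>+d*\<eta>^2) - 4*(e+b*\<eta>)^3*(n+g*\<eta>+d*\<eta>^2) + (e+b*\<eta>)^2*\<eta>*(f+c*\<eta>)^2
     - 4*a*\<eta>^2*(f+c*\<eta>)^3 - 27*a^2*\<eta>*(n+g*\<eta>+d*\<eta>^2)^2" for \<eta>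
  have E0: "E 0 \<noteq> 0" using False n by (simp add: E_def)
  have "isCont (\<lambda>t. E 0 * E (- t * E 0)) 0" unfolding E_def by (intro continuous_intros)
  then have "((\<lambda>t. E 0 * E (- t * E 0)) \<longlongrightarrow> E 0 * E 0) (at_right 0)"
    by (auto simp: isCont_def intro: tendsto_mono[OF at_le])
  then have "\<forall>\<^sub>F t in at_right 0. E 0 * E (- t * E 0) > 0"
    by (rule order_tendstoD(1)) (use E0 in \<open>auto simp: zero_less_mult_iff\<close>)
  moreover have "\<forall>\<^sub>F t in at_right 0. t > (0::real)" by (simp add: eventually_at_right_less)
  ultimately have "\<forall>\<^sub>F t in at_right 0. E 0 * E (- t * E 0) > 0 \<and> t > 0" by (rule eventually_conj)
  then obtain t where t: "E 0 * E (- t * E 0) > 0" "t > 0"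
    using eventually_happens'[OF trivial_limit_at_right_real] by blast
  \<comment> \<open>The sign of \<eta> is opposite to that of \<open>E 0\<close>, and t is so small
    that \<open>E\<close> keeps its sign; this makes the discriminant negative.\<close>
  define \<eta> where "\<eta> = - t * E 0"
  have "\<eta> * E \<eta> = - (t * (E 0 * E (- t * E 0)))" by (simp add: \<eta>_def)
  also have "\<dots> < 0" using t by simp
  finally have neg: "\<eta> * E \<eta> < 0" .
  have "18*a*(e+b*\<eta>)*(\<eta>*(f+c*\<eta>))*(\<eta>*(n+g*\<eta>+d*\<eta>^2)) - 4*(e+b*\<eta>)^3*(\<eta>*(n+g*\<eta>+d*\<eta>^2)) + (e+b*\<eta>)^2*(\<eta>*(f+c*\<eta>))^2
     - 4*a*(\<eta>*(f+c*\<eta>))^3 - 27*a^2*(\<eta>*(n+g*\<eta>+d*\<eta>^2))^2 = \<eta> * E \<eta>"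
    unfolding E_def by algebra
  with neg have disc: "18*a*(e+b*\<eta>)*(\<eta>*(f+c*\<eta>))*(\<eta>*(n+g*\<eta>+d*\<eta>^2)) - 4*(e+b*\<eta>)^3*(\<eta>*(n+g*\<eta>+d*\<eta>^2)) + (e+b*\<eta>)^2*(\<eta>*(f+c*\<eta>))^2
     - 4*a*(\<eta>*(f+c*\<eta>))^3 - 27*a^2*(\<eta>*(n+g*\<eta>+d*\<eta>^2))^2 < 0" by simp
  obtain r s u m w where fac: "(r, s) \<noteq> (0, 0)" "m^2 < 4*u*w"
    "\<And>x z. a*x^3 + (e+b*\<eta>)*x^2*z + (\<eta>*(f+c*\<eta>))*x*z^2 + (\<eta>*(n+g*\<eta>+d*\<eta>^2))*z^3 = (r*x + s * z) * (u*x^2 + m*x*z + w*z^2)"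
    by (rule disc_neg_factor[OF disc]) blast
  have rs: "r^2 + s^2 > 0" using fac(1) by (auto simp: sum_power2_gt_zero_iff)
  show ?thesis
  \<comment> \<open>The line y = \<eta> z becomes z = 0, and on it a rotation turns the real linear
    factor into a multiple of x.\<close>
  proof (rule weierstrass_transform[OF adm, where a = r and b = "-s" and c = 0 and d = "\<eta> * s" and e = "\<eta> * r" and f = 1 and g = s and h = r and i = 0])
    show "r * (\<eta> * r * 0 - 1 * r) - - s * (\<eta> * s * 0 - 1 * s) + 0 * (\<eta> * s * r - \<eta> * r * s) \<noteq> 0"
      using rs by (simp add: power2_eq_square)
    fix \<psi> assume adm: "admissible \<psi>" and \<psi>: "\<And>x y z. \<psi> (vec3 x y z) = \<phi> (vec3 (r*x + -s*y + 0*z) (\<eta> * s * x + \<eta>*r*y + 1*z) (s*x + r*y + 0*z))"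
    define k where "k = r^2 + s^2"
    define u' m' w' where "u' = k*(u*r^2 + m*r * s + w * s^2)" and "m' = k*(-2*u*r * s + m*(r^2 - s^2) + 2*w*r * s)" and "w' = k*(u * s^2 - m*r * s + w*r^2)"
    have "\<psi> (vec3 x y 0) = x * (u'*x^2 + m'*x*y + w'*y^2)" for x y
    proof -
      define X Z where "X = r*x - s*y" and "Z = s*x + r*y"
      have "\<psi> (vec3 x y 0) = a*X^3 + (e+b*\<eta>)*X^2*Z + (\<eta>*(f+c*\<eta>))*X*Z^2 + (\<eta>*(n+g*\<eta>+d*\<eta>^2))*Z^3"
        unfolding \<psi> \<phi> cubic_poly_def X_def Z_def by algebra
      also have "\<dots> = (r*X + s*Z) * (u*X^2 + m*X*Z + w*Z^2)" by (rule fac(3))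
      also have "\<dots> = x * (u'*x^2 + m'*x*y + w'*y^2)"
        unfolding X_def Z_def u'_def m'_def w'_def k_def by algebra
      finally show ?thesis .
    qed
    moreover have "m'^2 < 4*u'*w'"
    proof -
      have "m'^2 - 4*u'*w' = k^4 * (m^2 - 4*u*w)"
        unfolding u'_def m'_def w'_def k_def by algebra
      moreover have "k^4 * (m^2 - 4*u*w) < 0" by (rule mult_pos_neg) (use fac(2) rs[folded k_def] in auto)
      ultimately show ?thesis by simp
    qed
    ultimately show "weierstrass \<psi>" by (rule weierstrass_definite[OF adm])
  qed
qed

section \<open>Coordinates adapted to a real point\<close>

lemma weierstrass_point:
  assumes adm: "admissible \<phi>" and 0: "\<phi> (vec3 0 0 1) = 0"
  shows "weierstrass \<phi>"
proof -
  obtain a b c d e f g h i j where \<phi>: "\<And>x y z. \<phi> (vec3 x y z) = cubic_poly a b c d e f g h i j x y z"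
    using adm unfolding admissible_def cubic_form_def by blast
  have j: "j = 0" using 0 by (simp add: \<phi> cubic_poly_def)
  show ?thesis
  proof (cases "h = 0 \<and> i = 0")
    case True
    then show ?thesis using weierstrass_singular[OF adm, of a b c d e f g] \<phi> j by simp
  next
    case False
    then have n: "h^2 + i^2 \<noteq> 0" by (simp add: sum_power2_eq_zero_iff)
    show ?thesis
    proof (rule weierstrass_transform[OF adm, where a = i and b = h and c = 0 and d = "-h" and e = i and f = 0 and g = 0 and h = 0 and i = 1])
      show "i * (i * 1 - 0 * 0) - h * (- h * 1 - 0 * 0) + 0 * (- h * 0 - i * 0) \<noteq> 0"
        using False by (auto simp: sum_squares_eq_zero_iff)
      fix \<psi> assume adm: "admissible \<psi>" and \<psi>: "\<And>x y z. \<psi> (vec3 x y z) = \<phi> (vec3 (i*x + h*y + 0*z) (-h*x + i*y + 0*z) (0*x + 0*y + 1*z))"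
      have "\<psi> (vec3 x y z) = cubic_poly
          (a*i^3 - b*i^2*h + c*i*h^2 - d*h^3) (3*a*i^2*h + b*(i^3 - 2*i*h^2) + c*(h^3 - 2*h*i^2) + 3*d*h^2*i)
          (3*a*i*h^2 + b*(2*i^2*h - h^3) + c*(i^3 - 2*h^2*i) - 3*d*h*i^2) (a*h^3 + b*h^2*i + c*h*i^2 + d*i^3)
          (e*i^2 - f*i*h + g*h^2) (2*e*i*h + f*(i^2 - h^2) - 2*g*h*i) (e*h^2 + f*h*i + g*i^2) 0 (h^2 + i^2) 0 x y z" for x y z
        unfolding \<psi> \<phi> cubic_poly_def j by algebra
      then show "weierstrass \<psi>" by (rule weierstrass_smooth[OF adm _ n])
    qed
  qed
qed

theorem weierstrass_if_zero:
  assumes adm: "admissible \<phi>" and v: "v \<noteq> 0" "\<phi> v = 0"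
  shows "weierstrass \<phi>"
proof -
  define x y z where "x = v $ 1" "y = v $ 2" "z = v $ 3"
  have vv: "v = vec3 x y z" by (simp add: x_y_z_def vec3_eta)
  have 0: "\<phi> (vec3 x y z) = 0" using v(2) vv by simp
  have "x \<noteq> 0 \<or> y \<noteq> 0 \<or> z \<noteq> 0" using v(1) by (auto simp: x_y_z_def vec_eq_iff forall_3)
  then consider "z \<noteq> 0" | "y \<noteq> 0" | "x \<noteq> 0" by blast
  then show ?thesis
  proof cases
    case 1
    show ?thesis
      by (rule weierstrass_transform[OF adm, where a = 1 and b = 0 and c = x and d = 0 and e = 1 and f = y and g = 0 and h = 0 and i = z])
        (use 1 0 in \<open>auto intro!: weierstrass_point\<close>)
  next
    case 2
    show ?thesis
      by (rule weierstrass_transform[OF adm, where a = 1 and b = 0 and c = x and d = 0 and e = 0 and f = y and g = 0 and h = 1 and i = z])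
        (use 2 0 in \<open>auto intro!: weierstrass_point\<close>)
  next
    case 3
    show ?thesis
      by (rule weierstrass_transform[OF adm, where a = 0 and b = 0 and c = x and d = 1 and e = 0 and f = y and g = 0 and h = 1 and i = z])
        (use 3 0 in \<open>auto intro!: weierstrass_point\<close>)
  qed
qed

section \<open>Irreducible polynomials\<close>

lemma poly_eq_sum_atMost:
  fixes p :: "'a :: comm_semiring_1 poly"
  assumes "\<And>i. i > n \<Longrightarrow> coeff p i = 0"
  shows "poly p x = (\<Sum>i\<le>n. coeff p i * x ^ i)"
proof -
  have "degree p \<le> n" using assms by (intro degree_le) auto
  have "poly p x = (\<Sum>i\<le>degree p. coeff p i * x ^ i)" by (rule poly_altdef)
  also have "\<dots> = (\<Sum>i\<le>n. coeff p i * x ^ i)"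
    using \<open>degree p \<le> n\<close> by (intro sum.mono_neutral_left) (auto simp: coeff_eq_0)
  finally show ?thesis .
qed

lemma eval3_vec3: "eval3 F (vec3 x y z) = poly (poly (poly F [:[:z:]:]) [:y:]) x"
  by (simp add: eval3_def vector_3)

lemma cubic_form_eval3:
  assumes "homogeneous 3 F"
  shows "cubic_form (eval3 F)"
proof -
  define C where "C i j k = coeff (coeff (coeff F k) j) i" for i j k
  have C: "C i j k = 0" if "i + j + k \<noteq> 3" for i j k
    using assms that unfolding homogeneous_def C_def by blast
  have c0: "coeff (coeff F k) j = 0" if "j + k > 3" for j k
    by (rule poly_eqI) (use C[of _ j k] that in \<open>simp add: C_def\<close>)
  have c1: "coeff F k = 0" if "k > 3" for k
    by (rule poly_eqI) (use c0[of _ k] that in simp)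
  have "eval3 F (vec3 x y z) = (\<Sum>k\<le>3. \<Sum>j\<le>3. \<Sum>i\<le>3. C i j k * x^i * y^j * z^k)" for x y z
  proof -
    have 3: "poly (coeff (coeff F k) j) x = (\<Sum>i\<le>3. C i j k * x^i)" for j k
      unfolding C_def by (rule poly_eq_sum_atMost) (use C[of _ j k] in \<open>simp add: C_def\<close>)
    have 2: "poly (poly (coeff F k) [:y:]) x = (\<Sum>j\<le>3. \<Sum>i\<le>3. C i j k * x^i * y^j)" for k
    proof -
      have "poly (coeff F k) [:y:] = (\<Sum>j\<le>3. coeff (coeff F k) j * [:y:]^j)"
        by (rule poly_eq_sum_atMost) (use c0 in simp)
      then show ?thesis by (simp add: poly_sum 3 sum_distrib_right)
    qed
    have "poly F [:[:z:]:] = (\<Sum>k\<le>3. coeff F k * [:[:z:]:]^k)"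
      by (rule poly_eq_sum_atMost) (use c1 in simp)
    then show ?thesis by (simp add: eval3_vec3 poly_sum 2 sum_distrib_right)
  qed
  then have "\<forall>x y z. eval3 F (vec3 x y z) = cubic_poly (C 3 0 0) (C 2 1 0) (C 1 2 0) (C 0 3 0)
      (C 2 0 1) (C 1 1 1) (C 0 2 1) (C 1 0 2) (C 0 1 2) (C 0 0 3) x y z"
    by (simp add: numeral_3_eq_3 numeral_2_eq_2 C cubic_poly_def algebra_simps)
  then show ?thesis unfolding cubic_form_def by blast
qed

lemma poly_eqI_real:
  fixes p q :: "real poly"
  assumes "\<And>x. poly p x = poly q x"
  shows "p = q"
  using assms poly_eq_poly_eq_iff by blast

lemma poly_poly_eq_0:
  fixes p :: "real poly poly"
  assumes "\<And>x y. poly (poly p [:y:]) x = 0"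
  shows "p = 0"
proof (rule ccontr)
  assume "p \<noteq> 0"
  then have fin: "finite {a. poly p a = 0}" by (rule poly_roots_finite)
  have "poly p [:y:] = 0" for y by (rule poly_eqI_real) (use assms in simp)
  then have "range (\<lambda>y :: real. [:y:]) \<subseteq> {a. poly p a = 0}" by auto
  then have "finite (range (\<lambda>y :: real. [:y:]))" using fin finite_subset by blast
  moreover have "inj (\<lambda>y :: real. [:y:])" by (rule injI) simp
  ultimately show False using finite_imageD infinite_UNIV_char_0 by blast
qed

lemma unit_poly3:
  fixes G :: "real poly poly poly"
  assumes "G dvd 1"
  obtains c where "c \<noteq> 0" "G = [:[:[:c:]:]:]"
  using assms by (auto simp: is_unit_poly_iff dvd_field_iff)

text \<open>A factor that is no unit differs from the irreducible \<open>F\<close> by a constant, so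
  all its monomials have degree 3. One monomial of another degree excludes it.\<close>

lemma no_linear_factor:
  fixes L :: "real poly poly poly"
  assumes "homogeneous 3 F" "irreducible F" "L dvd F" "\<not> L dvd 1"
    and "i + j + k \<noteq> 3" "coeff (coeff (coeff L k) j) i \<noteq> 0"
  shows False
proof -
  obtain G where G: "F = L * G" using assms(3) by blast
  then have "G dvd 1" using irreducibleD[OF assms(2)] assms(4) by blast
  then obtain c where c: "c \<noteq> 0" "G = [:[:[:c:]:]:]" by (rule unit_poly3)
  have "F = smult [:[:c:]:] L" unfolding G c(2) by simp
  then have "coeff (coeff (coeff F k) j) i = c * coeff (coeff (coeff L k) j) i" by simp
  then show False using assms(1,5,6) c(1) unfolding homogeneous_def by auto
qed

text \<open>The equation of the line is solved for z, for y or for x. Because the polynomials are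
  nested, the linear factor appears at a different level in each case: as a root of
  \<open>F\<close>, of its coefficients, or of their coefficients.\<close>

lemma vanishes_on_no_line_eval3:
  assumes hom: "homogeneous 3 F" and irr: "irreducible F"
  shows "vanishes_on_no_line (eval3 F)"
  unfolding vanishes_on_no_line_def
proof (intro allI impI, rule ccontr)
  fix n :: "real^3"
  assume n: "n \<noteq> 0" and "\<nexists>v. n \<bullet> v = 0 \<and> eval3 F v \<noteq> 0"
  then have van: "n \<bullet> v = 0 \<Longrightarrow> eval3 F v = 0" for v by blast
  define a b c where "a = n $ 1" "b = n $ 2" "c = n $ 3"
  have van: "poly (poly (poly F [:[:z:]:]) [:y:]) x = 0" if "a*x + b*y + c*z = 0" for x y z
    using van[of "vec3 x y z"] that by (simp add: inner_vec3 eval3_vec3 a_b_c_def)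
  have "a \<noteq> 0 \<or> b \<noteq> 0 \<or> c \<noteq> 0" using n by (auto simp: a_b_c_def vec_eq_iff forall_3)
  then consider "c \<noteq> 0" | "c = 0" "b \<noteq> 0" | "c = 0" "b = 0" "a \<noteq> 0" by blast
  then show False
  proof cases
    case 1
    define r where "r = [:[:0, -a/c:], [:-b/c:]:]"
    have "poly F r = 0"
    proof (rule poly_poly_eq_0)
      fix x y
      have comp: "poly (poly (poly F r) [:y:]) x = poly (poly (poly F [:[:poly (poly r [:y:]) x:]:]) [:y:]) x"
      proof -
        have "poly (poly (poly F r) [:y:]) x = (\<Sum>k\<le>degree F. poly (poly (coeff F k) [:y:]) x * (poly (poly r [:y:]) x) ^ k)"
          by (simp add: poly_altdef[of F] poly_sum)
        moreover have "poly (poly (poly F [:[:z:]:]) [:y:]) x = (\<Sum>k\<le>degree F. poly (poly (coeff F k) [:y:]) x * z ^ k)" for z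
          by (simp add: poly_altdef[of F] poly_sum)
        ultimately show ?thesis by simp
      qed
      have "poly (poly r [:y:]) x = -(a*x + b*y)/c" by (simp add: r_def 1 field_simps)
      then show "poly (poly (poly F r) [:y:]) x = 0" unfolding comp using 1 by (intro van) simp
    qed
    then have "[:- r, 1:] dvd F" by (simp add: poly_eq_0_iff_dvd)
    then show False
      by (rule no_linear_factor[OF hom irr, of _ 0 0 1]) (auto simp: is_unit_poly_iff)
  next
    case 2
    define r where "r = [:0, -a/b:]"
    have "[:- r, 1:] dvd coeff F k" for k
    proof -
      have "poly (coeff F k) r = 0"
      proof (rule poly_eqI_real)
        fix x
        define y where "y = - a*x/b"
        define P where "P = map_poly (\<lambda>q. poly (poly q [:y:]) x) F"
        have cP: "coeff P k = poly (poly (coeff F k) [:y:]) x" for k by (simp add: P_def coeff_map_poly)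
        have "poly P z = poly (poly (poly F [:[:z:]:]) [:y:]) x" for z
        proof -
          have "poly P z = (\<Sum>k\<le>degree F. coeff P k * z^k)"
            by (intro poly_eq_sum_atMost) (simp add: cP coeff_eq_0)
          then show ?thesis by (simp add: cP poly_altdef[of F] poly_sum)
        qed
        then have "P = 0" using van[of x y] 2 by (intro poly_eqI_real) (simp add: y_def)
        then have "poly (poly (coeff F k) [:y:]) x = 0" using cP[of k] by simp
        moreover have "poly (poly (coeff F k) r) x = poly (poly (coeff F k) [:y:]) x"
          by (simp add: poly_altdef[of "coeff F k"] poly_sum r_def y_def mult.commute)
        ultimately show "poly (poly (coeff F k) r) x = poly 0 x" by simp
      qed
      then show ?thesis by (simp add: poly_eq_0_iff_dvd)
    qed
    then have "[:[:- r, 1:]:] dvd F" by (simp add: const_poly_dvd_iff)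
    then show False
      by (rule no_linear_factor[OF hom irr, of _ 0 1 0]) (auto simp: is_unit_poly_iff)
  next
    case 3
    have "[:0, 1:] dvd coeff (coeff F k) j" for k j
    proof -
      define P where "P y = map_poly (\<lambda>q. poly (poly q [:y:]) (0::real)) F" for y
      have cP: "coeff (P y) k = poly (poly (coeff F k) [:y:]) 0" for y k by (simp add: P_def coeff_map_poly)
      have "poly (P y) z = poly (poly (poly F [:[:z:]:]) [:y:]) 0" for y z
      proof -
        have "poly (P y) z = (\<Sum>k\<le>degree F. coeff (P y) k * z^k)"
          by (intro poly_eq_sum_atMost) (simp add: cP coeff_eq_0)
        then show ?thesis by (simp add: cP poly_altdef[of F] poly_sum)
      qed
      then have "P y = 0" for y using van[of 0 y] 3 by (intro poly_eqI_real) simp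
      then have z: "poly (poly (coeff F k) [:y:]) 0 = 0" for y using cP[of y k] by simp
      define Q where "Q = map_poly (\<lambda>q. poly q (0::real)) (coeff F k)"
      have cQ: "coeff Q j = poly (coeff (coeff F k) j) 0" for j by (simp add: Q_def coeff_map_poly)
      have "poly Q y = 0" for y
      proof -
        have "poly Q y = (\<Sum>j\<le>degree (coeff F k). coeff Q j * y^j)"
          by (intro poly_eq_sum_atMost) (simp add: cQ coeff_eq_0)
        then show ?thesis using z[of y] by (simp add: cQ poly_altdef[of "coeff F k"] poly_sum)
      qed
      then have "Q = 0" by (intro poly_eqI_real) simp
      then have "poly (coeff (coeff F k) j) 0 = 0" using cQ[of j] by simp
      then show ?thesis using poly_eq_0_iff_dvd[of "coeff (coeff F k) j" 0] by simp
    qed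
    then have "[:[:[:0, 1:]:]:] dvd F" by (simp add: const_poly_dvd_iff)
    then show False
      by (rule no_linear_factor[OF hom irr, of _ 1 0 0]) (auto simp: is_unit_poly_iff)
  qed
qed

theorem weierstrass_eval3:
  assumes "homogeneous 3 F" "irreducible F" "v \<noteq> 0" "eval3 F v = 0"
  shows "weierstrass (eval3 F)"
  using weierstrass_if_zero[of "eval3 F" v] cubic_form_eval3 vanishes_on_no_line_eval3 assms
  by (simp add: admissible_def)

section \<open>The bound\<close>

text \<open>In Weierstrass coordinates the dual points are affine points, points [1:\<mu>:0] and
  possibly [0:1:0]. The second kind is off the cubic and counts towards m; the third is the flex and
  takes the unit reserved in \<open>weierstrass_card_le\<close>.\<close>

lemma arrangement_weierstrass_bound:
  fixes R :: "(real^3) set"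
  assumes fin: "finite R" and R0: "0 \<notin> R"
    and nonprop: "\<And>r r' c. r \<in> R \<Longrightarrow> r' \<in> R \<Longrightarrow> r = c *\<^sub>R r' \<Longrightarrow> r = r'"
    and sm: "sides_meet R" and dn: "double_neighbours_pencil R" and wei: "weierstrass \<phi>"
  shows "8 * card {r\<in>R. \<phi> r = 0} \<le> 7 * card R + 21"
proof -
  obtain N :: "real^3^3" and \<kappa> p q where N: "invertible N" "\<kappa> \<noteq> 0"
    and \<phi>N: "\<And>x y z. \<phi> (N *v vec3 x y z) = \<kappa> * (y^2 * z - x^3 - p*x*z^2 - q*z^3)"
    using wei unfolding weierstrass_def by blast
  obtain N' where N': "N ** N' = mat 1" "N' ** N = mat 1" using N(1) unfolding invertible_def by blast
  define w1 w2 w3 where "w1 r = (N' *v r) $ 1" and "w2 r = (N' *v r) $ 2" and "w3 r = (N' *v r) $ 3" for r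
  note w_defs = w1_def w2_def w3_def
  have N'eq: "N' *v r = vec3 (w1 r) (w2 r) (w3 r)" for r unfolding w_defs by (simp add: vec3_eta)
  have Nw: "N *v vec3 (w1 r) (w2 r) (w3 r) = r" for r
    by (simp add: N'(1) matrix_vector_mul_assoc flip: N'eq)
  have \<phi>: "\<phi> r = \<kappa> * ((w2 r)^2 * w3 r - (w1 r)^3 - p * w1 r * (w3 r)^2 - q * (w3 r)^3)" for r
    using \<phi>N[of "w1 r" "w2 r" "w3 r"] by (simp add: Nw)
  \<comment> \<open>The point of the original plane that corresponds to the line a x + b y + c z = 0
    in the new coordinates of the dual plane.\<close>
  define ln where "ln a b c = a *\<^sub>R N' $ 1 + b *\<^sub>R N' $ 2 + c *\<^sub>R N' $ 3" for a b c
  have row: "r \<bullet> N' $ k = (N' *v r) $ k" for r k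
    by (simp add: matrix_vector_mult_def inner_vec_def mult.commute)
  have ln: "r \<bullet> ln a b c = a * w1 r + b * w2 r + c * w3 r" for r a b c
    by (simp add: ln_def inner_add_right row w_defs)
  have wne: "w1 r \<noteq> 0 \<or> w2 r \<noteq> 0 \<or> w3 r \<noteq> 0" if "r \<in> R" for r
  proof (rule ccontr)
    assume "\<not> ?thesis"
    then have "N *v vec3 0 0 0 = r" using Nw[of r] by simp
    moreover have "vec3 0 0 0 = 0" by (simp add: vec_eq_iff forall_3 vector_3)
    ultimately show False using R0 that by simp
  qed
  have multiple: "r = r'" if "r \<in> R" "r' \<in> R" "w1 r = c * w1 r'" "w2 r = c * w2 r'" "w3 r = c * w3 r'" for r r' c
  proof (rule nonprop[OF that(1,2)])
    have "vec3 (w1 r) (w2 r) (w3 r) = c *\<^sub>R vec3 (w1 r') (w2 r') (w3 r')"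
      using that(3-5) by (simp add: vec_eq_iff forall_3 vector_3)
    then have "r = N *v (c *\<^sub>R vec3 (w1 r') (w2 r') (w3 r'))" using Nw[of r] by simp
    then show "r = c *\<^sub>R r'" by (simp add: matrix_vector_mult_scaleR Nw)
  qed
  define R1 R2 R3 where "R1 = {r\<in>R. w3 r \<noteq> 0}" and "R2 = {r\<in>R. w3 r = 0 \<and> w1 r \<noteq> 0}" and "R3 = {r\<in>R. w3 r = 0 \<and> w1 r = 0}"
  define pt where "pt r = (w1 r / w3 r, w2 r / w3 r)" for r
  define slo where "slo r = w2 r / w1 r" for r
  define S I where "S = pt ` R1" and "I = slo ` R2"
  have RR: "R = R1 \<union> R2 \<union> R3" by (auto simp: R1_def R2_def R3_def)
  have finR: "finite R1" "finite R2" "finite R3" using fin by (simp_all add: R1_def R2_def R3_def)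
  have finSI: "finite S" "finite I" using finR by (simp_all add: S_def I_def)
  have inj1: "inj_on pt R1"
  proof (rule inj_onI)
    fix r r' assume r: "r \<in> R1" "r' \<in> R1" "pt r = pt r'"
    then have "w1 r / w3 r = w1 r' / w3 r'" "w2 r / w3 r = w2 r' / w3 r'" "w3 r \<noteq> 0" "w3 r' \<noteq> 0"
      by (auto simp: pt_def R1_def)
    then show "r = r'" using r by (intro multiple[of r r' "w3 r / w3 r'"]) (auto simp: R1_def field_simps)
  qed
  have inj2: "inj_on slo R2"
  proof (rule inj_onI)
    fix r r' assume r: "r \<in> R2" "r' \<in> R2" "slo r = slo r'"
    then have "w2 r / w1 r = w2 r' / w1 r'" "w1 r \<noteq> 0" "w1 r' \<noteq> 0" "w3 r = 0" "w3 r' = 0"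
      by (auto simp: slo_def R2_def)
    then show "r = r'" using r by (intro multiple[of r r' "w1 r / w1 r'"]) (auto simp: R2_def field_simps)
  qed
  have R3w: "w2 r \<noteq> 0" if "r \<in> R3" for r using wne[of r] that by (auto simp: R3_def)
  have cR3: "card R3 \<le> 1"
  proof -
    have "r = r'" if "r \<in> R3" "r' \<in> R3" for r r'
      using that R3w[of r'] by (intro multiple[of r r' "w2 r / w2 r'"]) (auto simp: R3_def)
    then show ?thesis by (metis One_nat_def card_le_Suc0_iff_eq finR(3))
  qed
  have ln1: "r \<bullet> ln (-s) 1 (-t) = w3 r * gap s t (pt r)" if "r \<in> R1" for r s t
    using that by (simp add: ln gap_def pt_def R1_def field_simps)
  have ln2: "r \<bullet> ln (-s) 1 (-t) = w1 r * (slo r - s)" if "r \<in> R2" for r s t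
    using that by (simp add: ln slo_def R2_def field_simps)
  have ln3: "r \<bullet> ln (-s) 1 (-t) = w2 r" if "r \<in> R3" for r s t
    using that by (simp add: ln R3_def)
  have sma: "sides_meet_aff S I"
    unfolding sides_meet_aff_def
  proof (intro allI impI)
    fix s t :: "real \<Rightarrow> real" and a b p1 p2
    assume ab: "a < b" and cont: "continuous_on {a..b} s" "continuous_on {a..b} t" and p12: "p1 \<in> S" "p2 \<in> S" "p1 \<noteq> p2"
      and at_a: "\<forall>p\<in>S. (gap (s a) (t a) p = 0) = (p = p1)" "s a \<notin> I"
      and at_b: "\<forall>p\<in>S. (gap (s b) (t b) p = 0) = (p = p2)" "s b \<notin> I"
      and btw: "\<forall>\<tau>\<in>{a<..<b}. s \<tau> \<notin> I \<and> (\<forall>p\<in>S. gap (s \<tau>) (t \<tau>) p \<noteq> 0)"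
    obtain q1 q2 where q: "q1 \<in> R1" "p1 = pt q1" "q2 \<in> R1" "p2 = pt q2" using p12 by (auto simp: S_def)
    define u where "u \<tau> = ln (- s \<tau>) 1 (- t \<tau>)" for \<tau>
    have contu: "continuous_on {a..b} u" unfolding u_def ln_def by (intro continuous_intros cont)
    have zero: "r \<bullet> u \<tau> = 0 \<longleftrightarrow> r \<in> R1 \<and> gap (s \<tau>) (t \<tau>) (pt r) = 0" if "r \<in> R" "s \<tau> \<notin> I" for r \<tau>
    proof -
      consider "r \<in> R1" | "r \<in> R2" "r \<notin> R1" | "r \<in> R3" "r \<notin> R1" using \<open>r \<in> R\<close> by (auto simp: R1_def R2_def R3_def)
      then show ?thesis
      proof cases
        case 1
        then show ?thesis using ln1[OF 1] by (simp add: u_def R1_def)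
      next
        case 2
        then have "slo r \<noteq> s \<tau>" using that(2) unfolding I_def by (metis imageI)
        then show ?thesis using ln2[OF 2(1)] 2 by (simp add: u_def R2_def)
      next
        case 3
        then show ?thesis using ln3[OF 3(1)] R3w[OF 3(1)] by (simp add: u_def)
      qed
    qed
    have za: "\<forall>r\<in>R. r \<bullet> u a = 0 \<longleftrightarrow> r = q1"
    proof
      fix r assume "r \<in> R"
      then show "r \<bullet> u a = 0 \<longleftrightarrow> r = q1"
        using zero[OF _ at_a(2)] at_a(1) q inj_on_eq_iff[OF inj1, of r q1] by (auto simp: S_def)
    qed
    have zb: "\<forall>r\<in>R. r \<bullet> u b = 0 \<longleftrightarrow> r = q2"
    proof
      fix r assume "r \<in> R"
      then show "r \<bullet> u b = 0 \<longleftrightarrow> r = q2"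
        using zero[OF _ at_b(2)] at_b(1) q inj_on_eq_iff[OF inj1, of r q2] by (auto simp: S_def)
    qed
    have zt: "\<forall>\<tau>\<in>{a<..<b}. \<forall>r\<in>R. r \<bullet> u \<tau> \<noteq> 0"
      using zero btw by (auto simp: S_def)
    \<comment> \<open>The common point of the lines \<open>q1\<close> and \<open>q2\<close>: in the
      dual plane, the line joining \<open>p1\<close> and \<open>p2\<close>.\<close>
    define P where "P = ln (snd p2 - snd p1) (- (fst p2 - fst p1)) (snd p1 * (fst p2 - fst p1) - fst p1 * (snd p2 - snd p1))"
    have P: "r \<bullet> P = w3 r * turn p1 p2 (pt r)" if "r \<in> R1" for r
    proof -
      have "w1 r = w3 r * fst (pt r)" "w2 r = w3 r * snd (pt r)" using that by (simp_all add: pt_def R1_def)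
      then show ?thesis unfolding P_def ln turn_def by algebra
    qed
    have qP: "q1 \<bullet> P = 0" "q2 \<bullet> P = 0" using P[OF q(1)] P[OF q(3)] by (simp_all add: turn_def flip: q(2,4))
    have q12: "q1 \<in> R" "q2 \<in> R" "q1 \<noteq> q2" using q p12(3) by (auto simp: R1_def)
    obtain \<sigma> where \<sigma>: "\<sigma> \<in> {1, -1 :: real}" "\<forall>r\<in>R. 0 \<le> \<sigma> * (r \<bullet> u a) * (r \<bullet> P)"
      using sm[unfolded sides_meet_def, rule_format, OF ab contu q12] za zb zt qP by blast
    have "0 \<le> \<sigma> * gap (s a) (t a) (pt r) * turn p1 p2 (pt r)" if r: "r \<in> R1" for r
    proof -
      have "0 \<le> \<sigma> * (r \<bullet> u a) * (r \<bullet> P)" using \<sigma>(2) r by (simp add: R1_def)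
      also have "\<dots> = (w3 r)^2 * (\<sigma> * gap (s a) (t a) (pt r) * turn p1 p2 (pt r))"
        unfolding P[OF r] u_def ln1[OF r] by (simp add: power2_eq_square)
      finally show ?thesis using r by (simp add: R1_def zero_le_mult_iff)
    qed
    then show "\<exists>\<sigma>\<in>{1, - 1}. \<forall>p\<in>S. 0 \<le> \<sigma> * gap (s a) (t a) p * turn p1 p2 p"
      using \<sigma>(1) by (auto simp: S_def)
  qed
  have pa: "pencil_aff S I"
    unfolding pencil_aff_def
  proof (intro ballI allI impI)
    fix o' p1 p2 s1 s2 P P' P''
    assume oS: "o' \<in> S" "p1 \<in> S" "p2 \<in> S" and ne: "fst p1 \<noteq> fst o'" "fst p2 \<noteq> fst o'" "s1 < s2"
      and sl: "snd p1 - snd o' = s1 * (fst p1 - fst o')" "snd p2 - snd o' = s2 * (fst p2 - fst o')"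
      and pos: "\<forall>p\<in>S - {o', p1, p2}. 0 < (snd p - snd o' - s1 * (fst p - fst o')) * (snd p - snd o' - s2 * (fst p - fst o'))"
      and posI: "\<forall>\<mu>\<in>I. 0 < (\<mu> - s1) * (\<mu> - s2)"
      and PS: "P \<in> S - {o'}" "P' \<in> S - {o'}" "P'' \<in> S - {o'}"
    obtain r0 a b where r: "r0 \<in> R1" "o' = pt r0" "a \<in> R1" "p1 = pt a" "b \<in> R1" "p2 = pt b" using oS by (auto simp: S_def)
    define L where "L s = ln (-s) 1 (- (snd o' - s * fst o'))" for s
    have L1: "x \<bullet> L s = w3 x * (snd (pt x) - snd o' - s * (fst (pt x) - fst o'))" if "x \<in> R1" for x s
      unfolding L_def ln1[OF that] by (simp add: gap_def algebra_simps)
    have L2: "x \<bullet> L s = w1 x * (slo x - s)" if "x \<in> R2" for x s unfolding L_def ln2[OF that] ..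
    have L3: "x \<bullet> L s = w2 x" if "x \<in> R3" for x s unfolding L_def ln3[OF that] ..
    have w3: "w3 a \<noteq> 0" "w3 b \<noteq> 0" "r0 \<in> R" "a \<in> R" "b \<in> R" using r by (auto simp: R1_def)
    have "p1 \<noteq> o'" "p2 \<noteq> o'" using ne by auto
    moreover have "p1 \<noteq> p2" using sl ne by auto
    ultimately have dist: "r0 \<noteq> a" "r0 \<noteq> b" "a \<noteq> b" using r by auto
    have z: "r0 \<bullet> L s1 = 0" "a \<bullet> L s1 = 0" "r0 \<bullet> L s2 = 0" "b \<bullet> L s2 = 0"
      using L1[OF r(1)] L1[OF r(3)] L1[OF r(5)] sl r by simp_all
    have "a \<bullet> L s2 = w3 a * ((s1 - s2) * (fst p1 - fst o'))" "b \<bullet> L s1 = w3 b * ((s2 - s1) * (fst p2 - fst o'))"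
      unfolding L1[OF r(3)] L1[OF r(5)] r(4,6)[symmetric] sl by algebra+
    then have nz: "a \<bullet> L s2 \<noteq> 0" "b \<bullet> L s1 \<noteq> 0" using w3 ne by auto
    have pp: "(x \<bullet> L s1) * (x \<bullet> L s2) > 0" if x: "x \<in> R - {r0, a, b}" for x
    proof -
      consider "x \<in> R1" | "x \<in> R2" | "x \<in> R3" using x RR by blast
      then show ?thesis
      proof cases
        case 1
        then have "pt x \<in> S - {o', p1, p2}" using x r inj_on_eq_iff[OF inj1 1] by (auto simp: S_def)
        then have "0 < (w3 x)^2 * ((snd (pt x) - snd o' - s1 * (fst (pt x) - fst o')) * (snd (pt x) - snd o' - s2 * (fst (pt x) - fst o')))"
          using pos 1 by (simp add: R1_def)
        then show ?thesis unfolding L1[OF 1] by (simp add: power2_eq_square mult_ac)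
      next
        case 2
        then have "0 < (w1 x)^2 * ((slo x - s1) * (slo x - s2))" using posI by (simp add: R2_def I_def)
        then show ?thesis unfolding L2[OF 2] by (simp add: power2_eq_square mult_ac)
      next
        case 3
        then show ?thesis using R3w[OF 3] unfolding L3[OF 3] by (simp add: zero_less_mult_iff linorder_neq_iff disj_commute)
      qed
    qed
    have "\<exists>W. W \<noteq> 0 \<and> (\<forall>x\<in>R - {r0}. x \<bullet> W = 0)"
      using dn[unfolded double_neighbours_pencil_def, rule_format, OF w3(3-5) dist z nz pp] by blast
    then obtain W where W: "W \<noteq> 0" "\<And>x. x \<in> R - {r0} \<Longrightarrow> x \<bullet> W = 0" by blast
    define V where "V = W v* N"
    have "V v* N' = W" by (simp add: V_def vector_matrix_mul_assoc N')
    then have V0: "V \<noteq> 0" using W(1) by auto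
    have V: "V $ 1 * w1 x + V $ 2 * w2 x + V $ 3 * w3 x = 0" if "x \<in> R - {r0}" for x
    proof -
      have "V \<bullet> vec3 (w1 x) (w2 x) (w3 x) = W \<bullet> x" unfolding V_def by (simp add: dot_lmul_matrix Nw)
      then show ?thesis using W(2)[OF that] by (simp add: inner_vec3 inner_commute)
    qed
    have on: "V $ 1 * fst p + V $ 2 * snd p + V $ 3 = 0" if "p \<in> S - {o'}" for p
    proof -
      obtain x where x: "x \<in> R1" "p = pt x" using \<open>p \<in> S - {o'}\<close> by (auto simp: S_def)
      then have "x \<in> R - {r0}" using \<open>p \<in> S - {o'}\<close> r(2) by (auto simp: R1_def)
      moreover have "V $ 1 * w1 x + V $ 2 * w2 x + V $ 3 * w3 x = w3 x * (V $ 1 * fst p + V $ 2 * snd p + V $ 3)"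
        using x by (simp add: pt_def R1_def field_simps)
      ultimately show ?thesis using V[of x] x(1) by (simp add: R1_def)
    qed
    have "V $ 1 * turn P P' P'' = 0" "V $ 2 * turn P P' P'' = 0"
      unfolding turn_def using on[OF PS(1)] on[OF PS(2)] on[OF PS(3)] by algebra+
    moreover have "V $ 1 \<noteq> 0 \<or> V $ 2 \<noteq> 0"
      using V0 on[OF PS(1)] by (auto simp: vec_eq_iff forall_3)
    ultimately show "turn P P' P'' = 0" by auto
  qed
  define T where "T = {P\<in>S. (snd P)^2 = (fst P)^3 + p * fst P + q}"
  define m where "m = card (S - T) + card I"
  have bound: "card T + 1 \<le> 7 * m + 21"
    using weierstrass_card_le[OF finSI sma pa, of p q] by (simp add: T_def m_def)
  have \<phi>1: "\<phi> r = 0 \<longleftrightarrow> pt r \<in> T" if "r \<in> R1" for r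
  proof -
    have w: "w1 r = w3 r * fst (pt r)" "w2 r = w3 r * snd (pt r)" "w3 r \<noteq> 0" using that by (simp_all add: pt_def R1_def)
    have "\<phi> r = \<kappa> * (w3 r)^3 * ((snd (pt r))^2 - ((fst (pt r))^3 + p * fst (pt r) + q))"
      unfolding \<phi> using w(1,2) by algebra
    then show ?thesis using w(3) N(2) that by (auto simp: T_def S_def)
  qed
  have \<phi>2: "\<phi> r \<noteq> 0" if "r \<in> R2" for r using that N(2) by (simp add: \<phi> R2_def)
  have "card {r\<in>R. \<phi> r = 0} \<le> card T + 1"
  proof -
    have "{r\<in>R. \<phi> r = 0} \<subseteq> {r\<in>R1. pt r \<in> T} \<union> R3" using \<phi>1 \<phi>2 RR by blast
    then have "card {r\<in>R. \<phi> r = 0} \<le> card ({r\<in>R1. pt r \<in> T} \<union> R3)" using finR by (intro card_mono) auto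
    also have "\<dots> \<le> card {r\<in>R1. pt r \<in> T} + card R3" by (rule card_Un_le)
    also have "card {r\<in>R1. pt r \<in> T} = card (pt ` {r\<in>R1. pt r \<in> T})"
      by (rule card_image[symmetric]) (rule inj_on_subset[OF inj1], auto)
    also have "\<dots> \<le> card T" using finSI by (intro card_mono) (auto simp: T_def)
    finally show ?thesis using cR3 by simp
  qed
  moreover have "m \<le> card {r\<in>R. \<phi> r \<noteq> 0}"
  proof -
    have "S - T = pt ` {r\<in>R1. pt r \<notin> T}" by (auto simp: S_def)
    moreover have "inj_on pt {r\<in>R1. pt r \<notin> T}" by (rule inj_on_subset[OF inj1]) auto
    ultimately have "card (S - T) = card {r\<in>R1. pt r \<notin> T}" by (simp add: card_image)
    moreover have "card I = card R2" unfolding I_def using inj2 by (rule card_image)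
    moreover have "card ({r\<in>R1. pt r \<notin> T} \<union> R2) = card {r\<in>R1. pt r \<notin> T} + card R2"
      using fin by (intro card_Un_disjoint) (auto simp: R1_def R2_def)
    moreover have "{r\<in>R1. pt r \<notin> T} \<union> R2 \<subseteq> {r\<in>R. \<phi> r \<noteq> 0}" using \<phi>1 \<phi>2 RR by blast
    then have "card ({r\<in>R1. pt r \<notin> T} \<union> R2) \<le> card {r\<in>R. \<phi> r \<noteq> 0}" using fin by (intro card_mono) auto
    ultimately show ?thesis by (simp add: m_def)
  qed
  moreover have "card R = card {r\<in>R. \<phi> r = 0} + card {r\<in>R. \<phi> r \<noteq> 0}"
  proof -
    have "card ({r\<in>R. \<phi> r = 0} \<union> {r\<in>R. \<phi> r \<noteq> 0}) = card {r\<in>R. \<phi> r = 0} + card {r\<in>R. \<phi> r \<noteq> 0}"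
      by (rule card_Un_disjoint) (use fin in auto)
    moreover have "{r\<in>R. \<phi> r = 0} \<union> {r\<in>R. \<phi> r \<noteq> 0} = R" by auto
    ultimately show ?thesis by simp
  qed
  ultimately show ?thesis using bound by simp
qed

lemma eval3_hpoint:
  assumes "homogeneous 3 F" "a \<noteq> 0" "hpoint a \<in> zero_locus F"
  shows "eval3 F a = 0"
proof -
  obtain v where v: "v \<noteq> 0" "hpoint a = hpoint v" "eval3 F v = 0" using assms(3) unfolding zero_locus_def by blast
  then obtain c where c: "a = c *\<^sub>R v" using hpoint_eq_iff[OF assms(2)] by blast
  obtain p q r s t u k h i j where F: "\<And>x y z. eval3 F (vec3 x y z) = cubic_poly p q r s t u k h i j x y z"
    using cubic_form_eval3[OF assms(1)] unfolding cubic_form_def by blast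
  have "eval3 F v = cubic_poly p q r s t u k h i j (v $ 1) (v $ 2) (v $ 3)" using F[of "v $ 1" "v $ 2" "v $ 3"] by (simp add: vec3_eta)
  moreover have "eval3 F a = cubic_poly p q r s t u k h i j (c * v $ 1) (c * v $ 2) (c * v $ 3)"
    using F[of "a $ 1" "a $ 2" "a $ 3"] unfolding vec3_eta by (simp add: c)
  moreover have "\<dots> = c^3 * cubic_poly p q r s t u k h i j (v $ 1) (v $ 2) (v $ 3)"
    unfolding cubic_poly_def by algebra
  ultimately show ?thesis using v(3) by simp
qed

theorem proposition1p7:
  fixes \<A> \<B> :: "rp2 set set" and C :: "rp2 set" and n k :: nat
  assumes "simplicial_arrangement \<A>" and "card \<A> = n"
    and "irreducible_cubic_curve C"
    and "\<B> \<subseteq> \<A>" and "card \<B> = k"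
    and "\<forall>L\<in>\<B>. dual_point L \<in> C"
  shows "real n \<ge> 8 / 7 * real k - 3"
\<comment> \<open>A dual point on the curve supplies the real zero from which the Weierstrass form
  is built; without one, k = 0.\<close>
proof (cases "\<B> = {}")
  case True
  then show ?thesis using assms(5) by simp
next
  case False
  obtain F where F: "homogeneous 3 F" "irreducible F" "C = zero_locus F"
    using assms(3) unfolding irreducible_cubic_curve_def by blast
  have fin: "finite \<A>" and "\<forall>L\<in>\<A>. \<exists>a. a \<noteq> 0 \<and> L = proj_line a"
    using assms(1) unfolding simplicial_arrangement_def line_arrangement_def by auto
  then obtain \<nu> where \<nu>: "\<And>L. L \<in> \<A> \<Longrightarrow> \<nu> L \<noteq> 0 \<and> L = proj_line (\<nu> L)" by metis
  define R where "R = \<nu> ` \<A>"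
  have inj: "inj_on \<nu> \<A>" by (rule inj_onI) (metis \<nu>)
  have "proj_line ` R = \<A>" using \<nu> by (force simp: R_def)
  with assms(1) have simp: "simplicial_arrangement (proj_line ` R)" by simp
  have R: "finite R" "0 \<notin> R" using fin \<nu> by (auto simp: R_def)
  have np: "r = r'" if "r \<in> R" "r' \<in> R" and c: "r = c *\<^sub>R r'" for r r' c
  proof -
    note rR = that(1,2)
    obtain L L' where L: "L \<in> \<A>" "r = \<nu> L" "L' \<in> \<A>" "r' = \<nu> L'" using rR by (auto simp: R_def)
    have "c \<noteq> 0" using rR(1) c R(2) by auto
    then have "proj_line r = proj_line r'" unfolding proj_line_def c by simp
    then show ?thesis using L \<nu> by metis
  qed
  have on: "eval3 F (\<nu> L) = 0" if "L \<in> \<B>" for L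
  proof (rule eval3_hpoint[OF F(1)])
    have L: "\<nu> L \<noteq> 0" "L = proj_line (\<nu> L)" using \<nu> that assms(4) by blast+
    then show "\<nu> L \<noteq> 0" by blast
    have "dual_point L = hpoint (\<nu> L)" using L dual_point_proj_line by metis
    then show "hpoint (\<nu> L) \<in> zero_locus F" using assms(6) that F(3) by auto
  qed
  obtain L where "L \<in> \<B>" using False by blast
  then have "\<nu> L \<noteq> 0" "eval3 F (\<nu> L) = 0" using \<nu> assms(4) on by blast+
  then have "weierstrass (eval3 F)" by (rule weierstrass_eval3[OF F(1,2)])
  then have "8 * card {r\<in>R. eval3 F r = 0} \<le> 7 * card R + 21"
    using R np simplicial_sides_meet[OF simp R] simplicial_double_neighbours_pencil[OF simp R]
    by (intro arrangement_weierstrass_bound) auto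
  moreover have "card R = n" unfolding R_def using card_image[OF inj] assms(2) by simp
  moreover have "k \<le> card {r\<in>R. eval3 F r = 0}"
  proof -
    have "k = card (\<nu> ` \<B>)" using card_image[OF inj_on_subset[OF inj assms(4)]] assms(5) by simp
    also have "\<dots> \<le> card {r\<in>R. eval3 F r = 0}"
      using R(1) on assms(4) by (intro card_mono) (auto simp: R_def)
    finally show ?thesis .
  qed
  ultimately have "8 * k \<le> 7 * n + 21" by simp
  then have "8 * real k \<le> 7 * real n + 21" by linarith
  then show ?thesis by simp
qed

end
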